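(* Let $N=2$, $k>0$, $V_k(r)=\dfrac{1}{r^2(-\log(r/e))^{2+k}}$, and consider $$-\Delta u=\lambda V_k(|x|)f(u)\ \text{ in } B_1,\qquad u>0\ \text{ in } B_1,\qquad u=0\ \text{ on }\partial B_1. \qquad (P)$$ Let $p_s:=k+1$ and $p_c:=2k+1$. (i) When $f(u)=e^u$, $(P)$ has a unique radial singular solution, namely $$(\lambda_*,U_* )=\bigl(k,\ k\log(-\log(r/e))\bigr).$$ Moreover $U_*\in H^1_0(B_1)$, and $$\lambda(\beta)\to\lambda_*\quad\text{and}\quad u(r,\beta)\to U_*(r)\ \text{ in } C^2_{\mathrm{loc}}(0,1]\quad\text{as }\beta\to\infty.$$ (ii) When $f(u)=(1+u)^p$ with $p>p_s$, $(P)$ has the radial singular solution $$(\lambda_*,U_* )=\Bigl(\tfrac{k}{p-1}\bigl(1-\tfrac{k}{p-1}\bigr),\ (-\log(r/e))^{\frac{k}{p-1}}-1\Bigr).$$ Moreover $U_*\in H^1_0(B_1)$ if and only if $p>p_c$. In addition, when $p>p_c$, the radial singular solution of $(P)$ is unique, and $$\lambda(\beta)\to\lambda_*\quad\text{and}\quad u(r,\beta)\to U_*(r)\ \text{ in } C^2_{\mathrm{loc}}(0,1]\quad\text{as }\beta\to\infty.$$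
   Context: $B_1\subset\mathbb{R}^2$ is the open unit ball, $r=|x|$. A radial solution of $(P)$ is a pair $(\lambda,u)$ with $\lambda>0$, $u$ radial, continuous on $[0,1]$ in $r$, $C^2$ on $(0,1]$, satisfying $(P)$ (the equation pointwise for $0<r<1$). A radial singular solution of $(P)$ is a pair $(\lambda,U)$ with $\lambda>0$ and $U\in C^2(0,1]$ radial satisfying $(P)$ for $0<r\le1$ and $U(r)\to\infty$ as $r\to0$. Parameterization of radial solutions: if $f(u)=e^u$, for every $\beta\in\mathbb{R}$ there is exactly one radial solution $(\lambda,u)$ of $(P)$ with $u(0)+\log\lambda=\beta$; if $f(u)=(1+u)^p$ with $p\ge p_c$, for every $\beta\in(0,\infty)$ there is exactly one radial solution $(\lambda,u)$ of $(P)$ with $\lambda^{1/(p-1)}(u(0)+1)=\beta$. In each case it is denoted $(\lambda(\beta),u(\cdot,\beta))$. *)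

theory Defs
  imports "HOL-Analysis.Analysis"
begin

section \<open>Calculus on the plane\<close>

definition partial_deriv :: "2 \<Rightarrow> (real^2 \<Rightarrow> real) \<Rightarrow> real^2 \<Rightarrow> real" where
  "partial_deriv i u x = frechet_derivative u (at x) (axis i 1)"

definition gradient :: "(real^2 \<Rightarrow> real) \<Rightarrow> real^2 \<Rightarrow> real^2" where
  "gradient u x = (\<chi> i. partial_deriv i u x)"

definition laplacian :: "(real^2 \<Rightarrow> real) \<Rightarrow> real^2 \<Rightarrow> real" where
  "laplacian u x = (\<Sum>i\<in>UNIV. partial_deriv i (partial_deriv i u) x)"

primrec Ck_plane :: "nat \<Rightarrow> (real^2 \<Rightarrow> real) \<Rightarrow> bool" where
  "Ck_plane 0 u \<longleftrightarrow> continuous_on UNIV u"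
| "Ck_plane (Suc m) u \<longleftrightarrow> u differentiable_on UNIV \<and> (\<forall>i. Ck_plane m (partial_deriv i u))"

section \<open>The Sobolev space \<open>H\<^sup>1\<^sub>0\<close> of the unit disc\<close>

abbreviation B1 :: "(real^2) set" where
  "B1 \<equiv> ball 0 1"

definition test_function :: "(real^2 \<Rightarrow> real) \<Rightarrow> bool" where
  "test_function \<phi> \<longleftrightarrow> (\<forall>m. Ck_plane m \<phi>) \<and>
     compact (closure {x. \<phi> x \<noteq> 0}) \<and> closure {x. \<phi> x \<noteq> 0} \<subseteq> B1"

definition L2_B1 :: "(real^2 \<Rightarrow> 'b::euclidean_space) \<Rightarrow> bool" where
  "L2_B1 u \<longleftrightarrow> set_borel_measurable lebesgue B1 u \<and>
     set_integrable lebesgue B1 (\<lambda>x. (norm (u x))\<^sup>2)"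

text \<open>The closure of the test functions in the \<open>H\<^sup>1\<close> norm; the \<open>L\<^sup>2\<close> limit \<open>g\<close> of the
  gradients is then the weak gradient of \<open>u\<close>.\<close>

definition H10_B1 :: "(real^2 \<Rightarrow> real) \<Rightarrow> bool" where
  "H10_B1 u \<longleftrightarrow> L2_B1 u \<and>
     (\<exists>(g :: real^2 \<Rightarrow> real^2) (\<phi> :: nat \<Rightarrow> real^2 \<Rightarrow> real).
        L2_B1 g \<and> (\<forall>n. test_function (\<phi> n)) \<and>
        (\<lambda>n. LINT x:B1|lebesgue. (norm (\<phi> n x - u x))\<^sup>2) \<longlonglongrightarrow> 0 \<and>
        (\<lambda>n. LINT x:B1|lebesgue. (norm (gradient (\<phi> n) x - g x))\<^sup>2) \<longlonglongrightarrow> 0)"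

section \<open>Radial profiles\<close>

text \<open>A radial function on the disc is given by its profile \<open>u\<close>, a function of \<open>r = |x|\<close>; only
  the values of \<open>u\<close> on \<open>[0,1]\<close> (or on \<open>(0,1]\<close>, for singular profiles) matter.\<close>

definition radial :: "(real \<Rightarrow> real) \<Rightarrow> real^2 \<Rightarrow> real" where
  "radial u x = u (norm x)"

text \<open>The derivative in \<open>r\<close> on \<open>(0,1]\<close>, one-sided at \<open>r = 1\<close>.\<close>

definition rderiv :: "(real \<Rightarrow> real) \<Rightarrow> real \<Rightarrow> real" where
  "rderiv u r = vector_derivative u (at r within {0<..1})"

definition C2_profile :: "(real \<Rightarrow> real) \<Rightarrow> bool" where
  "C2_profile u \<longleftrightarrow> u differentiable_on {0<..1} \<and> rderiv u differentiable_on {0<..1} \<and>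
     continuous_on {0<..1} (rderiv (rderiv u))"

definition C2_loc_limit ::
  "('a \<Rightarrow> real \<Rightarrow> real) \<Rightarrow> (real \<Rightarrow> real) \<Rightarrow> 'a filter \<Rightarrow> bool" where
  "C2_loc_limit u U F \<longleftrightarrow> (\<forall>K. compact K \<and> K \<subseteq> {0<..1} \<longrightarrow>
     uniform_limit K u U F \<and>
     uniform_limit K (\<lambda>b. rderiv (u b)) (rderiv U) F \<and>
     uniform_limit K (\<lambda>b. rderiv (rderiv (u b))) (rderiv (rderiv U)) F)"

section \<open>The boundary value problem\<close>

definition Vk :: "real \<Rightarrow> real \<Rightarrow> real" where
  "Vk k r = 1 / (r\<^sup>2 * (- ln (r / exp 1)) powr (2 + k))"

definition radial_solution :: "real \<Rightarrow> (real \<Rightarrow> real) \<Rightarrow> real \<Rightarrow> (real \<Rightarrow> real) \<Rightarrow> bool" where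
  "radial_solution k f lam u \<longleftrightarrow>
     lam > 0 \<and> continuous_on {0..1} u \<and> C2_profile u \<and>
     (\<forall>x\<in>B1 - {0}. - laplacian (radial u) x = lam * Vk k (norm x) * f (radial u x)) \<and>
     (\<forall>x\<in>B1. radial u x > 0) \<and> (\<forall>x\<in>sphere 0 1. radial u x = 0)"

text \<open>A singular solution satisfies the equation also at \<open>r = 1\<close>, where \<open>\<Delta>u\<close> is read as
  \<open>u'' + u'/r\<close> with one-sided derivatives.\<close>

definition radial_singular_solution ::
  "real \<Rightarrow> (real \<Rightarrow> real) \<Rightarrow> real \<Rightarrow> (real \<Rightarrow> real) \<Rightarrow> bool" where
  "radial_singular_solution k f lam U \<longleftrightarrow>
     lam > 0 \<and> C2_profile U \<and>
     (\<forall>x\<in>B1 - {0}. - laplacian (radial U) x = lam * Vk k (norm x) * f (radial U x)) \<and>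
     - (rderiv (rderiv U) 1 + rderiv U 1 / 1) = lam * Vk k 1 * f (U 1) \<and>
     (\<forall>x\<in>B1 - {0}. radial U x > 0) \<and> (\<forall>x\<in>sphere 0 1. radial U x = 0) \<and>
     filterlim U at_top (at_right 0)"

definition unique_radial_singular_solution ::
  "real \<Rightarrow> (real \<Rightarrow> real) \<Rightarrow> real \<Rightarrow> (real \<Rightarrow> real) \<Rightarrow> bool" where
  "unique_radial_singular_solution k f lam U \<longleftrightarrow>
     radial_singular_solution k f lam U \<and>
     (\<forall>lam' U'. radial_singular_solution k f lam' U' \<longrightarrow>
        lam' = lam \<and> (\<forall>r\<in>{0<..1}. U' r = U r))"

section \<open>The two nonlinearities and their solution curves\<close>

definition power_nl :: "real \<Rightarrow> real \<Rightarrow> real" where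
  "power_nl p u = (1 + u) powr p"

definition p_s :: "real \<Rightarrow> real" where "p_s k = k + 1"

definition p_c :: "real \<Rightarrow> real" where "p_c k = 2 * k + 1"

text \<open>The pair \<open>(\<lambda>(\<beta>), u(\<cdot>,\<beta>))\<close>. Membership in \<^term>\<open>extensional {0..1}\<close> fixes the irrelevant
  values of the profile outside \<open>[0,1]\<close>, so that the pair is unique as a HOL object.\<close>

definition exp_curve :: "real \<Rightarrow> real \<Rightarrow> real \<times> (real \<Rightarrow> real)" where
  "exp_curve k \<beta> = (THE s. radial_solution k exp (fst s) (snd s) \<and>
     snd s \<in> extensional {0..1} \<and> snd s 0 + ln (fst s) = \<beta>)"

definition power_curve :: "real \<Rightarrow> real \<Rightarrow> real \<Rightarrow> real \<times> (real \<Rightarrow> real)" where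
  "power_curve k p \<beta> = (THE s. radial_solution k (power_nl p) (fst s) (snd s) \<and>
     snd s \<in> extensional {0..1} \<and> fst s powr (1 / (p - 1)) * (snd s 0 + 1) = \<beta>)"

definition exp_U_star :: "real \<Rightarrow> real \<Rightarrow> real" where
  "exp_U_star k r = k * ln (- ln (r / exp 1))"

definition power_U_star :: "real \<Rightarrow> real \<Rightarrow> real \<Rightarrow> real" where
  "power_U_star k p r = (- ln (r / exp 1)) powr (k / (p - 1)) - 1"

definition power_lam_star :: "real \<Rightarrow> real \<Rightarrow> real" where
  "power_lam_star k p = k / (p - 1) * (1 - k / (p - 1))"

end

theory Submission
  imports Defs
begin

text \<open>In the variable \<open>s = ln (1 - ln r)\<close> both problems become one autonomous planar system. Write
  \<open>u = g \<xi>\<close> with \<open>g' = b exp (m \<xi>)\<close> and \<open>f (g \<xi>) = exp ((1 + m) \<xi>)\<close>; this is \<open>m = 0\<close>, \<open>g \<xi> = \<xi>\<close> for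
  the exponential and \<open>m = 1/(p - 1)\<close>, \<open>g \<xi> = exp (m \<xi>) - 1\<close> for the power. Then
  \<open>y = \<xi> - k s + ln (\<lambda>/b)\<close> and \<open>Q = \<xi>'\<close> satisfy \<open>y' = Q - k\<close> and \<open>Q' = Q - m Q^2 - exp y\<close>. Along orbits the
  energy \<open>E = exp (2 m y) (Q - k)^2 / 2 + G y\<close>, where \<open>G\<close> is minimal exactly at the equilibrium, satisfies
  \<open>E' = (1 - 2 m k) exp (2 m y) (Q - k)^2\<close>, and \<open>p > p_c\<close> says that \<open>2 m k < 1\<close>.

  The origin \<open>r = 0\<close> is \<open>s = \<infinity>\<close>. A singular solution is an orbit which stays bounded as \<open>s\<close> tends to
  infinity, so it converges to the equilibrium; as \<open>E\<close> increases towards its minimum, the orbit is constant.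
  A regular solution has \<open>y + k s\<close> convergent at infinity, which determines the orbit up to translation in
  \<open>s\<close>. Increasing \<open>\<beta>\<close> translates this single orbit to the right, so the limit \<open>\<beta> \<rightarrow> \<infinity>\<close> is its
  behaviour as \<open>s\<close> tends to minus infinity; there \<open>E\<close> decreases and the orbit tends to the equilibrium.

  The singular profile has \<open>U' = - c t powr e / r\<close> with \<open>t = 1 - ln r\<close>, so its Dirichlet integral
  is finite exactly if \<open>2 e < - 1\<close>. Truncating \<open>U'\<close> near \<open>0\<close> and \<open>1\<close> gives test functions
  converging to \<open>U\<close>; conversely, Green's formula bounds the energies of these truncations as soon as
  \<open>U\<close> is any \<open>H^1\<close> limit of test functions.\<close>

section \<open>The phase plane\<close>

text \<open>A singular solution is only known to blow up, at no given rate, so the boundedness that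
  the energy argument needs has to be earned. From above it comes from comparison functions. The
  lower bound is the hard point: without one, the energy forces \<open>y\<close> to minus infinity;
  there \<open>Q\<close> is at most \<open>exp y / k\<close>, hence integrable, and
  \<open>y + k s\<close> stays bounded, against the blow-up. For \<open>m > 0\<close> the potential
  tends to \<open>0\<close> at minus infinity and does not confine orbits by itself. A regular orbit
  is confined because its energy is negative at late times, which is again \<open>2 m k < 1\<close>.
  The data of the regular orbit sit at infinity. It is a fixed point in the variable
  \<open>x = exp (- k s)\<close>, with a nonlinearity truncated to be bounded and Lipschitz so that
  it exists globally; monotonicity and the energy show afterwards that the truncation is inactive.
  The pairs of the theorem are chosen by \<open>THE\<close>, so existence and uniqueness for each
  parameter are part of the proof. A solution determines its orbit only for \<open>s > 0\<close>,
  with \<open>\<lambda>\<close> hidden in an additive constant; continuity at \<open>r = 1\<close>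
  recovers it.\<close>

lemma mono_from:
  fixes g g' :: "real \<Rightarrow> real"
  assumes "\<And>s. a < s \<Longrightarrow> (g has_real_derivative g' s) (at s)"
    and "\<And>s. a < s \<Longrightarrow> 0 \<le> g' s" and "a < s" "s \<le> t"
  shows "g s \<le> g t"
  by (rule DERIV_nonneg_imp_nondecreasing[OF assms(4)])
    (use assms in \<open>meson less_le_trans\<close>)

text \<open>If \<open>g\<close> ended below \<open>c\<close>, then at the last time with
  \<open>c \<le> g\<close> continuity gives \<open>g = c\<close>, and the positive derivative there
  contradicts maximality. So the sign of \<open>g'\<close> matters only on the level
  \<open>c\<close> itself.\<close>

lemma barrier:
  fixes g g' :: "real \<Rightarrow> real"
  assumes "s0 \<le> s1"
    and der: "\<And>s. s0 \<le> s \<Longrightarrow> s \<le> s1 \<Longrightarrow> (g has_real_derivative g' s) (at s)"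
    and start: "c \<le> g s0"
    and pos: "\<And>s. s0 \<le> s \<Longrightarrow> s \<le> s1 \<Longrightarrow> g s = c \<Longrightarrow> 0 < g' s"
  shows "c \<le> g s1"
proof (rule ccontr)
  assume neg: "\<not> c \<le> g s1"
  have cont: "continuous_on {s0..s1} g"
    by (meson atLeastAtMost_iff continuous_at_imp_continuous_on der DERIV_isCont)
  define A where "A = {s\<in>{s0..s1}. c \<le> g s}"
  have "closed A"
    unfolding A_def using continuous_closed_preimage[OF cont closed_atLeastAtMost, of "{c..}"]
    by (simp add: vimage_def Int_def conj_commute)
  moreover have "A \<subseteq> {s0..s1}" by (auto simp: A_def)
  ultimately have "compact A"
    by (meson bounded_closed_interval bounded_subset compact_eq_bounded_closed)
  moreover have "A \<noteq> {}" using assms by (auto simp: A_def)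
  ultimately obtain t where t: "t \<in> A" "\<And>x. x \<in> A \<Longrightarrow> x \<le> t"
    by (metis compact_attains_sup)
  then have ts: "s0 \<le> t" "t \<le> s1" "c \<le> g t" by (auto simp: A_def)
  with neg have "t < s1" by (cases "t = s1") auto
  have "continuous_on {t..s1} g" using cont by (rule continuous_on_subset) (use ts in auto)
  then obtain x where x: "t \<le> x" "x \<le> s1" "g x = c"
    using IVT2'[of g s1 c t] neg ts by auto
  then have "x \<in> A" using ts by (auto simp: A_def)
  then have "g t = c" using t(2)[of x] x by auto
  from DERIV_pos_inc_right[OF der pos[OF _ _ this]] ts
  obtain d where d: "d > 0" "\<And>h. 0 < h \<Longrightarrow> h < d \<Longrightarrow> g t < g (t + h)" by blast
  define h where "h = min (d/2) (s1 - t)"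
  have h: "0 < h" "h < d" using d(1) \<open>t < s1\<close> by (auto simp: h_def)
  have "t + h \<in> A" using d(2)[OF h] h ts by (auto simp: A_def) (simp add: h_def)
  from t(2)[OF this] show False using d(1) \<open>t < s1\<close> by (auto simp: h_def)
qed

text \<open>The inequality is available only while \<open>g\<close> is positive. A barrier at half
  the initial value keeps it positive, and then \<open>g\<close> times \<open>exp (- c s)\<close>
  cannot decrease.\<close>

lemma exp_growth:
  fixes g g' :: "real \<Rightarrow> real"
  assumes der: "\<And>s. s0 \<le> s \<Longrightarrow> (g has_real_derivative g' s) (at s)"
    and start: "0 < g s0" and c: "0 < c"
    and grow: "\<And>s. s0 \<le> s \<Longrightarrow> 0 < g s \<Longrightarrow> c * g s \<le> g' s"
    and s: "s0 \<le> s"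
  shows "g s0 * exp (c * (s - s0)) \<le> g s"
proof -
  have pos: "0 < g t" if "s0 \<le> t" for t
  proof -
    have "g s0 / 2 \<le> g t"
    proof (rule barrier[OF that])
      fix x assume "s0 \<le> x" "x \<le> t" "g x = g s0 / 2"
      then show "0 < g' x" using grow[of x] start c
        by (smt (verit) half_gt_zero mult_pos_pos)
    qed (use der start in auto)
    then show ?thesis using start by linarith
  qed
  have "g s0 * exp (- c * s0) \<le> g s * exp (- c * s)"
  proof (rule DERIV_nonneg_imp_nondecreasing[OF s])
    fix x assume x: "s0 \<le> x" "x \<le> s"
    have "((\<lambda>x. g x * exp (- c * x)) has_real_derivative (g' x - c * g x) * exp (- c * x)) (at x)"
      using der[OF x(1)] by (auto intro!: derivative_eq_intros simp: algebra_simps)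
    moreover have "0 \<le> (g' x - c * g x) * exp (- c * x)"
      using grow[OF x(1) pos[OF x(1)]] by auto
    ultimately show "\<exists>y. ((\<lambda>x. g x * exp (- c * x)) has_real_derivative y) (at x) \<and> 0 \<le> y" by blast
  qed
  then have "g s0 * exp (- c * s0) * exp (c * s) \<le> g s * exp (- c * s) * exp (c * s)"
    by (rule mult_right_mono) simp
  then show ?thesis by (simp add: mult.assoc flip: exp_add) (simp add: algebra_simps)
qed

lemma exp_growth_unbounded:
  fixes g g' :: "real \<Rightarrow> real"
  assumes der: "\<And>s. s0 \<le> s \<Longrightarrow> (g has_real_derivative g' s) (at s)"
    and start: "0 < g s0" and c: "0 < c"
    and grow: "\<And>s. s0 \<le> s \<Longrightarrow> 0 < g s \<Longrightarrow> c * g s \<le> g' s"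
  shows "\<exists>s\<ge>s0. M < g s"
proof -
  define s where "s = s0 + \<bar>M\<bar> / (c * g s0)"
  have s: "s0 \<le> s" using c start by (auto simp: s_def)
  have "g s0 * (1 + c * (s - s0)) = g s0 + \<bar>M\<bar>"
    using c start by (simp add: s_def field_simps)
  then have "M < g s0 * (1 + c * (s - s0))" using start by linarith
  also have "\<dots> \<le> g s0 * exp (c * (s - s0))"
    using start by (intro mult_left_mono exp_ge_add_one_self) auto
  also have "\<dots> \<le> g s" by (rule exp_growth[OF der start c grow s])
  finally show ?thesis using s by blast
qed

text \<open>Barbalat's lemma. The increment of \<open>f\<close> over a window of fixed length
  \<open>d\<close> tends to \<open>0\<close>, so \<open>g\<close> is small somewhere in the window,
  and the bound on \<open>h\<close> carries this to the left end.\<close>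

lemma derivative_tendsto_0:
  fixes f g h :: "real \<Rightarrow> real"
  assumes f: "\<And>s. a < s \<Longrightarrow> (f has_real_derivative g s) (at s)"
    and g: "\<And>s. a < s \<Longrightarrow> (g has_real_derivative h s) (at s)"
    and h: "\<And>s. a < s \<Longrightarrow> \<bar>h s\<bar> \<le> M"
    and lim: "(f \<longlongrightarrow> L) at_top"
  shows "(g \<longlongrightarrow> 0) at_top"
proof (rule tendstoI)
  fix e :: real assume e: "0 < e"
  have M: "0 \<le> M" using h[of "a+1"] by linarith
  define d where "d = e / (2 * (M + 1))"
  have d: "0 < d" "M * d \<le> e / 2" using e M by (auto simp: d_def field_simps)
  have "((\<lambda>s. f (d + s) - f s) \<longlongrightarrow> L - L) at_top"
    by (intro tendsto_diff lim filterlim_compose[OF lim]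
        filterlim_tendsto_add_at_top[OF tendsto_const filterlim_ident])
  then have "eventually (\<lambda>s. \<bar>f (d + s) - f s\<bar> < d * (e / 2)) at_top"
    using d e by (auto dest!: tendstoD[where e = "d * (e / 2)"])
  then show "eventually (\<lambda>s. dist (g s) 0 < e) at_top"
    using eventually_gt_at_top[of a]
  proof eventually_elim
    case (elim s)
    obtain z where z: "s < z" "z < s + d" "f (d + s) - f s = d * g z"
      using MVT2[of s "s + d" f g] d f elim by (force simp: add.commute)
    obtain z' where z': "s < z'" "z' < z" "g z - g s = (z - s) * h z'"
      using MVT2[of s z g h] z g elim by fastforce
    have "\<bar>g z\<bar> < e / 2" using elim z d by (simp add: abs_mult)
    moreover have "\<bar>g z - g s\<bar> \<le> d * M"
      using z' z h[of z'] elim M d unfolding z'(3) abs_mult by (intro mult_mono) auto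
    ultimately show ?case using d by (simp add: mult.commute)
  qed
qed

section \<open>A priori bounds for orbits\<close>

text \<open>A half-line is the common form: a solution of the boundary value problem yields an orbit
  for \<open>s > 0\<close>, whereas the orbits constructed directly are entire, that is, satisfy
  this for every \<open>a\<close>.\<close>

definition orbit :: "real \<Rightarrow> real \<Rightarrow> real \<Rightarrow> (real \<Rightarrow> real) \<Rightarrow> (real \<Rightarrow> real) \<Rightarrow> bool" where
  "orbit k m a y Q \<longleftrightarrow> (\<forall>s>a. (y has_real_derivative Q s - k) (at s) \<and>
     (Q has_real_derivative Q s - m * (Q s)\<^sup>2 - exp (y s)) (at s))"

lemma orbitD:
  assumes "orbit k m a y Q" "a < s"
  shows "(y has_real_derivative Q s - k) (at s)"
    and "(Q has_real_derivative Q s - m * (Q s)\<^sup>2 - exp (y s)) (at s)"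
  using assms by (auto simp: orbit_def)

text \<open>Once \<open>Q\<close> is nonpositive, its equation drives it further down. Since
  \<open>Q\<close> is the derivative of \<open>y + k s\<close>, this violates the lower bound, which
  for solutions expresses the positivity of \<open>u\<close>.\<close>

lemma orbit_Q_pos:
  assumes o: "orbit k m a y Q" and m: "0 \<le> m"
    and lower: "\<And>s. a < s \<Longrightarrow> C \<le> y s + k * s" and s: "a < s"
  shows "0 < Q s"
proof (rule ccontr)
  assume neg: "\<not> 0 < Q s"
  note D = orbitD[OF o]
  have dQ: "((\<lambda>s. - Q s) has_real_derivative - (Q t - m * (Q t)\<^sup>2 - exp (y t))) (at t)" if "s \<le> t" for t
    using D(2)[of t] that s by (auto intro!: derivative_eq_intros)
  have nonpos: "0 \<le> - Q t" if "s \<le> t" for t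
    by (rule barrier[OF that dQ]) (use neg in auto)
  \<comment> \<open>\<open>Q s\<close> may vanish; one unit later \<open>Q\<close> is strictly
    negative, which provides the rate \<open>d\<close>.\<close>
  have s1: "- Q s < - Q (s + 1)"
  proof (rule DERIV_pos_imp_increasing[of s "s+1"])
    fix x assume x: "s \<le> x" "x \<le> s + 1"
    have "0 < - (Q x - m * (Q x)\<^sup>2 - exp (y x))"
      using nonpos[OF x(1)] m by (smt (verit) exp_gt_zero mult_nonneg_nonneg zero_le_power2)
    then show "\<exists>y. ((\<lambda>s. - Q s) has_real_derivative y) (at x) \<and> 0 < y" using dQ[OF x(1)] by blast
  qed simp
  define d where "d = - Q (s + 1)"
  have d: "0 < d" using s1 neg unfolding d_def by linarith
  have Qd: "Q t \<le> - d" if "s + 1 \<le> t" for t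
  proof -
    have "- Q (s+1) * exp (1 * (t - (s+1))) \<le> - Q t"
      by (rule exp_growth[where g = "\<lambda>s. - Q s", OF dQ])
        (use d m that in \<open>auto simp: d_def algebra_simps intro!: add_nonneg_nonneg mult_nonneg_nonneg\<close>)
    moreover have "d * 1 \<le> d * exp (1 * (t - (s+1)))"
      using d that by (intro mult_left_mono) auto
    ultimately show ?thesis by (simp add: d_def)
  qed
  define t where "t = s + 1 + \<bar>y (s+1) + k * (s+1) - C\<bar> / d + 1"
  have t: "s + 1 \<le> t" using d by (auto simp: t_def)
  have "- (y (s+1) + k * (s+1) + d * (s+1)) \<le> - (y t + k * t + d * t)"
  proof (rule DERIV_nonneg_imp_nondecreasing[OF t])
    fix x assume x: "s + 1 \<le> x" "x \<le> t"
    have "((\<lambda>s. - (y s + k * s + d * s)) has_real_derivative - (Q x - k + k + d)) (at x)"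
      using D(1)[of x] x s by (auto intro!: derivative_eq_intros)
    then show "\<exists>z. ((\<lambda>s. - (y s + k * s + d * s)) has_real_derivative z) (at x) \<and> 0 \<le> z"
      using Qd[OF x(1)] by (intro exI conjI) (assumption, linarith)
  qed
  then have "y t + k * t \<le> y (s+1) + k * (s+1) - d * (t - (s+1))" by (simp add: algebra_simps)
  moreover have "d * (t - (s+1)) = \<bar>y (s+1) + k * (s+1) - C\<bar> + d"
    using d by (simp add: t_def field_simps)
  ultimately show False using lower[of t] t s d by linarith
qed

text \<open>\<open>Q - exp y / k\<close> has derivative \<open>Q (1 - m Q - exp y / k)\<close>, so a
  positive value grows exponentially as long as \<open>Q < 2 k\<close> and \<open>exp y\<close> is
  small. Once \<open>Q\<close> has reached \<open>2 k\<close> it stays above, and \<open>y\<close>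
  increases, against \<open>y\<close> tending to minus infinity.\<close>

lemma orbit_near_axis:
  assumes o: "orbit k m a y Q" and m: "0 \<le> m" and k: "0 < k" and mk: "2 * m * k < 1"
    and Q: "\<And>s. a < s \<Longrightarrow> 0 < Q s" and lim: "filterlim y at_bot at_top"
  shows "\<forall>\<^sub>F s in at_top. k * Q s \<le> exp (y s)"
proof -
  note D = orbitD[OF o]
  \<comment> \<open>Half of the supercritical gap: \<open>exp y \<le> c k\<close> leaves
    \<open>1 - m Q - exp y / k \<ge> c\<close> for \<open>Q \<le> 2 k\<close>, and also makes
    \<open>Q'\<close> positive on the level \<open>Q = 2 k\<close>.\<close>
  define c where "c = (1 - 2 * m * k) / 2"
  have c: "0 < c" using mk by (simp add: c_def)
  have "eventually (\<lambda>s. y s \<le> ln (c * k)) at_top"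
    using lim by (simp add: filterlim_at_bot)
  then obtain S where S: "\<And>s. S \<le> s \<Longrightarrow> exp (y s) \<le> c * k"
    using c k by (auto simp: eventually_at_top_linorder ln_ge_iff)
  have "k * Q s0 \<le> exp (y s0)" if s0: "max S (a+1) \<le> s0" for s0
  proof (rule ccontr)
    assume neg: "\<not> k * Q s0 \<le> exp (y s0)"
    have "\<exists>s1\<ge>s0. 2 * k \<le> Q s1"
    proof (rule ccontr)
      assume no: "\<not> (\<exists>s1\<ge>s0. 2 * k \<le> Q s1)"
      have "\<exists>s\<ge>s0. 2 * k < Q s - exp (y s) / k"
      proof (rule exp_growth_unbounded[OF _ _ c])
        fix s assume s: "s0 \<le> s"
        then have as: "a < s" using s0 by linarith
        show "((\<lambda>s. Q s - exp (y s) / k) has_real_derivative Q s * (1 - m * Q s - exp (y s) / k)) (at s)"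
          using D[OF as] k by (auto intro!: derivative_eq_intros simp: field_simps power2_eq_square)
        have "m * Q s \<le> m * (2 * k)"
          using no s m by (intro mult_left_mono) force+
        moreover have "exp (y s) / k \<le> c" using S[of s] s s0 k by (simp add: field_simps)
        ultimately have "c \<le> 1 - m * Q s - exp (y s) / k" by (simp add: c_def)
        then have "c * Q s \<le> Q s * (1 - m * Q s - exp (y s) / k)"
          using Q[OF as] by (simp add: mult.commute)
        moreover have "c * (Q s - exp (y s) / k) \<le> c * Q s"
          using c k by (intro mult_left_mono) auto
        ultimately show "c * (Q s - exp (y s) / k) \<le> Q s * (1 - m * Q s - exp (y s) / k)" by linarith
      qed (use neg k in \<open>auto simp: field_simps\<close>)
      then obtain s where "s \<ge> s0" "2 * k < Q s - exp (y s) / k" by blast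
      moreover have "0 < exp (y s) / k" using k by simp
      ultimately show False using no by force
    qed
    then obtain s1 where s1: "s1 \<ge> s0" "2 * k \<le> Q s1" by blast
    have big: "2 * k \<le> Q s" if "s1 \<le> s" for s
    proof (rule barrier[OF that])
      fix t assume t: "s1 \<le> t" "t \<le> s"
      then have "a < t" using s1 s0 by linarith
      then show "(Q has_real_derivative Q t - m * (Q t)\<^sup>2 - exp (y t)) (at t)" by (rule D)
      assume "Q t = 2 * k"
      moreover have "exp (y t) \<le> c * k" using S t s1 s0 by auto
      moreover have "0 < c * k" using c k by simp
      moreover have "c * k = k / 2 - m * k * k" by (simp add: c_def field_simps)
      ultimately show "0 < Q t - m * (Q t)\<^sup>2 - exp (y t)"
        by (simp add: power2_eq_square algebra_simps)
    qed (use s1 in auto)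
    have up: "y s1 \<le> y s" if "s1 \<le> s" for s
    proof (rule DERIV_nonneg_imp_nondecreasing[OF that])
      fix x assume x: "s1 \<le> x" "x \<le> s"
      then show "\<exists>z. (y has_real_derivative z) (at x) \<and> 0 \<le> z"
        using D(1)[of x] big[OF x(1)] s1 s0 k by (intro exI conjI) auto
    qed
    have "eventually (\<lambda>s. y s < y s1) at_top" using lim by (simp add: filterlim_at_bot_dense)
    then have "eventually (\<lambda>s. y s < y s1 \<and> s1 \<le> s) at_top"
      using eventually_ge_at_top[of s1] by (rule eventually_conj)
    then have "eventually (\<lambda>s::real. False) at_top"
      by eventually_elim (use up in force)
    then show False by simp
  qed
  then show ?thesis unfolding eventually_at_top_linorder by blast
qed

text \<open>Eventually \<open>Q \<le> exp y / k\<close> while \<open>y\<close> falls at rate at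
  least \<open>k / 2\<close>, so \<open>Q\<close>, the derivative of \<open>y + k s\<close>, is
  integrable.\<close>

lemma orbit_near_axis_bounded:
  assumes o: "orbit k m a y Q" and m: "0 \<le> m" and k: "0 < k" and mk: "2 * m * k < 1"
    and Q: "\<And>s. a < s \<Longrightarrow> 0 < Q s" and lim: "filterlim y at_bot at_top"
  shows "\<not> filterlim (\<lambda>s. y s + k * s) at_top at_top"
proof
  assume top: "filterlim (\<lambda>s. y s + k * s) at_top at_top"
  note D = orbitD[OF o]
  have near: "\<forall>\<^sub>F s in at_top. k * Q s \<le> exp (y s)"
    by (rule orbit_near_axis[OF o m k mk _ lim]) (rule Q)
  have "eventually (\<lambda>s. y s \<le> ln (k\<^sup>2 / 2)) at_top"
    using lim by (simp add: filterlim_at_bot)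
  then have "eventually (\<lambda>s. exp (y s) \<le> k\<^sup>2 / 2 \<and> k * Q s \<le> exp (y s) \<and> a < s) at_top"
    using near eventually_gt_at_top[of a]
  proof eventually_elim
    case (elim s)
    then have "exp (y s) \<le> exp (ln (k\<^sup>2 / 2))" by (simp only: exp_le_cancel_iff)
    with elim k show ?case by simp
  qed
  then obtain S where S: "\<And>s. S \<le> s \<Longrightarrow> exp (y s) \<le> k\<^sup>2 / 2 \<and> k * Q s \<le> exp (y s) \<and> a < s"
    by (auto simp: eventually_at_top_linorder)
  have "y s + k * s \<le> y S + k * S + 2 / k\<^sup>2 * exp (y S)" if "S \<le> s" for s
  proof -
    \<comment> \<open>The multiple of \<open>exp y\<close> pays for the remaining integral of
      \<open>Q\<close>: its derivative is at most \<open>- exp y / k\<close>, hence at most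
      \<open>- Q\<close>.\<close>
    have "- (y S + k * S + 2 / k\<^sup>2 * exp (y S)) \<le> - (y s + k * s + 2 / k\<^sup>2 * exp (y s))"
    proof (rule DERIV_nonneg_imp_nondecreasing[OF that])
      fix x assume x: "S \<le> x" "x \<le> s"
      note Sx = S[OF x(1)]
      have "((\<lambda>s. - (y s + k * s + 2 / k\<^sup>2 * exp (y s))) has_real_derivative
          - (Q x + 2 / k\<^sup>2 * ((Q x - k) * exp (y x)))) (at x)"
        using D[of x] Sx k by (auto intro!: derivative_eq_intros simp: field_simps)
      moreover have "0 \<le> - (Q x + 2 / k\<^sup>2 * ((Q x - k) * exp (y x)))"
      proof -
      have "k * Q x \<le> k * (k / 2)" using Sx by (simp add: power2_eq_square)
      then have "Q x - k \<le> - (k / 2)" using k by simp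
      then have "(Q x - k) * exp (y x) \<le> - (k / 2) * exp (y x)" by (rule mult_right_mono) simp
      then have "2 / k\<^sup>2 * ((Q x - k) * exp (y x)) \<le> 2 / k\<^sup>2 * (- (k / 2) * exp (y x))"
        by (rule mult_left_mono) (use k in simp)
      also have "\<dots> = - exp (y x) / k" using k by (simp add: power2_eq_square field_simps)
      also have "\<dots> \<le> - Q x" using Sx k by (simp add: field_simps)
      finally show ?thesis by linarith
      qed
      ultimately show "\<exists>z. ((\<lambda>s. - (y s + k * s + 2 / k\<^sup>2 * exp (y s))) has_real_derivative z) (at x) \<and> 0 \<le> z"
        by blast
    qed
    moreover have "0 < 2 / k\<^sup>2 * exp (y s)" using k by simp
    ultimately show ?thesis by linarith
  qed
  moreover have "eventually (\<lambda>s. y S + k * S + 2 / k\<^sup>2 * exp (y S) < y s + k * s) at_top"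
    using top by (simp add: filterlim_at_top_dense)
  then have "eventually (\<lambda>s. S \<le> s \<and> y S + k * S + 2 / k\<^sup>2 * exp (y S) < y s + k * s) at_top"
    using eventually_ge_at_top[of S] by eventually_elim simp
  then obtain s where "S \<le> s" "y S + k * S + 2 / k\<^sup>2 * exp (y S) < y s + k * s"
    using eventually_happens' trivial_limit_at_top_linorder by (metis (no_types, lifting))
  ultimately show False by force
qed

text \<open>For \<open>Z = exp y - (1 + k) Q\<close> one has \<open>Z' \<ge> Z\<close> and
  \<open>Q' \<le> - Z\<close>, so a positive \<open>Z\<close> would grow and make \<open>Q\<close>
  negative. The first bound integrates to the second because \<open>- Q exp (- (y + k s))\<close> is
  the derivative of \<open>exp (- (y + k s))\<close>, which vanishes at infinity.\<close>

lemma singular_orbit_bounds: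
  assumes o: "orbit k m a y Q" and m: "0 \<le> m" and k: "0 < k"
    and top: "filterlim (\<lambda>s. y s + k * s) at_top at_top"
    and Q: "\<And>s. a < s \<Longrightarrow> 0 < Q s" and s: "a < s"
  shows "exp (y s) \<le> (1 + k) * Q s" and "exp (y s) \<le> k * (1 + k)"
proof -
  note D = orbitD[OF o]
  have H: "exp (y s) \<le> (1 + k) * Q s" if s: "a < s" for s
  proof (rule ccontr)
    assume neg: "\<not> ?thesis"
    define Z where "Z = (\<lambda>s. exp (y s) - (1 + k) * Q s)"
    have dZ: "(Z has_real_derivative Z t + Q t * exp (y t) + (1 + k) * m * (Q t)\<^sup>2) (at t)"
      if "s \<le> t" for t
      unfolding Z_def using D[of t] that s
      by (auto intro!: derivative_eq_intros simp: algebra_simps)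
    have g: "1 * Z t \<le> Z t + Q t * exp (y t) + (1 + k) * m * (Q t)\<^sup>2" if "s \<le> t" for t
    proof -
      have "0 \<le> Q t * exp (y t)" "0 \<le> (1 + k) * m * (Q t)\<^sup>2"
        using Q[of t] that s k m by auto
      then show ?thesis by linarith
    qed
    have Z0: "0 < Z s" using neg by (simp add: Z_def)
    have Zgrow: "Z u * exp (1 * (t - u)) \<le> Z t" if "s \<le> u" "u \<le> t" "0 < Z u" for t u
      by (rule exp_growth[OF dZ that(3) zero_less_one g that(2)]) (use that in auto)
    have Zpos: "0 < Z t" if "s \<le> t" for t
      using Zgrow[of s t] that Z0 by (smt (verit) exp_gt_zero mult_pos_pos)
    have dec: "Q t \<le> Q s" if "s \<le> t" for t
    proof (rule DERIV_nonpos_imp_nonincreasing[OF that])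
      fix x assume x: "s \<le> x" "x \<le> t"
      have "0 \<le> k * Q x" "0 \<le> m * (Q x)\<^sup>2" using Q[of x] x s k m by auto
      then show "\<exists>z. (Q has_real_derivative z) (at x) \<and> z \<le> 0"
        using D(2)[of x] Zpos[OF x(1)] x s by (intro exI conjI) (auto simp: Z_def algebra_simps)
    qed
    have "\<exists>t\<ge>s. 1 + Q s < Z t"
      by (rule exp_growth_unbounded[OF dZ Z0 zero_less_one g])
    then obtain t where t: "s \<le> t" "1 + Q s < Z t" by blast
    have Zinc: "Z t \<le> Z x" if x: "t \<le> x" for x
    proof -
      have "Z t * 1 \<le> Z t * exp (1 * (x - t))"
        using Zpos[OF t(1)] x by (intro mult_left_mono) auto
      then show ?thesis using Zgrow[OF t(1) x Zpos[OF t(1)]] by linarith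
    qed
    \<comment> \<open>Beyond \<open>t\<close> one has \<open>Q' \<le> - 1\<close>, and
      \<open>Q s + 1\<close> units of time exhaust \<open>Q\<close>, which never exceeds
      \<open>Q s\<close>.\<close>
    have "Q (t + Q s + 1) + 1 * (t + Q s + 1) \<le> Q t + 1 * t"
    proof (rule DERIV_nonpos_imp_nonincreasing[where f = "\<lambda>x. Q x + 1 * x"])
      show "t \<le> t + Q s + 1" using Q[OF s] by linarith
      fix x assume x: "t \<le> x" "x \<le> t + Q s + 1"
      then have sx: "s \<le> x" using t by linarith
      have "((\<lambda>x. Q x + 1 * x) has_real_derivative Q x - m * (Q x)\<^sup>2 - exp (y x) + 1) (at x)"
        using D(2)[of x] sx s by (auto intro!: derivative_eq_intros)
      moreover have "0 \<le> m * (Q x)\<^sup>2" "Q x \<le> Q s" "0 \<le> k * Q x" "0 < Q x"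
        using m dec[OF sx] Q[of x] sx s k by auto
      then have "Q x - m * (Q x)\<^sup>2 - exp (y x) + 1 \<le> 0"
        using Zinc[OF x(1)] t(2) by (auto simp: Z_def algebra_simps)
      ultimately show "\<exists>z. ((\<lambda>x. Q x + 1 * x) has_real_derivative z) (at x) \<and> z \<le> 0" by blast
    qed
    then show False using Q[of "t + Q s + 1"] Q[OF s] dec[OF t(1)] t(1) s by auto
  qed
  show "exp (y s) \<le> (1 + k) * Q s" using H[OF s] .
  \<comment> \<open>By the first bound \<open>W\<close> is nonincreasing, and it tends to
    \<open>0\<close>. Its nonnegativity is the second bound up to positive factors.\<close>
  define W where "W = (\<lambda>s. exp (- (y s + k * s)) - exp (- k * s) / (k * (1 + k)))"
  have dW: "(W has_real_derivative - (Q t * exp (- (y t + k * t))) + exp (- k * t) / (1 + k)) (at t)"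
    if "a < t" for t
  proof -
    have "(W has_real_derivative - (Q t * exp (- (y t + k * t))) + k * exp (- k * t) / (k * (1 + k))) (at t)"
      unfolding W_def using D(1)[OF that] k
      by (auto intro!: derivative_eq_intros DERIV_cdivide)
    moreover have "k * exp (- k * t) / (k * (1 + k)) = exp (- k * t) / (1 + k)"
      using k by (simp only: mult_divide_mult_cancel_left)
    ultimately show ?thesis by simp
  qed
  have dec: "W t \<le> W s" if "s \<le> t" for t
  proof (rule DERIV_nonpos_imp_nonincreasing[OF that])
    fix x assume x: "s \<le> x" "x \<le> t"
    then have ax: "a < x" using s by linarith
    have "exp (y x) * exp (- (y x + k * x)) \<le> ((1 + k) * Q x) * exp (- (y x + k * x))"
      by (intro mult_right_mono H ax) simp
    then have "exp (- k * x) \<le> (1 + k) * (Q x * exp (- (y x + k * x)))"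
      by (simp add: mult.assoc flip: exp_add)
    then have "- (Q x * exp (- (y x + k * x))) + exp (- k * x) / (1 + k) \<le> 0"
      using k by (simp add: field_simps)
    then show "\<exists>z. (W has_real_derivative z) (at x) \<and> z \<le> 0" using dW[OF ax] by blast
  qed
  have "(W \<longlongrightarrow> 0 - 0 / (k * (1 + k))) at_top"
    unfolding W_def
  proof (intro tendsto_diff tendsto_divide tendsto_const)
    show "((\<lambda>s. exp (- (y s + k * s))) \<longlongrightarrow> 0) at_top"
      by (rule filterlim_compose[OF exp_at_bot filterlim_uminus_at_top[THEN iffD1, OF top]])
    have "filterlim (\<lambda>s. k * s) at_top at_top"
      using k by (intro filterlim_tendsto_pos_mult_at_top[OF tendsto_const _ filterlim_ident])
    then show "((\<lambda>s. exp (- k * s)) \<longlongrightarrow> 0) at_top"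
      by (intro filterlim_compose[OF exp_at_bot]) (simp add: filterlim_uminus_at_top)
  qed (use k in auto)
  then have lim: "(W \<longlongrightarrow> 0) at_top" by simp
  have "0 \<le> W s"
    by (rule tendsto_upperbound[OF lim]) (auto simp: eventually_at_top_linorder intro!: exI[of _ s] dec)
  then have "exp (- k * s) / (k * (1 + k)) * (k * (1 + k) * exp (y s + k * s))
      \<le> exp (- (y s + k * s)) * (k * (1 + k) * exp (y s + k * s))"
    by (intro mult_right_mono) (use k in \<open>auto simp: W_def\<close>)
  then show "exp (y s) \<le> k * (1 + k)"
    using k by (simp add: mult.assoc mult.left_commute flip: exp_add)
qed

text \<open>For \<open>m > 0\<close> the quadratic damping confines \<open>Q\<close>. For
  \<open>m = 0\<close> there is none; instead, a \<open>Q\<close> beyond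
  \<open>k (1 + k) + k\<close> would grow exponentially and carry \<open>y\<close> past its upper
  bound.\<close>

lemma singular_orbit_Q_bounded:
  assumes o: "orbit k m a y Q" and m: "0 \<le> m" and k: "0 < k"
    and top: "filterlim (\<lambda>s. y s + k * s) at_top at_top"
    and Q: "\<And>s. a < s \<Longrightarrow> 0 < Q s" and a: "a < s0"
  shows "\<exists>B. \<forall>s\<ge>s0. Q s \<le> B"
proof (cases "m = 0")
  case True
  note D = orbitD[OF o, unfolded True]
  have H: "exp (y s) \<le> k * (1 + k)" if "a < s" for s
    by (rule singular_orbit_bounds[OF o m k top _ that]) (rule Q)
  have "Q s \<le> k * (1 + k) + k" if s: "s0 \<le> s" for s
  proof (rule ccontr)
    assume neg: "\<not> ?thesis"
    have dZ: "((\<lambda>s. Q s - k * (1 + k)) has_real_derivative Q t - exp (y t)) (at t)"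
      if "s \<le> t" for t
      using D(2)[of t] that s a by (auto intro!: derivative_eq_intros)
    have g: "1 * (Q t - k * (1 + k)) \<le> Q t - exp (y t)" if "s \<le> t" for t
      using H[of t] that s a by auto
    have Z0: "0 < Q s - k * (1 + k)" using neg k by auto
    have "\<exists>s1\<ge>s. k + 1 < Q s1 - k * (1 + k)"
      by (rule exp_growth_unbounded[OF dZ Z0 zero_less_one g])
    then obtain s1 where s1: "s \<le> s1" "k + 1 < Q s1 - k * (1 + k)" by blast
    have kk: "0 < k * (1 + k)" using k by simp
    have large: "k + 1 \<le> Q t" if "s1 \<le> t" for t
    proof -
      have "(Q s1 - k * (1 + k)) * exp (1 * (t - s1)) \<le> Q t - k * (1 + k)"
        by (rule exp_growth[OF dZ _ _ g]) (use s1 k that in auto)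
      moreover have "(Q s1 - k * (1 + k)) * 1 \<le> (Q s1 - k * (1 + k)) * exp (1 * (t - s1))"
        using s1 that k by (intro mult_left_mono) auto
      ultimately have "k + 1 < Q t - k * (1 + k)"
        using s1(2) by (metis dual_order.trans less_le_not_le mult.right_neutral order_less_le_trans)
      then show ?thesis using kk by linarith
    qed
    have "\<exists>t\<ge>s1. k * (1 + k) < exp (y t)"
    proof (rule exp_growth_unbounded[where g' = "\<lambda>t. (Q t - k) * exp (y t)" and c = 1])
      fix t assume t: "s1 \<le> t"
      show "((\<lambda>t. exp (y t)) has_real_derivative (Q t - k) * exp (y t)) (at t)"
        using D(1)[of t] t s1 s a by (auto intro!: derivative_eq_intros)
      show "1 * exp (y t) \<le> (Q t - k) * exp (y t)"
        using large[OF t] by (intro mult_right_mono) auto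
    qed auto
    then obtain t where "s1 \<le> t" "k * (1 + k) < exp (y t)" by blast
    then show False using H[of t] s1(1) s a by linarith
  qed
  then show ?thesis by blast
next
  case False
  note D = orbitD[OF o]
  have m: "0 < m" using m False by simp
  define B where "B = max (Q s0) (1/m)"
  have "- B \<le> - Q s" if s: "s0 \<le> s" for s
  proof (rule barrier[OF s])
    fix t assume t: "s0 \<le> t" "t \<le> s"
    then show "((\<lambda>s. - Q s) has_real_derivative - (Q t - m * (Q t)\<^sup>2 - exp (y t))) (at t)"
      using D(2)[of t] a by (auto intro!: derivative_eq_intros)
    assume "- Q t = - B"
    then have "1 / m \<le> Q t" by (simp add: B_def)
    then have "1 \<le> m * Q t" using m by (simp add: field_simps)
    then have "1 * Q t \<le> m * Q t * Q t" using Q[of t] t a by (intro mult_right_mono) auto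
    then show "0 < - (Q t - m * (Q t)\<^sup>2 - exp (y t))"
      using exp_gt_zero[of "y t"] by (simp add: power2_eq_square mult.assoc del: exp_gt_zero)
  qed (simp add: B_def)
  then show ?thesis by auto
qed

text \<open>The system reads \<open>y'' = (1 - 2 m k) y' - m y'^2 + k (1 - m k) - exp y\<close>; the factor \<open>exp (2 m y) y'\<close>
  absorbs the quadratic term, and the remaining force has the following potential.\<close>

definition pot :: "real \<Rightarrow> real \<Rightarrow> real \<Rightarrow> real" where
  "pot k m y = (if m = 0 then exp y - k * y
     else exp ((2 * m + 1) * y) / (2 * m + 1) - k * (1 - m * k) * exp (2 * m * y) / (2 * m))"

lemma pot_deriv:
  assumes "0 \<le> m"
  shows "(pot k m has_real_derivative exp (2 * m * y) * (exp y - k * (1 - m * k))) (at y)"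
proof (cases "m = 0")
  case True
  then have "pot k m = (\<lambda>y. exp y - k * y)" by (auto simp: pot_def)
  then show ?thesis using True by (auto intro!: derivative_eq_intros)
next
  case False
  then have p: "pot k m = (\<lambda>y. exp ((2 * m + 1) * y) / (2 * m + 1) - k * (1 - m * k) * exp (2 * m * y) / (2 * m))"
    by (auto simp: pot_def)
  have "(pot k m has_real_derivative exp ((2 * m + 1) * y) - k * (1 - m * k) * exp (2 * m * y)) (at y)"
    unfolding p by (rule derivative_eq_intros refl | use False assms in simp)+
  moreover have "exp ((2 * m + 1) * y) = exp (2 * m * y) * exp y"
    by (simp add: algebra_simps flip: exp_add)
  ultimately show ?thesis by (simp add: algebra_simps)
qed

text \<open>Strictness is what lets the energy alone identify the equilibrium.\<close>

lemma pot_min: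
  assumes "0 \<le> m" "0 < k * (1 - m * k)" "y \<noteq> ln (k * (1 - m * k))"
  shows "pot k m (ln (k * (1 - m * k))) < pot k m y"
proof (cases "y < ln (k * (1 - m * k))")
  case True
  have cont: "continuous_on A (pot k m)" for A
    by (intro continuous_at_imp_continuous_on ballI DERIV_isCont[OF pot_deriv] assms)
  show ?thesis
  proof (rule DERIV_neg_imp_decreasing_open[OF True _ cont])
    fix x assume "y < x" "x < ln (k * (1 - m * k))"
    then have "exp x < k * (1 - m * k)" using assms(2) by (metis exp_less_mono exp_ln)
    then show "\<exists>z. (pot k m has_real_derivative z) (at x) \<and> z < 0"
      using pot_deriv[OF assms(1)] by (intro exI conjI) (auto simp: mult_less_0_iff)
  qed
next
  case False
  then have less: "ln (k * (1 - m * k)) < y" using assms(3) by simp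
  have cont: "continuous_on A (pot k m)" for A
    by (intro continuous_at_imp_continuous_on ballI DERIV_isCont[OF pot_deriv] assms)
  show ?thesis
  proof (rule DERIV_pos_imp_increasing_open[OF less _ cont])
    fix x assume "x < y" "ln (k * (1 - m * k)) < x"
    then have "k * (1 - m * k) < exp x" using assms(2) by (metis exp_less_mono exp_ln)
    then show "\<exists>z. (pot k m has_real_derivative z) (at x) \<and> 0 < z"
      using pot_deriv[OF assms(1)] by (intro exI conjI) auto
  qed
qed

section \<open>The energy and convergence to the equilibrium\<close>

definition energy :: "real \<Rightarrow> real \<Rightarrow> real \<Rightarrow> real \<Rightarrow> real" where
  "energy k m y q = (exp (m * y) * (q - k))\<^sup>2 / 2 + pot k m y"

text \<open>The factor \<open>e\<close> will be \<open>1\<close> or \<open>- 1\<close>, the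
  direction of time. Singular orbits for increasing \<open>s\<close> and regular orbits for
  decreasing \<open>s\<close> thus share one argument.\<close>

lemma energy_deriv:
  assumes m: "0 \<le> m"
    and y: "(y has_real_derivative e * (Q s - k)) (at s)"
    and Q: "(Q has_real_derivative e * (Q s - m * (Q s)\<^sup>2 - exp (y s))) (at s)"
  shows "((\<lambda>s. exp (m * y s) * (Q s - k)) has_real_derivative
      e * ((1 - 2 * m * k) * (exp (m * y s) * (Q s - k))
        + exp (m * y s) * (k * (1 - m * k) - exp (y s)))) (at s)"
    and "((\<lambda>s. energy k m (y s) (Q s)) has_real_derivative
      e * (1 - 2 * m * k) * (exp (m * y s) * (Q s - k))\<^sup>2) (at s)"
proof -
  show 1: "((\<lambda>s. exp (m * y s) * (Q s - k)) has_real_derivative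
      e * ((1 - 2 * m * k) * (exp (m * y s) * (Q s - k))
        + exp (m * y s) * (k * (1 - m * k) - exp (y s)))) (at s)"
    using y Q by (auto intro!: derivative_eq_intros simp: algebra_simps power2_eq_square)
  have 2: "((\<lambda>s. pot k m (y s)) has_real_derivative
      exp (2 * m * y s) * (exp (y s) - k * (1 - m * k)) * (e * (Q s - k))) (at s)"
    by (rule DERIV_chain2[OF pot_deriv[OF m] y])
  have e2: "exp (2 * m * y s) = exp (m * y s) * exp (m * y s)"
    by (simp flip: exp_add)
  show "((\<lambda>s. energy k m (y s) (Q s)) has_real_derivative
      e * (1 - 2 * m * k) * (exp (m * y s) * (Q s - k))\<^sup>2) (at s)"
    unfolding energy_def
    by (rule DERIV_cong[OF DERIV_add[OF DERIV_cdivide[OF DERIV_power[OF 1, of 2]] 2]])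
      (simp only: e2, simp add: field_simps power2_eq_square)
qed

text \<open>Barbalat's lemma twice: convergence of the energy makes its derivative, a multiple of
  \<open>X^2\<close>, vanish in the limit; then \<open>X\<close> tending to \<open>0\<close> makes
  \<open>X'\<close> vanish, which leaves the force \<open>P\<close>. The weight
  \<open>exp (m y)\<close> is kept because \<open>y\<close> may still be unbounded below.\<close>

lemma orbit_settles:
  assumes e: "\<bar>e\<bar> = 1" and m: "0 \<le> m" and k: "0 < k" and mk: "2 * m * k < 1"
    and y: "\<And>s. a < s \<Longrightarrow> (y has_real_derivative e * (Q s - k)) (at s)"
    and Q: "\<And>s. a < s \<Longrightarrow> (Q has_real_derivative e * (Q s - m * (Q s)\<^sup>2 - exp (y s))) (at s)"
    and Y: "\<And>s. a < s \<Longrightarrow> y s \<le> Y" and B: "\<And>s. a < s \<Longrightarrow> \<bar>Q s - k\<bar> \<le> B"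
    and L: "((\<lambda>s. energy k m (y s) (Q s)) \<longlongrightarrow> L) at_top"
  shows "((\<lambda>s. exp (m * y s) * (Q s - k)) \<longlongrightarrow> 0) at_top"
    and "((\<lambda>s. exp (m * y s) * (k * (1 - m * k) - exp (y s))) \<longlongrightarrow> 0) at_top"
proof -
  define c where "c = 1 - 2 * m * k"
  define H where "H = k * (1 - m * k)"
  define X where "X = (\<lambda>s. exp (m * y s) * (Q s - k))"
  define P where "P = (\<lambda>s. exp (m * y s) * (H - exp (y s)))"
  define X1 where "X1 = (\<lambda>s. e * (c * X s + P s))"
  define P1 where "P1 = (\<lambda>s. e * ((Q s - k) * exp (m * y s) * (m * H - (m + 1) * exp (y s))))"
  have c: "0 < c" using mk by (simp add: c_def)
  have "2 * (m * k) < 1" using mk by (simp add: mult.assoc)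
  then have "0 < 1 - m * k" using mk m k mult_nonneg_nonneg[of m k] by linarith
  then have H: "0 < H" using k by (simp add: H_def)
  have dX: "(X has_real_derivative X1 s) (at s)" if "a < s" for s
    unfolding X_def X1_def P_def c_def H_def by (rule energy_deriv(1)[OF m y[OF that] Q[OF that]])
  have dE: "((\<lambda>s. energy k m (y s) (Q s)) has_real_derivative e * c * (X s)\<^sup>2) (at s)" if "a < s" for s
    unfolding X_def c_def by (rule energy_deriv(2)[OF m y[OF that] Q[OF that]])
  have dP: "(P has_real_derivative P1 s) (at s)" if "a < s" for s
    unfolding P_def P1_def using y[OF that] by (auto intro!: derivative_eq_intros simp: algebra_simps)
  define h where "h = exp (m * Y)"
  have hb: "exp (m * y s) \<le> h" "0 \<le> h" "exp (y s) \<le> exp Y" if "a < s" for s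
    using Y[OF that] m by (auto simp: h_def intro: mult_left_mono)
  have "0 \<le> B" using B[of "a + 1"] by linarith
  have Xb: "\<bar>X s\<bar> \<le> h * B" if "a < s" for s
    using hb[OF that] B[OF that] unfolding X_def abs_mult by (intro mult_mono) auto
  have Pb: "\<bar>P s\<bar> \<le> h * (H + exp Y)" if "a < s" for s
  proof -
    have "\<bar>H - exp (y s)\<bar> \<le> H + exp Y"
      using hb(3)[OF that] H exp_gt_zero[of "y s"] exp_gt_zero[of Y] unfolding abs_le_iff by linarith
    then show ?thesis
      using hb(1,2)[OF that] unfolding P_def abs_mult by (intro mult_mono) auto
  qed
  have X1b: "\<bar>X1 s\<bar> \<le> c * (h * B) + h * (H + exp Y)" if "a < s" for s
  proof -
    have "\<bar>X1 s\<bar> \<le> c * \<bar>X s\<bar> + \<bar>P s\<bar>"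
      using e c abs_triangle_ineq[of "c * X s" "P s"] by (simp add: X1_def abs_mult)
    also have "\<dots> \<le> c * (h * B) + h * (H + exp Y)"
      using Xb[OF that] Pb[OF that] c by (intro add_mono mult_left_mono) auto
    finally show ?thesis .
  qed
  have P1b: "\<bar>P1 s\<bar> \<le> B * h * (m * H + (m + 1) * exp Y)" if "a < s" for s
  proof -
    have "\<bar>m * H - (m + 1) * exp (y s)\<bar> \<le> \<bar>m * H\<bar> + \<bar>(m + 1) * exp (y s)\<bar>" by (rule abs_triangle_ineq4)
    also have "\<dots> \<le> m * H + (m + 1) * exp Y"
      using hb(3)[OF that] m H by (simp add: mult_left_mono)
    finally have "\<bar>m * H - (m + 1) * exp (y s)\<bar> \<le> m * H + (m + 1) * exp Y" .
    then show ?thesis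
      using hb[OF that] B[OF that] e unfolding P1_def abs_mult by (simp, intro mult_mono) auto
  qed
  have "((\<lambda>s. e * c * (X s)\<^sup>2) \<longlongrightarrow> 0) at_top"
  proof (rule derivative_tendsto_0[OF dE _ _ L])
    fix s assume s: "a < s"
    show "((\<lambda>s. e * c * (X s)\<^sup>2) has_real_derivative e * c * (2 * X s * X1 s)) (at s)"
      using dX[OF s] by (auto intro!: derivative_eq_intros)
    have "\<bar>X s\<bar> * \<bar>X1 s\<bar> \<le> (h * B) * (c * (h * B) + h * (H + exp Y))"
      using Xb[OF s] X1b[OF s] by (intro mult_mono) auto
    then have "c * (2 * (\<bar>X s\<bar> * \<bar>X1 s\<bar>)) \<le> c * (2 * ((h * B) * (c * (h * B) + h * (H + exp Y))))"
      using c by (intro mult_left_mono) auto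
    then show "\<bar>e * c * (2 * X s * X1 s)\<bar> \<le> c * (2 * ((h * B) * (c * (h * B) + h * (H + exp Y))))"
      using e c by (simp add: abs_mult mult.assoc)
  qed
  then have "((\<lambda>s. \<bar>e * c * (X s)\<^sup>2\<bar> / c) \<longlongrightarrow> \<bar>0\<bar> / c) at_top"
    using c by (intro tendsto_intros) auto
  then have "((\<lambda>s. (X s)\<^sup>2) \<longlongrightarrow> 0) at_top" using e c by (simp add: abs_mult)
  then have "((\<lambda>s. sqrt ((X s)\<^sup>2)) \<longlongrightarrow> sqrt 0) at_top" by (rule tendsto_real_sqrt)
  then have Xlim: "(X \<longlongrightarrow> 0) at_top" by (simp add: tendsto_rabs_zero_iff)
  then show "((\<lambda>s. exp (m * y s) * (Q s - k)) \<longlongrightarrow> 0) at_top" by (simp add: X_def)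
  have "(X1 \<longlongrightarrow> 0) at_top"
  proof (rule derivative_tendsto_0[OF dX _ _ Xlim])
    fix s assume s: "a < s"
    show "(X1 has_real_derivative e * (c * X1 s + P1 s)) (at s)"
    proof -
      have "((\<lambda>s. e * (c * X s + P s)) has_real_derivative e * (c * X1 s + P1 s)) (at s)"
        by (intro DERIV_cmult DERIV_add dX dP s)
      then show ?thesis by (simp only: X1_def)
    qed
    have "\<bar>c * X1 s + P1 s\<bar> \<le> c * \<bar>X1 s\<bar> + \<bar>P1 s\<bar>"
      using c abs_triangle_ineq[of "c * X1 s" "P1 s"] by (simp add: abs_mult)
    also have "\<dots> \<le> c * (c * (h * B) + h * (H + exp Y)) + B * h * (m * H + (m + 1) * exp Y)"
      using X1b[OF s] P1b[OF s] c by (intro add_mono mult_left_mono) auto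
    finally show "\<bar>e * (c * X1 s + P1 s)\<bar> \<le> c * (c * (h * B) + h * (H + exp Y)) + B * h * (m * H + (m + 1) * exp Y)"
      using e by (simp add: abs_mult)
  qed
  then have "((\<lambda>s. X1 s / e - c * X s) \<longlongrightarrow> 0 / e - c * 0) at_top"
    using e by (intro tendsto_intros Xlim) auto
  moreover have "X1 s / e - c * X s = P s" for s using e by (auto simp: X1_def)
  ultimately show "((\<lambda>s. exp (m * y s) * (k * (1 - m * k) - exp (y s))) \<longlongrightarrow> 0) at_top"
    by (simp add: P_def H_def)
qed

text \<open>With a lower bound on \<open>y\<close> the weight can be divided out.\<close>

lemma orbit_settles_bounded_below:
  assumes e: "\<bar>e\<bar> = 1" and m: "0 \<le> m" and k: "0 < k" and mk: "2 * m * k < 1"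
    and y: "\<And>s. a < s \<Longrightarrow> (y has_real_derivative e * (Q s - k)) (at s)"
    and Q: "\<And>s. a < s \<Longrightarrow> (Q has_real_derivative e * (Q s - m * (Q s)\<^sup>2 - exp (y s))) (at s)"
    and Y: "\<And>s. a < s \<Longrightarrow> y s \<le> Y" and B: "\<And>s. a < s \<Longrightarrow> \<bar>Q s - k\<bar> \<le> B"
    and L: "((\<lambda>s. energy k m (y s) (Q s)) \<longlongrightarrow> L) at_top"
    and C: "\<And>s. a < s \<Longrightarrow> C \<le> y s"
  shows "(Q \<longlongrightarrow> k) at_top" and "(y \<longlongrightarrow> ln (k * (1 - m * k))) at_top"
proof -
  have "2 * (m * k) < 1" using mk by (simp add: mult.assoc)
  then have "0 < 1 - m * k" using mk m k mult_nonneg_nonneg[of m k] by linarith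
  then have H: "0 < k * (1 - m * k)" using k by simp
  have lower: "\<forall>\<^sub>F s in at_top. exp (m * C) \<le> exp (m * y s)"
    using eventually_gt_at_top[of a] by eventually_elim (use C m in \<open>auto intro: mult_left_mono\<close>)
  have cancel: "(f \<longlongrightarrow> 0) at_top" if "((\<lambda>s. exp (m * y s) * f s) \<longlongrightarrow> 0) at_top" for f :: "real \<Rightarrow> real"
  proof (rule Lim_null_comparison)
    show "((\<lambda>s. (1 / exp (m * C)) * norm (exp (m * y s) * f s)) \<longlongrightarrow> 0) at_top"
      by (intro tendsto_mult_right_zero tendsto_norm_zero that)
    show "\<forall>\<^sub>F s in at_top. norm (f s) \<le> (1 / exp (m * C)) * norm (exp (m * y s) * f s)"
      using lower
    proof eventually_elim
      case (elim s)
      then have "exp (m * C) * \<bar>f s\<bar> \<le> exp (m * y s) * \<bar>f s\<bar>" by (intro mult_right_mono) auto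
      then show ?case by (simp add: abs_mult field_simps)
    qed
  qed
  have "((\<lambda>s. Q s - k) \<longlongrightarrow> 0) at_top"
    by (rule cancel[OF orbit_settles(1)[OF e m k mk y Q Y B L]])
  then show "(Q \<longlongrightarrow> k) at_top" by (rule LIM_zero_cancel)
  have "((\<lambda>s. k * (1 - m * k) - exp (y s)) \<longlongrightarrow> 0) at_top"
    by (rule cancel[OF orbit_settles(2)[OF e m k mk y Q Y B L]])
  then have "((\<lambda>s. k * (1 - m * k) - (k * (1 - m * k) - exp (y s))) \<longlongrightarrow> k * (1 - m * k) - 0) at_top"
    by (intro tendsto_diff tendsto_const)
  then have "((\<lambda>s. ln (exp (y s))) \<longlongrightarrow> ln (k * (1 - m * k))) at_top"
    using H by (intro tendsto_ln) auto
  then show "(y \<longlongrightarrow> ln (k * (1 - m * k))) at_top" by simp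
qed

text \<open>For \<open>m > 0\<close> this displays the sign of the energy and shows that, for
  bounded \<open>Q\<close>, it is small where \<open>y\<close> is very negative. For
  \<open>m = 0\<close> the energy grows without bound there, whence the case distinctions
  below.\<close>

lemma energy_factored:
  assumes "0 < m"
  shows "energy k m y q = (exp (m * y))\<^sup>2 * ((q - k)\<^sup>2 / 2 + exp y / (2 * m + 1) - k * (1 - m * k) / (2 * m))"
proof -
  have h2: "exp (2 * m * y) = (exp (m * y))\<^sup>2"
    by (simp add: power2_eq_square flip: exp_add)
  have "exp ((2 * m + 1) * y) = exp (2 * m * y) * exp y"
    by (simp add: algebra_simps flip: exp_add)
  then have "pot k m y = (exp (m * y))\<^sup>2 * exp y / (2 * m + 1) - k * (1 - m * k) * (exp (m * y))\<^sup>2 / (2 * m)"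
    using assms by (simp only: pot_def h2) simp
  then show ?thesis
    unfolding energy_def power_mult_distrib by (simp add: algebra_simps)
qed

lemma pot_continuous: "0 \<le> m \<Longrightarrow> continuous_on A (pot k m)"
  by (intro continuous_at_imp_continuous_on ballI DERIV_isCont[OF pot_deriv])

lemma monotone_bounded_tendsto:
  fixes f :: "real \<Rightarrow> real"
  assumes "\<And>s t. a < s \<Longrightarrow> s \<le> t \<Longrightarrow> f s \<le> f t" and "\<And>s. a < s \<Longrightarrow> f s \<le> M"
  shows "\<exists>L. (f \<longlongrightarrow> L) at_top \<and> (\<forall>s>a. f s \<le> L)"
proof -
  have bdd: "bdd_above (f ` {a<..})" using assms(2) by (auto simp: bdd_above_def)
  define L where "L = (SUP s\<in>{a<..}. f s)"
  have le: "f s \<le> L" if "a < s" for s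
    unfolding L_def by (rule cSUP_upper[OF _ bdd]) (use that in auto)
  have "(f \<longlongrightarrow> L) at_top"
  proof (rule order_tendstoI)
    fix b assume "b < L"
    then obtain s where s: "a < s" "b < f s"
      using less_cSUP_iff[OF _ bdd, of b] by (auto simp: L_def)
    show "\<forall>\<^sub>F x in at_top. b < f x"
      using eventually_ge_at_top[of s] by eventually_elim (use assms(1)[OF s(1)] s(2) in fastforce)
  next
    fix b assume "L < b"
    show "\<forall>\<^sub>F x in at_top. f x < b"
      using eventually_gt_at_top[of a] by eventually_elim (use le \<open>L < b\<close> in fastforce)
  qed
  then show ?thesis using le by blast
qed

lemma energy_mono:
  assumes o: "orbit k m a y Q" and m: "0 \<le> m" and mk: "2 * m * k < 1" and s: "a < s" "s \<le> t"
  shows "energy k m (y s) (Q s) \<le> energy k m (y t) (Q t)"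
proof (rule mono_from[of a "\<lambda>s. energy k m (y s) (Q s)", OF _ _ s])
  fix x assume x: "a < x"
  show "((\<lambda>s. energy k m (y s) (Q s)) has_real_derivative
      1 * (1 - 2 * m * k) * (exp (m * y x) * (Q x - k))\<^sup>2) (at x)"
    by (rule energy_deriv(2)[where y = y and Q = Q and e = 1, OF m]) (use orbitD[OF o x] in simp_all)
qed (use mk in simp)

text \<open>The upper bound on \<open>y\<close> and the bound on \<open>Q\<close> are at hand; a
  lower bound on \<open>y\<close> is what the convergence of the energy still requires. In the limit
  the energy is the minimum of the potential, and being nondecreasing it was at most this minimum at
  every earlier time.\<close>

theorem singular_orbit_constant:
  assumes o: "orbit k m a y Q" and m: "0 \<le> m" and k: "0 < k" and mk: "2 * m * k < 1"
    and top: "filterlim (\<lambda>s. y s + k * s) at_top at_top"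
    and C: "\<And>s. a < s \<Longrightarrow> C \<le> y s + k * s" and s: "a < s"
  shows "y s = ln (k * (1 - m * k))"
proof -
  define E where "E = (\<lambda>s. energy k m (y s) (Q s))"
  define yy where "yy = ln (k * (1 - m * k))"
  have "2 * (m * k) < 1" using mk by (simp add: mult.assoc)
  then have "0 < 1 - m * k" using mk m k mult_nonneg_nonneg[of m k] by linarith
  then have H: "0 < k * (1 - m * k)" using k by simp
  have Qp: "0 < Q t" if "a < t" for t by (rule orbit_Q_pos[OF o m C that])
  have yb: "y t \<le> ln (k * (1 + k))" if t: "a < t" for t
  proof -
    have "exp (y t) \<le> k * (1 + k)"
      by (rule singular_orbit_bounds(2)[OF o m k top _ t]) (rule Qp)
    then show ?thesis using k by (simp add: ln_ge_iff)
  qed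
  obtain B where B: "\<And>t. s \<le> t \<Longrightarrow> Q t \<le> B"
    using singular_orbit_Q_bounded[OF o m k top _ s] Qp by blast
  have Qk: "\<bar>Q t - k\<bar> \<le> B + k" if "s < t" for t
    using B[of t] Qp[of t] that s k by auto
  have D: "(y has_real_derivative 1 * (Q t - k)) (at t)"
    "(Q has_real_derivative 1 * (Q t - m * (Q t)\<^sup>2 - exp (y t))) (at t)" if "s < t" for t
    using orbitD[OF o, of t] that s by auto
  have yb': "y t \<le> ln (k * (1 + k))" if "s < t" for t using yb[of t] that s by simp
  have mono: "E t \<le> E t'" if "a < t" "t \<le> t'" for t t'
    unfolding E_def by (rule energy_mono[OF o m mk that])
  have X2: "(exp (m * y t) * (Q t - k))\<^sup>2 \<le> (exp (m * ln (k * (1 + k))) * (B + k))\<^sup>2" if "s < t" for t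
    unfolding abs_le_square_iff[symmetric] abs_mult
    using Qk[OF that] yb[of t] that s m by (intro mult_mono) (auto intro: mult_left_mono)
  have "\<not> (\<forall>C'. \<exists>t>s. y t < C')"
  proof
    assume unb: "\<forall>C'. \<exists>t>s. y t < C'"
    \<comment> \<open>On the compact interval from \<open>s\<close> to \<open>u\<close> the function
      \<open>y\<close> has a minimum, and smaller values can occur only later. So low points recur
      arbitrarily late.\<close>
    have unb': "\<exists>t>u. y t < C'" if u: "s < u" for u C'
    proof -
      have "continuous_on {s..u} y"
        using s by (intro continuous_at_imp_continuous_on ballI DERIV_isCont[OF orbitD(1)[OF o]]) auto
      then have "\<exists>w\<in>{s..u}. \<forall>t\<in>{s..u}. y w \<le> y t"
        using u by (intro continuous_attains_inf) auto
      then obtain w where w: "\<And>t. t \<in> {s..u} \<Longrightarrow> y w \<le> y t" by blast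
      obtain t where "s < t" "y t < min C' (y w)" using unb by blast
      moreover from this have "u < t" using w[of t] by force
      ultimately show ?thesis by (intro exI[of _ t]) auto
    qed
    have "filterlim y at_bot at_top"
    proof (cases "m = 0")
      case True
      \<comment> \<open>For \<open>m = 0\<close> the energy differs from \<open>- k y\<close> by a
        bounded amount. It is large at one low point, remains large because it is nondecreasing, and
        so keeps \<open>y\<close> low from then on.\<close>
      define K where "K = (B + k)\<^sup>2 / 2 + k * (1 + k)"
      have up: "E t \<le> K - k * y t" if t: "s < t" for t
      proof -
        have "exp (y t) \<le> exp (ln (k * (1 + k)))" using yb[of t] t s by simp
        also have "\<dots> = k * (1 + k)" using k by simp
        finally show ?thesis
          using X2[OF t] True by (simp add: E_def energy_def pot_def K_def)
      qed
      have low: "exp (y t) - k * y t \<le> E t" for t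
        using True by (simp add: E_def energy_def pot_def)
      show ?thesis
        unfolding filterlim_at_bot
      proof
        fix Z
        obtain t where t: "s < t" "y t < (min 0 Z * k - K) / k" 
          using unb by blast
        have "- k * y t \<le> E t" using low[of t] by (smt (verit) exp_gt_zero mult_minus_left)
        moreover have "k * y t < min 0 Z * k - K" using t(2) k by (simp add: field_simps)
        ultimately have Et: "K - min 0 Z * k < E t" by linarith
        show "\<forall>\<^sub>F u in at_top. y u \<le> Z"
          using eventually_ge_at_top[of t]
        proof eventually_elim
          case (elim u)
          then have "K - min 0 Z * k < K - k * y u"
            using Et mono[of t u] up[of u] t s by linarith
          then have "k * y u < k * min 0 Z" by (simp add: mult.commute)
          then show ?case using k by simp
        qed
      qed
    next
      case False
      then have m0: "0 < m" using m by simp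
      define c where "c = k * (1 - m * k) / (2 * m)"
      define h where "h = (\<lambda>t. exp (m * y t))"
      have h2: "exp (2 * m * y t) = (h t)\<^sup>2" for t
        by (simp add: h_def power2_eq_square flip: exp_add)
      have EE: "E t = (h t)\<^sup>2 * ((Q t - k)\<^sup>2 / 2 + exp (y t) / (2 * m + 1) - c)" for t
        unfolding E_def h_def c_def by (rule energy_factored[OF m0])
      define K where "K = (B + k)\<^sup>2 / 2 + k * (1 + k) / (2 * m + 1) + \<bar>c\<bar>"
      have Kb: "\<bar>E t\<bar> \<le> (h t)\<^sup>2 * K" if t: "s < t" for t
      proof -
        have "exp (y t) \<le> exp (ln (k * (1 + k)))" using yb[of t] t s by simp
        also have "\<dots> = k * (1 + k)" using k by simp
        finally have 1: "exp (y t) / (2 * m + 1) \<le> k * (1 + k) / (2 * m + 1)"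
          using m by (intro divide_right_mono) auto
        have "\<bar>Q t - k\<bar> \<le> \<bar>B + k\<bar>" using Qk[OF t] by linarith
        then have 2: "(Q t - k)\<^sup>2 / 2 \<le> (B + k)\<^sup>2 / 2" by (simp add: abs_le_square_iff)
        have "0 \<le> (Q t - k)\<^sup>2 / 2" "0 \<le> exp (y t) / (2 * m + 1)" using m by auto
        then have "\<bar>(Q t - k)\<^sup>2 / 2 + exp (y t) / (2 * m + 1) - c\<bar> \<le> K"
          using 1 2 unfolding K_def by linarith
        then show ?thesis unfolding EE abs_mult by (intro mult_mono) auto
      qed
      have Kpos: "0 < K + 1" by (simp add: K_def add_nonneg_pos k m0 less_imp_le)
      \<comment> \<open>The energy is small at low points, which recur; being nondecreasing, it is
        nonpositive and tends to \<open>0\<close>. It remains to deduce that \<open>y\<close> itself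
        goes to minus infinity.\<close>
      have small: "\<exists>t>u. \<bar>E t\<bar> < d" if u: "s < u" and d: "0 < d" for u d
      proof -
        obtain t where t: "u < t" "y t < ln (d / (K + 1)) / (2 * m)" using unb'[OF u] by blast
        then have "2 * m * y t < ln (d / (K + 1))" using m0 by (simp add: field_simps)
        then have "exp (2 * m * y t) < exp (ln (d / (K + 1)))" by (simp only: exp_less_cancel_iff)
        then have ht: "(h t)\<^sup>2 < d / (K + 1)" using Kpos d by (simp add: h2)
        have "\<bar>E t\<bar> \<le> (h t)\<^sup>2 * K" using Kb t u by simp
        also have "\<dots> \<le> (h t)\<^sup>2 * (K + 1)" by (simp add: algebra_simps)
        also have "\<dots> < d" using ht Kpos by (simp add: field_simps)
        finally show ?thesis using t by blast
      qed
      have Eneg: "E t \<le> 0" if st: "s < t" for t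
      proof (rule ccontr)
        assume "\<not> E t \<le> 0"
        then obtain u where "t < u" "\<bar>E u\<bar> < E t" using small[OF st, of "E t"] by auto
        then show False using mono[of t u] st s by linarith
      qed
      have Elim: "(E \<longlongrightarrow> 0) at_top"
      proof (rule tendstoI)
        fix d :: real assume d: "0 < d"
        obtain t where t: "s + 1 < t" "\<bar>E t\<bar> < d" using small[of "s + 1" d] d by auto
        show "\<forall>\<^sub>F u in at_top. dist (E u) 0 < d"
          using eventually_ge_at_top[of t]
        proof eventually_elim
          case (elim u)
          then show ?case using mono[of t u] Eneg[of u] t s by (simp add: dist_real_def)
        qed
      qed
      have Xlim: "((\<lambda>s. h s * (Q s - k)) \<longlongrightarrow> 0) at_top"
        unfolding h_def by (rule orbit_settles(1)[OF _ m k mk D yb' Qk Elim[unfolded E_def]]) auto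
      have Plim: "((\<lambda>s. h s * (k * (1 - m * k) - exp (y s))) \<longlongrightarrow> 0) at_top"
        unfolding h_def by (rule orbit_settles(2)[OF _ m k mk D yb' Qk Elim[unfolded E_def]]) auto
      have hP: "((\<lambda>t. (h t)\<^sup>2 * (k * (1 - m * k) - exp (y t))) \<longlongrightarrow> 0) at_top"
      proof (rule Lim_null_comparison)
        show "((\<lambda>t. exp (m * ln (k * (1 + k))) * norm (h t * (k * (1 - m * k) - exp (y t)))) \<longlongrightarrow> 0) at_top"
          by (intro tendsto_mult_right_zero tendsto_norm_zero Plim)
        show "\<forall>\<^sub>F t in at_top. norm ((h t)\<^sup>2 * (k * (1 - m * k) - exp (y t)))
            \<le> exp (m * ln (k * (1 + k))) * norm (h t * (k * (1 - m * k) - exp (y t)))"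
          using eventually_gt_at_top[of s]
        proof eventually_elim
          case (elim t)
          have "h t \<le> exp (m * ln (k * (1 + k)))"
            using yb[of t] elim s m by (auto simp: h_def intro: mult_left_mono)
          then have "h t * norm (h t * (k * (1 - m * k) - exp (y t)))
            \<le> exp (m * ln (k * (1 + k))) * norm (h t * (k * (1 - m * k) - exp (y t)))"
            by (rule mult_right_mono) simp
          then show ?case by (simp add: abs_mult power2_eq_square mult.assoc h_def)
        qed
      qed
      \<comment> \<open>Eliminating \<open>Q\<close> and \<open>exp y\<close> between the energy and
        the two limits leaves \<open>h^2 G\<close>. As \<open>G > 0\<close>, the weight
        \<open>h\<close> tends to \<open>0\<close>.\<close>
      define G where "G = c - k * (1 - m * k) / (2 * m + 1)"
      have "k * (1 - m * k) / (2 * m + 1) < k * (1 - m * k) / (2 * m)"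
        using H m0 by (intro divide_strict_left_mono) auto
      then have G: "0 < G" by (simp add: G_def c_def)
      have "((\<lambda>t. ((h t * (Q t - k))\<^sup>2 / 2 - E t - (h t)\<^sup>2 * (k * (1 - m * k) - exp (y t)) / (2 * m + 1)) / G)
          \<longlongrightarrow> (0\<^sup>2 / 2 - 0 - 0 / (2 * m + 1)) / G) at_top"
        using G m by (intro tendsto_intros Xlim Elim hP) auto
      moreover have "((h t * (Q t - k))\<^sup>2 / 2 - E t - (h t)\<^sup>2 * (k * (1 - m * k) - exp (y t)) / (2 * m + 1)) / G
          = (h t)\<^sup>2" for t
      proof -
        have "(h t * (Q t - k))\<^sup>2 / 2 - E t - (h t)\<^sup>2 * (k * (1 - m * k) - exp (y t)) / (2 * m + 1)
            = (h t)\<^sup>2 * G"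
          unfolding EE G_def power_mult_distrib by (simp add: distrib_left right_diff_distrib diff_divide_distrib)
        then show ?thesis using G by simp
      qed
      ultimately have "((\<lambda>t. exp (2 * m * y t)) \<longlongrightarrow> 0) at_top" by (simp add: h2)
      then have "filterlim (\<lambda>t. exp (2 * m * y t)) (at_right 0) at_top"
        by (intro tendsto_imp_filterlim_at_right) auto
      then have "filterlim (\<lambda>t. ln (exp (2 * m * y t))) at_bot at_top"
        by (rule filterlim_compose[OF ln_at_0])
      then have "filterlim (\<lambda>t. 2 * m * y t) at_bot at_top" by simp
      then have "filterlim (\<lambda>t. (1 / (2 * m)) * (2 * m * y t)) at_bot at_top"
        by (rule filterlim_tendsto_pos_mult_at_bot[OF tendsto_const, rotated]) (use m0 in simp)
      moreover have "(1 / (2 * m)) * (2 * m * y t) = y t" for t using m0 by simp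
      ultimately show ?thesis by simp
    qed
    then have "\<not> filterlim (\<lambda>s. y s + k * s) at_top at_top"
      by (rule orbit_near_axis_bounded[OF o m k mk, rotated]) (rule Qp)
    then show False using top by contradiction
  qed
  then obtain C' where C': "\<And>t. s < t \<Longrightarrow> C' \<le> y t" by (meson not_less)
  have "bdd_above (pot k m ` {C'..ln (k * (1 + k))})"
    by (intro bounded_imp_bdd_above compact_imp_bounded compact_continuous_image pot_continuous m) simp
  then obtain P where P: "\<And>z. z \<in> {C'..ln (k * (1 + k))} \<Longrightarrow> pot k m z \<le> P"
    unfolding bdd_above_def by blast
  have Eb: "E t \<le> (exp (m * ln (k * (1 + k))) * (B + k))\<^sup>2 / 2 + P" if "s < t" for t
    using X2[OF that] P[of "y t"] C'[OF that] yb[of t] that s by (auto simp: E_def energy_def)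
  have "\<exists>L. (E \<longlongrightarrow> L) at_top \<and> (\<forall>t>s. E t \<le> L)"
    by (rule monotone_bounded_tendsto[OF _ Eb]) (use mono s in auto)
  then obtain L where L: "(E \<longlongrightarrow> L) at_top" "\<And>t. s < t \<Longrightarrow> E t \<le> L" by blast
  have Qlim: "(Q \<longlongrightarrow> k) at_top"
    by (rule orbit_settles_bounded_below(1)[OF _ m k mk D yb' Qk L(1)[unfolded E_def] C']) auto
  have ylim: "(y \<longlongrightarrow> yy) at_top" unfolding yy_def
    by (rule orbit_settles_bounded_below(2)[OF _ m k mk D yb' Qk L(1)[unfolded E_def] C']) auto
  have "((\<lambda>t. pot k m (y t)) \<longlongrightarrow> pot k m yy) at_top"
    by (rule isCont_tendsto_compose[OF DERIV_isCont[OF pot_deriv[OF m]] ylim])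
  then have "(E \<longlongrightarrow> (exp (m * yy) * (k - k))\<^sup>2 / 2 + pot k m yy) at_top"
    unfolding E_def energy_def by (intro tendsto_intros ylim Qlim) auto
  then have "L = (exp (m * yy) * (k - k))\<^sup>2 / 2 + pot k m yy"
    by (rule tendsto_unique[OF trivial_limit_at_top_linorder L(1)])
  then have "L = pot k m yy" by simp
  moreover have "E s \<le> E (s + 1)" using mono[of s "s+1"] s by simp
  ultimately have "E s \<le> pot k m yy" using L(2)[of "s + 1"] by simp
  then have "pot k m (y s) \<le> pot k m yy" unfolding E_def energy_def by (smt (verit) zero_le_power2 field_sum_of_halves)
  then show ?thesis using pot_min[OF m H, of "y s"] by (auto simp: yy_def)
qed

section \<open>Regular orbits: confinement, limit at minus infinity, uniqueness\<close>

lemma regular_orbit_Q_tendsto: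
  assumes o: "orbit k m a y Q" and m: "0 \<le> m" and k: "0 < k" and mk: "2 * m * k < 1"
    and C: "\<And>s. a < s \<Longrightarrow> C \<le> y s + k * s"
    and lim: "((\<lambda>s. y s + k * s) \<longlongrightarrow> A) at_top"
  shows "filterlim y at_bot at_top" and "(Q \<longlongrightarrow> 0) at_top"
proof -
  have "filterlim (\<lambda>s. k * s) at_top at_top"
    using k by (intro filterlim_tendsto_pos_mult_at_top[OF tendsto_const _ filterlim_ident])
  then have "filterlim (\<lambda>s. - (k * s)) at_bot at_top" by (simp add: filterlim_uminus_at_top)
  then have "filterlim (\<lambda>s. (y s + k * s) + - (k * s)) at_bot at_top"
    by (simp only: filterlim_tendsto_add_at_bot_iff[OF lim])
  then show ybot: "filterlim y at_bot at_top" by simp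
  have Qp: "0 < Q s" if "a < s" for s by (rule orbit_Q_pos[OF o m C that])
  have near: "\<forall>\<^sub>F s in at_top. k * Q s \<le> exp (y s)"
    by (rule orbit_near_axis[OF o m k mk Qp ybot])
  show "(Q \<longlongrightarrow> 0) at_top"
  proof (rule Lim_null_comparison)
    show "\<forall>\<^sub>F s in at_top. norm (Q s) \<le> exp (y s) / k"
      using near eventually_gt_at_top[of a]
    proof eventually_elim
      case (elim s)
      then show ?case using Qp[of s] k by (simp add: field_simps)
    qed
    have "((\<lambda>s. exp (y s)) \<longlongrightarrow> 0) at_top" by (rule filterlim_compose[OF exp_at_bot ybot])
    then show "((\<lambda>s. exp (y s) / k) \<longlongrightarrow> 0) at_top"
      using tendsto_divide[OF _ tendsto_const[of k]] k by fastforce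
  qed
qed

lemma abs_le_of_square_le:
  fixes x c :: real
  assumes "x\<^sup>2 \<le> c"
  shows "\<bar>x\<bar> \<le> c + 1"
proof (rule ccontr)
  assume neg: "\<not> \<bar>x\<bar> \<le> c + 1"
  have "0 \<le> c" using assms zero_le_power2[of x] by linarith
  then have "\<bar>x\<bar> * 1 \<le> \<bar>x\<bar> * \<bar>x\<bar>" using neg by (intro mult_left_mono) auto
  then show False using assms neg by (simp add: power2_eq_square)
qed

text \<open>Backwards in \<open>s\<close> the energy cannot increase, so the orbit stays in a
  sublevel set. For \<open>m = 0\<close> the potential is coercive. For \<open>m > 0\<close> only
  the sublevel sets of negative levels are bounded, and the start is moved to a late
  \<open>s1\<close> with negative energy. The bounds are uniform in \<open>a\<close>: they serve an
  entire orbit as well as one that might break down at \<open>a\<close>.\<close>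

lemma regular_orbit_bounds:
  assumes m: "0 \<le> m" and k: "0 < k" and mk: "2 * m * k < 1"
    and ybot: "filterlim y at_bot at_top" and Qlim: "(Q \<longlongrightarrow> 0) at_top"
  shows "\<exists>B Y C s1. s0 \<le> s1 \<and> (\<forall>a. orbit k m a y Q \<longrightarrow> (\<forall>s. a < s \<and> s \<le> s1 \<longrightarrow> \<bar>Q s - k\<bar> \<le> B \<and> y s \<le> Y \<and> C \<le> y s))"
proof (cases "m = 0")
  case True
  define E1 where "E1 = energy k m (y s0) (Q s0)"
  obtain e1 where e1: "E1 \<le> e1" "0 \<le> e1" by (meson abs_ge_self abs_ge_zero)
  define p where "p = pot k m (ln (k * (1 - m * k)))"
  have "\<bar>Q s - k\<bar> \<le> 2 * (E1 - p) + 1 \<and> y s \<le> 4 * k + 4 + 4 * e1 \<and> - E1 / k \<le> y s"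
    if o: "orbit k m a y Q" and s: "a < s" "s \<le> s0" for a s
  proof -
    have E: "(Q s - k)\<^sup>2 / 2 + pot k m (y s) \<le> E1"
      using energy_mono[OF o m mk s] True by (simp add: E1_def energy_def)
    have pot: "pot k m (y s) = exp (y s) - k * y s" using True by (simp add: pot_def)
    have "p \<le> pot k m (y s)"
      using pot_min[OF m, of k "y s"] k True by (cases "y s = ln k") (auto simp: p_def)
    then have "(Q s - k)\<^sup>2 \<le> 2 * (E1 - p)" using E by simp
    then have "\<bar>Q s - k\<bar> \<le> 2 * (E1 - p) + 1" by (rule abs_le_of_square_le)
    moreover have "exp (y s) - k * y s \<le> E1"
      using E zero_le_power2[of "Q s - k"] unfolding pot by linarith
    then have e: "exp (y s) \<le> E1 + k * y s" by linarith
    then have "- E1 < k * y s" using exp_gt_zero[of "y s"] by linarith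
    then have "- E1 / k \<le> y s" using k by (simp add: field_simps)
    \<comment> \<open>Since \<open>exp y \<ge> (y / 2)^2\<close>, the energy is at least
      \<open>y (y / 4 - k)\<close>, and beyond this bound that product is too large.\<close>
    moreover have "y s \<le> 4 * k + 4 + 4 * e1"
    proof (rule ccontr)
      assume neg: "\<not> ?thesis"
      then have y0: "1 \<le> y s" using k e1 by linarith
      have "(y s / 2)\<^sup>2 \<le> (exp (y s / 2))\<^sup>2"
        using exp_ge_add_one_self[of "y s / 2"] y0 by (intro power_mono) linarith+
      also have "(exp (y s / 2))\<^sup>2 = exp (y s)" by (simp add: power2_eq_square flip: exp_add)
      finally have "y s * (y s / 4 - k) \<le> E1" using e by (simp add: power2_eq_square algebra_simps)
      moreover have "1 * (1 + e1) \<le> y s * (y s / 4 - k)"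
        using y0 neg e1 by (intro mult_mono) auto
      ultimately have "1 * (1 + e1) \<le> E1" by (rule order.trans[rotated])
      then have "1 + e1 \<le> E1" by simp
      then show False using e1 by simp
    qed
    ultimately show ?thesis by blast
  qed
  then show ?thesis by (meson order_refl)
next
  case False
  then have m0: "0 < m" using m by simp
  define c where "c = k * (1 - m * k) / (2 * m)"
  define br where "br = (\<lambda>s. (Q s - k)\<^sup>2 / 2 + exp (y s) / (2 * m + 1) - c)"
  have EE: "energy k m (y s) (Q s) = (exp (m * y s))\<^sup>2 * br s" for s
    unfolding br_def c_def by (rule energy_factored[OF m0])
  have "((\<lambda>s. exp (y s)) \<longlongrightarrow> 0) at_top" by (rule filterlim_compose[OF exp_at_bot ybot])
  then have "(br \<longlongrightarrow> (0 - k)\<^sup>2 / 2 + 0 / (2 * m + 1) - c) at_top"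
    unfolding br_def using m by (intro tendsto_intros Qlim) auto
  \<comment> \<open>Equivalent to \<open>2 m k < 1\<close>. It says that the bracket is negative in
    the limit \<open>Q = 0\<close>, \<open>exp y = 0\<close>.\<close>
  moreover have cpos: "k\<^sup>2 / 2 < c"
    using mk m0 k by (simp add: c_def field_simps power2_eq_square)
  ultimately have "\<forall>\<^sub>F s in at_top. br s < 0" by (intro order_tendstoD(2)) auto
  then have "\<forall>\<^sub>F s in at_top. br s < 0 \<and> s0 \<le> s"
    using eventually_ge_at_top by (rule eventually_conj)
  then obtain s1 where s1: "br s1 < 0" "s0 \<le> s1" by (auto simp: eventually_at_top_linorder)
  define e0 where "e0 = - energy k m (y s1) (Q s1)"
  have e0: "0 < e0" using s1 by (simp add: e0_def EE mult_less_0_iff)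
  have c0: "0 < c" using cpos zero_le_power2[of k] by linarith
  have "\<bar>Q s - k\<bar> \<le> 2 * c + 1 \<and> y s \<le> ln (c * (2 * m + 1)) \<and> ln (e0 / c) / (2 * m) \<le> y s"
    if o: "orbit k m a y Q" and s: "a < s" "s \<le> s1" for a s
  proof -
    have E: "(exp (m * y s))\<^sup>2 * br s \<le> - e0"
      using energy_mono[OF o m mk s] by (simp add: e0_def flip: EE)
    then have "(exp (m * y s))\<^sup>2 * br s < 0" using e0 by linarith
    then have b: "br s < 0" by (simp add: mult_less_0_iff)
    have e: "0 < exp (y s) / (2 * m + 1)" using m by simp
    have "(Q s - k)\<^sup>2 \<le> 2 * c" using b e unfolding br_def by linarith
    then have 1: "\<bar>Q s - k\<bar> \<le> 2 * c + 1" by (rule abs_le_of_square_le)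
    have "exp (y s) / (2 * m + 1) \<le> c"
      using b zero_le_power2[of "Q s - k"] unfolding br_def by linarith
    then have "exp (y s) \<le> c * (2 * m + 1)" using m by (simp add: field_simps)
    then have 2: "y s \<le> ln (c * (2 * m + 1))" using c0 m by (simp add: ln_ge_iff)
    have "- c \<le> br s" using e zero_le_power2[of "Q s - k"] unfolding br_def by linarith
    then have "(exp (m * y s))\<^sup>2 * (- c) \<le> (exp (m * y s))\<^sup>2 * br s" by (intro mult_left_mono) auto
    then have "e0 \<le> (exp (m * y s))\<^sup>2 * c" using E by linarith
    then have "e0 / c \<le> (exp (m * y s))\<^sup>2" using c0 by (simp add: field_simps)
    also have "\<dots> = exp (2 * m * y s)" by (simp add: power2_eq_square flip: exp_add)
    finally have "ln (e0 / c) \<le> 2 * m * y s" using e0 c0 by (simp add: ln_le_cancel_iff[symmetric] del: ln_le_cancel_iff)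
    then have "ln (e0 / c) / (2 * m) \<le> y s" using m0 by (simp add: field_simps)
    then show ?thesis using 1 2 by blast
  qed
  then show ?thesis using s1(2) by blast
qed

text \<open>Time is reversed, with \<open>e = - 1\<close>. The energy is then nonincreasing and
  bounded below by the minimum of the potential, and the confinement makes the orbit settle.\<close>

theorem regular_orbit_at_bot:
  assumes o: "\<And>a. orbit k m a y Q" and m: "0 \<le> m" and k: "0 < k" and mk: "2 * m * k < 1"
    and ybot: "filterlim y at_bot at_top" and Qlim: "(Q \<longlongrightarrow> 0) at_top"
  shows "(y \<longlongrightarrow> ln (k * (1 - m * k))) at_bot" and "(Q \<longlongrightarrow> k) at_bot"
proof -
  have "2 * (m * k) < 1" using mk by (simp add: mult.assoc)
  then have "0 < 1 - m * k" using mk m k mult_nonneg_nonneg[of m k] by linarith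
  then have H: "0 < k * (1 - m * k)" using k by simp
  obtain B Y C s1 where b: "\<And>s. s \<le> s1 \<Longrightarrow> \<bar>Q s - k\<bar> \<le> B \<and> y s \<le> Y \<and> C \<le> y s"
    using regular_orbit_bounds[OF m k mk ybot Qlim] o lt_ex by meson
  define yr Qr where "yr = (\<lambda>s. y (- s))" and "Qr = (\<lambda>s. Q (- s))"
  have D: "(yr has_real_derivative - 1 * (Qr s - k)) (at s)"
    "(Qr has_real_derivative - 1 * (Qr s - m * (Qr s)\<^sup>2 - exp (yr s))) (at s)" for s
    using orbitD[OF o, of "- s - 1" "- s"] by (auto simp: yr_def Qr_def DERIV_mirror)
  have b': "yr s \<le> Y" "\<bar>Qr s - k\<bar> \<le> B" "C \<le> yr s" if "- s1 < s" for s
    using b[of "- s"] that by (auto simp: yr_def Qr_def)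
  define p where "p = pot k m (ln (k * (1 - m * k)))"
  have "\<exists>L. ((\<lambda>s. - energy k m (yr s) (Qr s)) \<longlongrightarrow> L) at_top \<and> (\<forall>s>0. - energy k m (yr s) (Qr s) \<le> L)"
  proof (rule monotone_bounded_tendsto)
    fix s t :: real assume "0 < s" "s \<le> t"
    then show "- energy k m (yr s) (Qr s) \<le> - energy k m (yr t) (Qr t)"
      using energy_mono[OF o m mk, of "- t - 1" "- t" "- s"] by (simp add: yr_def Qr_def)
  next
    fix s :: real
    have "p \<le> pot k m (yr s)"
      using pot_min[OF m H, of "yr s"] by (cases "yr s = ln (k * (1 - m * k))") (auto simp: p_def)
    then show "- energy k m (yr s) (Qr s) \<le> - p"
      unfolding energy_def using zero_le_power2[of "exp (m * yr s) * (Qr s - k)"] by linarith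
  qed
  then obtain L where "((\<lambda>s. - energy k m (yr s) (Qr s)) \<longlongrightarrow> L) at_top" by blast
  from tendsto_minus[OF this] have L: "((\<lambda>s. energy k m (yr s) (Qr s)) \<longlongrightarrow> - L) at_top" by simp
  have "(Qr \<longlongrightarrow> k) at_top"
    by (rule orbit_settles_bounded_below(1)[OF _ m k mk D b'(1,2) L b'(3)]) auto
  then show "(Q \<longlongrightarrow> k) at_bot" by (simp add: filterlim_at_bot_mirror Qr_def)
  have "(yr \<longlongrightarrow> ln (k * (1 - m * k))) at_top"
    by (rule orbit_settles_bounded_below(2)[OF _ m k mk D b'(1,2) L b'(3)]) auto
  then show "(y \<longlongrightarrow> ln (k * (1 - m * k))) at_bot" by (simp add: filterlim_at_bot_mirror yr_def)
qed

text \<open>A factor \<open>g\<close> in place of an intermediate point lets the difference of two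
  orbits satisfy a linear system with controlled coefficients.\<close>

lemma exp_difference_quotient:
  fixes x y A :: real
  assumes "x \<le> A" "y \<le> A"
  shows "\<exists>g. exp x - exp y = g * (x - y) \<and> 0 \<le> g \<and> g \<le> exp A"
proof -
  have *: "\<exists>g. exp x - exp y = g * (x - y) \<and> 0 \<le> g \<and> g \<le> exp A" if xy: "x < y" "y \<le> A" for x y :: real
  proof -
    obtain z where z: "x < z" "z < y" "exp y - exp x = (y - x) * exp z"
      using MVT2[OF xy(1), of exp exp] DERIV_exp by blast
    then show ?thesis using xy by (intro exI[of _ "exp z"]) (auto simp: algebra_simps)
  qed
  consider "x < y" | "x = y" | "y < x" by linarith
  then show ?thesis
  proof cases
    case 2
    then show ?thesis by (intro exI[of _ 0]) auto
  next
    case 3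
    then obtain g where "exp y - exp x = g * (y - x)" "0 \<le> g" "g \<le> exp A" using *[of y x] assms by blast
    then show ?thesis by (intro exI[of _ g]) (auto simp: algebra_simps)
  qed (use * assms in blast)
qed

text \<open>The data sit at infinity, so a Gronwall argument runs backwards from there. The linear
  part \<open>d' = e\<close>, \<open>e' = e\<close> conserves \<open>d - e\<close> and contracts
  \<open>e\<close> backwards; the remaining coefficients are integrable.\<close>

theorem regular_orbit_unique:
  assumes o1: "orbit k m a y1 Q1" and o2: "orbit k m a y2 Q2" and m: "0 \<le> m" and k: "0 < k"
    and l1: "((\<lambda>s. y1 s + k * s) \<longlongrightarrow> A) at_top" and l2: "((\<lambda>s. y2 s + k * s) \<longlongrightarrow> A) at_top"
    and q1: "(Q1 \<longlongrightarrow> 0) at_top" and q2: "(Q2 \<longlongrightarrow> 0) at_top"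
    and p1: "\<And>s. a < s \<Longrightarrow> 0 < Q1 s" and p2: "\<And>s. a < s \<Longrightarrow> 0 < Q2 s" and s: "a < s"
  shows "y1 s = y2 s"
proof -
  have upper: "y t + k * t \<le> A"
    if o: "orbit k m a y Q" and l: "((\<lambda>s. y s + k * s) \<longlongrightarrow> A) at_top"
      and p: "\<And>s. a < s \<Longrightarrow> 0 < Q s" and t: "a < t" for y Q t
  proof (rule tendsto_lowerbound[OF l])
    have "y t + k * t \<le> y u + k * u" if u: "t \<le> u" for u
    proof (rule mono_from[where g = "\<lambda>s. y s + k * s" and g' = Q, OF _ _ t u])
      fix x assume x: "a < x"
      show "((\<lambda>s. y s + k * s) has_real_derivative Q x) (at x)"
        using orbitD(1)[OF o x] by (auto intro!: derivative_eq_intros)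
      show "0 \<le> Q x" using p[OF x] by simp
    qed
    then show "\<forall>\<^sub>F u in at_top. y t + k * t \<le> y u + k * u"
      by (auto simp: eventually_at_top_linorder)
  qed auto
  \<comment> \<open>The squared distance \<open>V\<close> vanishes at infinity, and the bounded integrating factor \<open>exp P\<close> makes it
    nondecreasing.\<close>
  define d where "d = (\<lambda>s. y1 s - y2 s)"
  define e where "e = (\<lambda>s. Q1 s - Q2 s)"
  define V where "V = (\<lambda>s. (d s - e s)\<^sup>2 + (e s)\<^sup>2)"
  define P where "P = (\<lambda>s. 3 * m * (y1 s + k * s + (y2 s + k * s)) - 2 * exp A / k * exp (- k * s))"
  have "V s * exp (P s) \<le> V t * exp (P t)" if t: "s \<le> t" for t
  proof (rule DERIV_nonneg_imp_nondecreasing[where f = "\<lambda>s. V s * exp (P s)", OF t])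
    fix x assume x: "s \<le> x" "x \<le> t"
    then have ax: "a < x" using s by linarith
    note D1 = orbitD[OF o1 ax] and D2 = orbitD[OF o2 ax]
    obtain g where g: "exp (y1 x) - exp (y2 x) = g * (y1 x - y2 x)" "0 \<le> g" "g \<le> exp (A - k * x)"
      using exp_difference_quotient[of "y1 x" "A - k * x" "y2 x"]
        upper[OF o1 l1 p1 ax] upper[OF o2 l2 p2 ax] by (auto simp: algebra_simps)
    define \<mu> where "\<mu> = m * (Q1 x + Q2 x)"
    define W where "W = 2 * (d x - e x) * (\<mu> * e x + g * d x) + 2 * e x * (e x - \<mu> * e x - g * d x)"
    have mu: "0 \<le> \<mu>" using m p1[OF ax] p2[OF ax] by (simp add: \<mu>_def)
    have dd: "(d has_real_derivative e x) (at x)"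
      unfolding d_def e_def using D1 D2 by (auto intro!: derivative_eq_intros)
    have "(e has_real_derivative (Q1 x - m * (Q1 x)\<^sup>2 - exp (y1 x)) - (Q2 x - m * (Q2 x)\<^sup>2 - exp (y2 x))) (at x)"
      unfolding e_def using D1 D2 by (intro DERIV_diff)
    moreover have "(Q1 x - m * (Q1 x)\<^sup>2 - exp (y1 x)) - (Q2 x - m * (Q2 x)\<^sup>2 - exp (y2 x))
        = e x - \<mu> * e x - g * d x"
      using g(1) by (simp add: \<mu>_def e_def d_def algebra_simps power2_eq_square)
    ultimately have de: "(e has_real_derivative e x - \<mu> * e x - g * d x) (at x)" by simp
    have dV: "(V has_real_derivative W) (at x)"
      unfolding V_def W_def using dd de by (auto intro!: derivative_eq_intros)
    \<comment> \<open>Both terms have bounded antiderivatives: \<open>\<mu>\<close> is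
      \<open>m\<close> times the derivative of the convergent sum of \<open>y1 + k s\<close> and
      \<open>y2 + k s\<close>, and \<open>exp (- k s)\<close> decays.\<close>
    have dP: "(P has_real_derivative 3 * \<mu> + 2 * exp (A - k * x)) (at x)"
      unfolding P_def \<mu>_def using D1 D2 k
      by (auto intro!: derivative_eq_intros simp: exp_diff exp_minus field_simps)
    have "((\<lambda>s. V s * exp (P s)) has_real_derivative (W + (3 * \<mu> + 2 * exp (A - k * x)) * V x) * exp (P x)) (at x)"
      using dV dP by (auto intro!: derivative_eq_intros simp: algebra_simps)
    moreover have "0 \<le> W + (3 * \<mu> + 2 * exp (A - k * x)) * V x"
    proof -
      have V0: "0 \<le> V x" by (simp add: V_def)
      define p where "p = d x - e x"
      have dp: "d x = p + e x" by (simp add: p_def)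
      \<comment> \<open>In the variables \<open>d - e\<close> and \<open>e\<close> the mixed terms
        with \<open>g\<close> cancel, and these multiples of \<open>V\<close> turn the rest into
        squares.\<close>
      have "W + (3 * \<mu> + 2 * g) * V x
          = \<mu> * (p + e x)\<^sup>2 + 2 * \<mu> * p\<^sup>2 + 4 * g * p\<^sup>2 + 2 * (e x)\<^sup>2"
        unfolding W_def V_def dp by (simp add: algebra_simps power2_eq_square)
      also have "0 \<le> \<dots>" using mu g by (intro add_nonneg_nonneg mult_nonneg_nonneg) auto
      finally have "0 \<le> W + (3 * \<mu> + 2 * g) * V x" .
      also have "\<dots> \<le> W + (3 * \<mu> + 2 * exp (A - k * x)) * V x"
        using g V0 mu by (intro add_mono mult_right_mono) auto
      finally show ?thesis .
    qed
    ultimately show "\<exists>z. ((\<lambda>s. V s * exp (P s)) has_real_derivative z) (at x) \<and> 0 \<le> z"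
      by (intro exI conjI) (assumption, intro mult_nonneg_nonneg, auto)
  qed
  moreover have "((\<lambda>s. V s * exp (P s)) \<longlongrightarrow> 0) at_top"
  proof -
    have "((\<lambda>s. (y1 s + k * s) - (y2 s + k * s)) \<longlongrightarrow> A - A) at_top" by (intro tendsto_diff l1 l2)
    then have dl: "(d \<longlongrightarrow> 0) at_top" by (simp add: d_def)
    have el: "(e \<longlongrightarrow> 0 - 0) at_top" unfolding e_def by (intro tendsto_diff q1 q2)
    have "filterlim (\<lambda>s. k * s) at_top at_top"
      using k by (intro filterlim_tendsto_pos_mult_at_top[OF tendsto_const _ filterlim_ident])
    then have kl: "((\<lambda>s. exp (- k * s)) \<longlongrightarrow> 0) at_top"
      by (intro filterlim_compose[OF exp_at_bot]) (simp add: filterlim_uminus_at_top)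
    have "(P \<longlongrightarrow> 3 * m * (A + A) - 2 * exp A / k * 0) at_top"
      unfolding P_def by (intro tendsto_intros l1 l2 kl)
    then have "((\<lambda>s. V s * exp (P s)) \<longlongrightarrow> ((0 - (0 - 0))\<^sup>2 + (0 - 0)\<^sup>2) * exp (3 * m * (A + A) - 2 * exp A / k * 0)) at_top"
      unfolding V_def by (intro tendsto_intros dl el)
    then show ?thesis by simp
  qed
  then have "V s * exp (P s) \<le> 0"
    by (rule tendsto_lowerbound) (use calculation in \<open>auto simp: eventually_at_top_linorder\<close>)
  then have "V s \<le> 0" by (simp add: mult_le_0_iff)
  then have "d s - e s = 0 \<and> e s = 0" unfolding V_def by (rule sum_power2_le_zero_iff[THEN iffD1])
  then have "d s = 0" by simp
  then show ?thesis by (simp add: d_def)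
qed

section \<open>Existence of the regular orbit\<close>

text \<open>For continuous \<open>g\<close> this is the solution of \<open>v' = g - a v / x\<close>
  that stays bounded at \<open>0\<close>, where the homogeneous solution \<open>x powr (- a)\<close>
  is singular. Up to the factor \<open>a\<close> it will be the velocity \<open>z\<close> of the
  regular orbit.\<close>

definition weighted_mean :: "real \<Rightarrow> (real \<Rightarrow> real) \<Rightarrow> real \<Rightarrow> real" where
  "weighted_mean a g x = x powr (- a) * integral {0..x} (\<lambda>\<xi>. \<xi> powr a * g \<xi>)"

lemma continuous_powr_mult:
  fixes g :: "real \<Rightarrow> real"
  assumes "0 < a" "continuous_on UNIV g"
  shows "continuous_on {0..x} (\<lambda>\<xi>. \<xi> powr a * g \<xi>)"
  using assms by (intro continuous_intros continuous_on_subset[OF assms(2)] continuous_on_powr') auto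

text \<open>The weights \<open>(\<xi> / x) powr a\<close> are at most \<open>1\<close>.\<close>

lemma weighted_mean_abs_le:
  fixes g G :: "real \<Rightarrow> real"
  assumes a: "0 < a" and g: "continuous_on UNIV g" and G: "continuous_on UNIV G"
    and le: "\<And>\<xi>. 0 \<le> \<xi> \<Longrightarrow> \<xi> \<le> x \<Longrightarrow> \<bar>g \<xi>\<bar> \<le> G \<xi>" and x: "0 \<le> x"
  shows "\<bar>weighted_mean a g x\<bar> \<le> integral {0..x} G"
proof (cases "x = 0")
  case False
  with x have x: "0 < x" by simp
  have iG: "G integrable_on {0..x}"
    by (intro integrable_continuous_interval continuous_on_subset[OF G]) auto
  have "norm (integral {0..x} (\<lambda>\<xi>. \<xi> powr a * g \<xi>)) \<le> integral {0..x} (\<lambda>\<xi>. x powr a * G \<xi>)"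
  proof (rule integral_norm_bound_integral)
    show "(\<lambda>\<xi>. \<xi> powr a * g \<xi>) integrable_on {0..x}"
      by (intro integrable_continuous_interval continuous_powr_mult a g)
    show "(\<lambda>\<xi>. x powr a * G \<xi>) integrable_on {0..x}" using integrable_on_mult_right[OF iG] .
    fix \<xi> assume "\<xi> \<in> {0..x}"
    then show "norm (\<xi> powr a * g \<xi>) \<le> x powr a * G \<xi>"
      using le[of \<xi>] a by (auto simp: abs_mult intro!: mult_mono powr_mono2)
  qed
  then have "\<bar>integral {0..x} (\<lambda>\<xi>. \<xi> powr a * g \<xi>)\<bar> \<le> x powr a * integral {0..x} G" by simp
  then have "x powr (- a) * \<bar>integral {0..x} (\<lambda>\<xi>. \<xi> powr a * g \<xi>)\<bar>
      \<le> x powr (- a) * (x powr a * integral {0..x} G)"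
    by (intro mult_left_mono) auto
  also have "\<dots> = integral {0..x} G" using x by (simp add: powr_minus field_simps)
  finally show ?thesis by (simp add: weighted_mean_def abs_mult)
qed (simp add: weighted_mean_def)

lemma weighted_mean_diff:
  assumes "0 < a" "continuous_on UNIV g" "continuous_on UNIV h"
  shows "weighted_mean a g x - weighted_mean a h x = weighted_mean a (\<lambda>\<xi>. g \<xi> - h \<xi>) x"
proof -
  have "integral {0..x} (\<lambda>\<xi>. \<xi> powr a * g \<xi> - \<xi> powr a * h \<xi>)
      = integral {0..x} (\<lambda>\<xi>. \<xi> powr a * g \<xi>) - integral {0..x} (\<lambda>\<xi>. \<xi> powr a * h \<xi>)"
    by (intro integral_diff integrable_continuous_interval continuous_powr_mult assms)
  then show ?thesis by (simp add: weighted_mean_def right_diff_distrib)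
qed

lemma indefinite_integral_deriv:
  fixes g :: "real \<Rightarrow> real"
  assumes "\<And>b. continuous_on {0..b} g" "0 < x"
  shows "((\<lambda>x. integral {0..x} g) has_real_derivative g x) (at x)"
proof -
  have "((\<lambda>x. integral {0..x} g) has_real_derivative g x) (at x within {0..x+1})"
    using assms by (intro integral_has_real_derivative) auto
  moreover have "at x within {0..x+1} = at x"
    using assms(2) by (intro at_within_Icc_at) auto
  ultimately show ?thesis by simp
qed

lemma weighted_mean_deriv:
  fixes g :: "real \<Rightarrow> real"
  assumes a: "0 < a" and g: "continuous_on UNIV g" and x: "0 < x"
  shows "(weighted_mean a g has_real_derivative g x - a * weighted_mean a g x / x) (at x)"
proof -
  have 1: "((\<lambda>x. integral {0..x} (\<lambda>\<xi>. \<xi> powr a * g \<xi>)) has_real_derivative x powr a * g x) (at x)"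
    by (rule indefinite_integral_deriv[OF continuous_powr_mult[OF a g] x])
  have 2: "((\<lambda>x. x powr (- a)) has_real_derivative - a * x powr (- a - 1)) (at x)"
    using x by (auto intro!: derivative_eq_intros)
  have "x powr (- a) * (x powr a * g x) = g x"
    using x by (simp add: powr_minus field_simps)
  moreover have "x powr (- a - 1) = x powr (- a) / x" using x by (simp add: powr_diff)
  ultimately show ?thesis
    unfolding weighted_mean_def[abs_def]
    by (intro DERIV_cong[OF DERIV_mult[OF 2 1]]) (simp add: algebra_simps)
qed

lemma lipschitz_abs_continuous:
  fixes F :: "real \<Rightarrow> real"
  assumes "\<And>x y. \<bar>F x - F y\<bar> \<le> L * \<bar>x - y\<bar>"
  shows "continuous_on UNIV F"
proof (rule lipschitz_on_continuous_on[of L])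
  show "L-lipschitz_on UNIV F"
    using assms assms[of 1 0] by (auto simp: lipschitz_on_def dist_real_def)
qed

text \<open>With \<open>x = exp (- k s)\<close> and \<open>a = 1/k\<close>, the regular orbits are the solutions of this integral
  equation that are continuous up to \<open>x = 0\<close>.\<close>

definition volterra :: "real \<Rightarrow> real \<Rightarrow> (real \<Rightarrow> real) \<Rightarrow> real \<Rightarrow> real" where
  "volterra a w0 g x = w0 - a * (integral {0..x} g - weighted_mean a g x)"

text \<open>With \<open>v\<close> the weighted mean, \<open>a v / x\<close> is
  \<open>g - v'\<close>. Its integral from \<open>0\<close> is therefore explicit, which is the
  origin of the difference in \<open>volterra\<close>.\<close>

lemma volterra_deriv:
  fixes g :: "real \<Rightarrow> real"
  assumes a: "0 < a" and g: "continuous_on UNIV g" and x: "0 < x"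
  shows "(volterra a w0 g has_real_derivative - (a * (a * weighted_mean a g x / x))) (at x)"
proof -
  have 1: "((\<lambda>x. integral {0..x} g) has_real_derivative g x) (at x)"
    by (rule indefinite_integral_deriv[OF continuous_on_subset[OF g] x]) auto
  show ?thesis
    unfolding volterra_def[abs_def]
    using 1 weighted_mean_deriv[OF a g x] by (auto intro!: derivative_eq_intros)
qed

lemma volterra_abs_le:
  fixes g G :: "real \<Rightarrow> real"
  assumes a: "0 < a" and g: "continuous_on UNIV g" and G: "continuous_on UNIV G"
    and le: "\<And>\<xi>. 0 \<le> \<xi> \<Longrightarrow> \<xi> \<le> x \<Longrightarrow> \<bar>g \<xi>\<bar> \<le> G \<xi>" and x: "0 \<le> x"
  shows "\<bar>integral {0..x} g - weighted_mean a g x\<bar> \<le> 2 * integral {0..x} G"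
proof -
  have "norm (integral {0..x} g) \<le> integral {0..x} G"
    by (intro integral_norm_bound_integral integrable_continuous_interval continuous_on_subset[OF G]
        continuous_on_subset[OF g]) (use le in auto)
  moreover have "\<bar>weighted_mean a g x\<bar> \<le> integral {0..x} G"
    by (rule weighted_mean_abs_le[OF a g G le x])
  ultimately show ?thesis by simp
qed

text \<open>The even extension yields a function on the whole line, as the space of bounded
  continuous functions requires. Away from \<open>0\<close> continuity follows from the derivative,
  at \<open>0\<close> from the linear bound.\<close>

lemma volterra_continuous:
  fixes g :: "real \<Rightarrow> real"
  assumes a: "0 < a" and g: "continuous_on UNIV g" and M: "\<And>x. \<bar>g x\<bar> \<le> M"
  shows "continuous_on UNIV (\<lambda>x. volterra a w0 g \<bar>x\<bar>)"
proof -
  have bound: "\<bar>volterra a w0 g \<bar>x\<bar> - w0\<bar> \<le> 2 * a * M * \<bar>x\<bar>" for x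
  proof -
    have "a * \<bar>integral {0..\<bar>x\<bar>} g - weighted_mean a g \<bar>x\<bar>\<bar> \<le> a * (2 * integral {0..\<bar>x\<bar>} (\<lambda>x. M))"
      using a by (intro mult_left_mono volterra_abs_le g M) auto
    then show ?thesis using a by (simp add: volterra_def abs_mult mult.commute mult.left_commute)
  qed
  show ?thesis
  proof (intro continuous_at_imp_continuous_on ballI)
    fix x :: real
    show "isCont (\<lambda>x. volterra a w0 g \<bar>x\<bar>) x"
    proof (cases "x = 0")
      case True
      have "((\<lambda>x. volterra a w0 g \<bar>x\<bar> - w0) \<longlongrightarrow> 0) (at 0)"
      proof (rule Lim_null_comparison)
        show "\<forall>\<^sub>F x in at 0. norm (volterra a w0 g \<bar>x\<bar> - w0) \<le> 2 * a * M * \<bar>x\<bar>"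
          using bound by simp
        show "((\<lambda>x. 2 * a * M * \<bar>x\<bar>) \<longlongrightarrow> 0) (at 0)"
          by (rule tendsto_eq_intros refl | simp)+
      qed
      then have "((\<lambda>x. volterra a w0 g \<bar>x\<bar>) \<longlongrightarrow> w0) (at 0)" by (rule LIM_zero_cancel)
      moreover have "volterra a w0 g \<bar>0\<bar> = w0" using bound[of 0] by simp
      ultimately show ?thesis using True by (simp add: isCont_def)
    next
      case False
      then have "isCont (volterra a w0 g) \<bar>x\<bar>"
        by (intro DERIV_isCont[OF volterra_deriv[OF a g]]) auto
      then show ?thesis by (rule isCont_o2[OF isCont_rabs[OF continuous_ident]])
    qed
  qed
qed

text \<open>A Banach fixed point in the weight \<open>exp (K x)\<close>, so that no continuation argument is needed.\<close>

lemma volterra_fixed_point: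
  fixes F :: "real \<Rightarrow> real"
  assumes a: "0 < a" and M: "\<And>x. \<bar>F x\<bar> \<le> M"
    and L: "\<And>x y. \<bar>F x - F y\<bar> \<le> L * \<bar>x - y\<bar>"
  shows "\<exists>v. continuous_on UNIV v \<and> (\<forall>x\<ge>0. v x = volterra a w0 (\<lambda>\<xi>. F (v \<xi>)) x)"
proof -
  have L0: "0 \<le> L" using L[of 1 0] by simp
  have M0: "0 \<le> M" using M[of 0] by linarith
  \<comment> \<open>This makes the contraction constant \<open>2 a L / K\<close> at most
    \<open>1 / 2\<close>; the summand \<open>1\<close> covers \<open>L = 0\<close>.\<close>
  define K where "K = 4 * a * L + 1"
  have "0 \<le> a * L" using a L0 by simp
  then have K0: "0 < K" by (simp add: K_def)
  then have K: "0 < K" "2 * a * L / K \<le> 1 / 2" by (simp_all add: field_simps) (simp add: K_def)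
  have Fc: "continuous_on UNIV F"
    using L by (rule lipschitz_abs_continuous)
  define FF where "FF = (\<lambda>(h :: real \<Rightarrow>\<^sub>C real) \<xi>. F (exp (K * \<xi>) * apply_bcontfun h \<xi>))"
  have hc: "continuous_on A (apply_bcontfun h)" for A and h :: "real \<Rightarrow>\<^sub>C real"
    by (rule continuous_on_apply_bcontfun)
  have FFc: "continuous_on UNIV (FF h)" for h
    unfolding FF_def by (intro continuous_on_compose2[OF Fc] continuous_intros hc) auto
  have FFM: "\<bar>FF h x\<bar> \<le> M" for h x by (simp add: FF_def M)
  \<comment> \<open>The unknown \<open>h\<close> stands for \<open>exp (- K x) v\<close>. It is
    bounded because \<open>F\<close> is bounded and \<open>v\<close> grows at most linearly.\<close>
  define N where "N = (\<lambda>h x. exp (- (K * \<bar>x\<bar>)) * volterra a w0 (FF h) \<bar>x\<bar>)"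
  have Nb: "N h \<in> bcontfun" for h
  proof (rule bcontfun_normI)
    show "continuous_on UNIV (N h)"
      unfolding N_def by (intro continuous_intros volterra_continuous[OF a FFc FFM])
    fix x
    have "a * \<bar>integral {0..\<bar>x\<bar>} (FF h) - weighted_mean a (FF h) \<bar>x\<bar>\<bar> \<le> a * (2 * integral {0..\<bar>x\<bar>} (\<lambda>x. M))"
      using a by (intro mult_left_mono volterra_abs_le FFc FFM) auto
    then have v: "\<bar>volterra a w0 (FF h) \<bar>x\<bar>\<bar> \<le> \<bar>w0\<bar> + 2 * a * M * \<bar>x\<bar>"
      using a abs_triangle_ineq4[of w0] by (auto simp: volterra_def abs_mult mult.commute mult.left_commute intro: order.trans[OF abs_triangle_ineq4])
    have "K * \<bar>x\<bar> \<le> exp (K * \<bar>x\<bar>)" using exp_ge_add_one_self[of "K * \<bar>x\<bar>"] by linarith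
    then have "exp (- (K * \<bar>x\<bar>)) * \<bar>x\<bar> \<le> 1 / K" using K by (simp add: exp_minus field_simps)
    then have 1: "2 * a * M * (exp (- (K * \<bar>x\<bar>)) * \<bar>x\<bar>) \<le> 2 * a * M * (1 / K)"
      using a M0 by (intro mult_left_mono) auto
    have "exp (- (K * \<bar>x\<bar>)) \<le> 1" using K by simp
    then have 2: "exp (- (K * \<bar>x\<bar>)) * \<bar>w0\<bar> \<le> 1 * \<bar>w0\<bar>" by (intro mult_right_mono) auto
    have "norm (N h x) \<le> exp (- (K * \<bar>x\<bar>)) * (\<bar>w0\<bar> + 2 * a * M * \<bar>x\<bar>)"
      unfolding N_def by (simp add: abs_mult v)
    also have "\<dots> \<le> \<bar>w0\<bar> + 2 * a * M * (1 / K)" using 1 2 by (simp add: algebra_simps)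
    finally show "norm (N h x) \<le> \<bar>w0\<bar> + 2 * a * M * (1 / K)" .
  qed
  have app: "apply_bcontfun (Bcontfun (N h)) = N h" for h
    using Nb by (rule Bcontfun_inverse)
  have contr: "dist (Bcontfun (N h)) (Bcontfun (N h')) \<le> 1 / 2 * dist h h'" for h h'
  proof (rule dist_bound)
    fix x :: real
    define X where "X = \<bar>x\<bar>"
    have X: "0 \<le> X" by (simp add: X_def)
    define D where "D = dist h h'"
    have diff: "\<bar>FF h \<xi> - FF h' \<xi>\<bar> \<le> L * D * exp (K * \<xi>)" for \<xi>
    proof -
      have "\<bar>FF h \<xi> - FF h' \<xi>\<bar> \<le> L * \<bar>exp (K * \<xi>) * apply_bcontfun h \<xi> - exp (K * \<xi>) * apply_bcontfun h' \<xi>\<bar>"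
        unfolding FF_def by (rule L)
      also have "\<dots> = L * (exp (K * \<xi>) * dist (apply_bcontfun h \<xi>) (apply_bcontfun h' \<xi>))"
        by (simp add: dist_real_def abs_mult flip: right_diff_distrib)
      also have "\<dots> \<le> L * (exp (K * \<xi>) * D)"
        unfolding D_def using L0 by (intro mult_left_mono dist_bounded) auto
      finally show ?thesis by (simp add: mult_ac)
    qed
    have ex: "((\<lambda>\<xi>. L * D * exp (K * \<xi>)) has_integral L * D / K * exp (K * X) - L * D / K * exp (K * 0)) {0..X}"
      by (rule fundamental_theorem_of_calculus[OF X])
        (use K in \<open>auto intro!: derivative_eq_intros simp flip: has_real_derivative_iff_has_vector_derivative\<close>)
    have "volterra a w0 (FF h) X - volterra a w0 (FF h') X
        = - (a * (integral {0..X} (\<lambda>\<xi>. FF h \<xi> - FF h' \<xi>) - weighted_mean a (\<lambda>\<xi>. FF h \<xi> - FF h' \<xi>) X))"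
    proof -
      have "integral {0..X} (\<lambda>\<xi>. FF h \<xi> - FF h' \<xi>) = integral {0..X} (FF h) - integral {0..X} (FF h')"
        by (intro integral_diff integrable_continuous_interval continuous_on_subset[OF FFc]) auto
      then show ?thesis
        unfolding volterra_def weighted_mean_diff[OF a FFc FFc, symmetric]
        by (simp only: right_diff_distrib)
    qed
    then have "\<bar>volterra a w0 (FF h) X - volterra a w0 (FF h') X\<bar>
        = a * \<bar>integral {0..X} (\<lambda>\<xi>. FF h \<xi> - FF h' \<xi>) - weighted_mean a (\<lambda>\<xi>. FF h \<xi> - FF h' \<xi>) X\<bar>"
      using a by (simp add: abs_mult)
    also have "\<dots> \<le> a * (2 * integral {0..X} (\<lambda>\<xi>. L * D * exp (K * \<xi>)))"
      using a by (intro mult_left_mono volterra_abs_le[OF a _ _ diff X] continuous_intros FFc) auto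
    also have "\<dots> \<le> a * (2 * (L * D / K * exp (K * X)))"
    proof -
      have "0 \<le> L * D / K" using L0 K by (simp add: D_def)
      then show ?thesis using a unfolding integral_unique[OF ex] by (intro mult_left_mono) auto
    qed
    also have "\<dots> = 2 * a * L / K * (D * exp (K * X))" by simp
    also have "\<dots> \<le> 1 / 2 * (D * exp (K * X))"
      by (rule mult_right_mono[OF K(2)]) (simp add: D_def)
    finally have "exp (- (K * X)) * \<bar>volterra a w0 (FF h) X - volterra a w0 (FF h') X\<bar>
        \<le> exp (- (K * X)) * (1 / 2 * (D * exp (K * X)))" by (intro mult_left_mono) auto
    also have "\<dots> = 1 / 2 * D" by (simp add: exp_minus)
    finally show "dist (apply_bcontfun (Bcontfun (N h)) x) (apply_bcontfun (Bcontfun (N h')) x) \<le> 1 / 2 * dist h h'"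
      unfolding app by (simp add: N_def dist_real_def D_def X_def abs_mult flip: right_diff_distrib)
  qed
  have "\<exists>!h. Bcontfun (N h) = h"
    by (rule banach_fix_type[of "1/2"]) (use contr in auto)
  then obtain h where h: "Bcontfun (N h) = h" by blast
  then have h': "apply_bcontfun h = N h" using app[of h] by simp
  define v where "v = (\<lambda>\<xi>. exp (K * \<xi>) * apply_bcontfun h \<xi>)"
  have "continuous_on UNIV v" unfolding v_def by (intro continuous_intros hc)
  moreover have "v x = volterra a w0 (\<lambda>\<xi>. F (v \<xi>)) x" if "0 \<le> x" for x
  proof -
    have "v x = exp (K * x) * N h x" by (simp add: v_def h')
    also have "\<dots> = volterra a w0 (FF h) x" using that by (simp add: N_def exp_minus)
    also have "FF h = (\<lambda>\<xi>. F (v \<xi>))" by (simp add: FF_def v_def)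
    finally show ?thesis .
  qed
  ultimately show ?thesis by blast
qed

text \<open>The equation for \<open>w = exp (m \<xi>)\<close>, or \<open>w = \<xi>\<close> if
  \<open>m = 0\<close>, is free of the quadratic term. For bounded Lipschitz \<open>F\<close> the
  fixed point then solves it on the whole line.\<close>

theorem regular_solution_exists:
  fixes F :: "real \<Rightarrow> real"
  assumes k: "0 < k" and M: "\<And>x. \<bar>F x\<bar> \<le> M"
    and L: "\<And>x y. \<bar>F x - F y\<bar> \<le> L * \<bar>x - y\<bar>"
  shows "\<exists>w z. (\<forall>s. (w has_real_derivative z s) (at s) \<and>
      (z has_real_derivative z s - exp (- k * s) * F (w s)) (at s)) \<and>
    (w \<longlongrightarrow> w0) at_top \<and> (z \<longlongrightarrow> 0) at_top"
proof -
  define a where "a = 1 / k"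
  have a: "0 < a" "k * a = 1" using k by (auto simp: a_def)
  obtain v where v: "continuous_on UNIV v" "\<And>x. 0 \<le> x \<Longrightarrow> v x = volterra a w0 (\<lambda>\<xi>. F (v \<xi>)) x"
    using volterra_fixed_point[OF a(1) M L] by blast
  define g where "g = (\<lambda>\<xi>. F (v \<xi>))"
  have L0: "0 \<le> L" using L[of 1 0] by simp
  have Fc: "continuous_on UNIV F"
    using L by (rule lipschitz_abs_continuous)
  have gc: "continuous_on UNIV g"
    unfolding g_def by (intro continuous_on_compose2[OF Fc v(1)]) auto
  have gM: "\<bar>g x\<bar> \<le> M" for x by (simp add: g_def M)
  define x where "x = (\<lambda>s. exp (- k * s))"
  have x: "0 < x s" for s by (simp add: x_def)
  have dx: "(x has_real_derivative - k * x s) (at s)" for s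
    unfolding x_def by (auto intro!: derivative_eq_intros)
  have xlim: "(x \<longlongrightarrow> 0) at_top"
  proof -
    have "filterlim (\<lambda>s. k * s) at_top at_top"
      using k by (intro filterlim_tendsto_pos_mult_at_top[OF tendsto_const _ filterlim_ident])
    then show ?thesis unfolding x_def
      by (intro filterlim_compose[OF exp_at_bot]) (simp add: filterlim_uminus_at_top)
  qed
  define w where "w = (\<lambda>s. volterra a w0 g (x s))"
  define z where "z = (\<lambda>s. a * weighted_mean a g (x s))"
  have wF: "g (x s) = F (w s)" for s
    using v(2)[of "x s"] x[of s] by (simp add: g_def w_def)
  have "(w has_real_derivative - (a * (a * weighted_mean a g (x s) / x s)) * (- k * x s)) (at s)" for s
    unfolding w_def by (rule DERIV_chain2[OF volterra_deriv[OF a(1) gc x] dx])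
  moreover have "- (a * (a * weighted_mean a g (x s) / x s)) * (- k * x s) = (k * a) * z s" for s
    using x[of s] by (simp add: z_def)
  ultimately have dw: "(w has_real_derivative z s) (at s)" for s using a by simp
  have "(z has_real_derivative a * ((g (x s) - a * weighted_mean a g (x s) / x s) * (- k * x s))) (at s)" for s
    unfolding z_def by (intro DERIV_cmult DERIV_chain2[OF weighted_mean_deriv[OF a(1) gc x] dx])
  moreover have "a * ((g (x s) - a * weighted_mean a g (x s) / x s) * (- k * x s))
      = (k * a) * (z s - x s * g (x s))" for s
    using x[of s] by (simp add: z_def field_simps)
  ultimately have dz: "(z has_real_derivative z s - exp (- k * s) * F (w s)) (at s)" for s
    using a wF by (simp add: x_def)
  have wb: "\<bar>w s - w0\<bar> \<le> 2 * a * M * x s" for s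
  proof -
    have "a * \<bar>integral {0..x s} g - weighted_mean a g (x s)\<bar> \<le> a * (2 * integral {0..x s} (\<lambda>x. M))"
      using a x[of s] by (intro mult_left_mono volterra_abs_le gc gM) auto
    then show ?thesis using a x[of s] by (simp add: w_def volterra_def abs_mult mult.commute mult.left_commute)
  qed
  have zb: "\<bar>z s\<bar> \<le> a * M * x s" for s
  proof -
    have "a * \<bar>weighted_mean a g (x s)\<bar> \<le> a * integral {0..x s} (\<lambda>x. M)"
      using a x[of s] by (intro mult_left_mono weighted_mean_abs_le gc gM) auto
    then show ?thesis using a x[of s] by (simp add: z_def abs_mult mult.commute mult.left_commute)
  qed
  have "((\<lambda>s. w s - w0) \<longlongrightarrow> 0) at_top"
    by (rule Lim_null_comparison[OF _ tendsto_mult_right_zero[OF xlim, of "2 * a * M"]]) (use wb in auto)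
  then have wl: "(w \<longlongrightarrow> w0) at_top" by (rule LIM_zero_cancel)
  have zl: "(z \<longlongrightarrow> 0) at_top"
    by (rule Lim_null_comparison[OF _ tendsto_mult_right_zero[OF xlim, of "a * M"]]) (use zb in auto)
  show ?thesis using dw dz wl zl by blast
qed

lemma powr_lipschitz_unit:
  fixes p x y :: real
  assumes p: "1 \<le> p" and x: "0 \<le> x" "x \<le> 1" and y: "0 \<le> y" "y \<le> 1"
  shows "\<bar>x powr p - y powr p\<bar> \<le> p * \<bar>x - y\<bar>"
proof -
  have *: "\<bar>x powr p - y powr p\<bar> \<le> p * \<bar>x - y\<bar>" if xy: "0 \<le> x" "x < y" "y \<le> 1" for x y :: real
  proof -
    have cont: "continuous_on {x..y} (\<lambda>t. t powr p)"
      using xy p by (intro continuous_on_powr' continuous_intros) auto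
    have der: "((\<lambda>t. t powr p) has_real_derivative p * t powr (p - 1)) (at t)" if "x < t" for t
      using that xy by (intro has_real_derivative_powr) auto
    have diff: "(\<lambda>t. t powr p) differentiable (at t)" if "x < t" "t < y" for t
      using der that by (auto simp: real_differentiable_def)
    obtain l z where z: "x < z" "z < y" "((\<lambda>t. t powr p) has_real_derivative l) (at z)"
      "y powr p - x powr p = (y - x) * l"
      using MVT[OF xy(2) cont diff] by blast
    have "l = p * z powr (p - 1)" by (rule DERIV_unique[OF z(3) der[OF z(1)]])
    moreover have "z powr (p - 1) \<le> 1" using z xy p by (intro powr_le1) auto
    ultimately have "0 \<le> l" "l \<le> p" using p by (auto simp: mult_left_le)
    then have "0 \<le> (y - x) * l" "(y - x) * l \<le> (y - x) * p" using xy by (auto intro: mult_left_mono)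
    then show ?thesis using z(4) xy by (simp add: mult.commute)
  qed
  consider "x < y" | "x = y" | "y < x" by linarith
  then show ?thesis
    using *[of x y] *[of y x] x y by cases (auto simp: abs_minus_commute)
qed

text \<open>\<open>z exp (- s)\<close> is nonincreasing and tends to \<open>0\<close>.\<close>

lemma regular_velocity_sign:
  fixes z h :: "real \<Rightarrow> real"
  assumes der: "\<And>s. (z has_real_derivative z s - h s) (at s)" and lim: "(z \<longlongrightarrow> 0) at_top"
    and h: "\<And>s. 0 \<le> h s"
  shows "0 \<le> z s" and "(\<And>s. 0 < h s) \<Longrightarrow> 0 < z s"
proof -
  define Z where "Z = (\<lambda>s. - (z s * exp (- s)))"
  have dZ: "(Z has_real_derivative h s * exp (- s)) (at s)" for s
    unfolding Z_def using der by (auto intro!: derivative_eq_intros simp: algebra_simps)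
  have Zlim: "(Z \<longlongrightarrow> - (0 * 0)) at_top"
    unfolding Z_def
    by (intro tendsto_intros lim filterlim_compose[OF exp_at_bot]) (simp add: filterlim_uminus_at_top[symmetric] filterlim_ident)
  have mono: "Z s \<le> Z t" if "s \<le> t" for s t
    by (rule mono_from[of "s - 1" Z, OF dZ _ _ that]) (use h in auto)
  have Zneg: "Z s \<le> 0" for s
    by (rule tendsto_lowerbound[OF Zlim[simplified]]) (auto simp: eventually_at_top_linorder intro!: exI[of _ s] mono)
  then show "0 \<le> z s" using Zneg[of s] by (simp add: Z_def zero_le_mult_iff)
  assume pos: "\<And>s. 0 < h s"
  have "Z s < Z (s + 1)"
    by (rule DERIV_pos_imp_increasing[of s "s+1" Z]) (use dZ pos in \<open>auto intro!: exI mult_pos_pos\<close>)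
  then have "Z s < 0" using Zneg[of "s+1"] by linarith
  then show "0 < z s" by (simp add: Z_def zero_less_mult_iff)
qed

text \<open>The limit \<open>0\<close> is a normalisation, since translation in \<open>s\<close>
  produces every other limit. The truncations of the nonlinearity are inactive: \<open>w\<close>
  increases to its limit, which bounds it above, and for \<open>m > 0\<close> it also stays
  positive.\<close>

theorem regular_orbit_exists:
  assumes m: "0 \<le> m" and k: "0 < k" and mk: "2 * m * k < 1"
  shows "\<exists>y Q. (\<forall>a. orbit k m a y Q) \<and> (\<forall>s. 0 < Q s) \<and>
    ((\<lambda>s. y s + k * s) \<longlongrightarrow> 0) at_top \<and> (Q \<longlongrightarrow> 0) at_top"
proof (cases "m = 0")
  case True
  define F :: "real \<Rightarrow> real" where "F = (\<lambda>u. exp (min u 0))"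
  have FM: "\<bar>F x\<bar> \<le> 1" for x by (simp add: F_def)
  have FL: "\<bar>F x - F y\<bar> \<le> 1 * \<bar>x - y\<bar>" for x y
  proof -
    obtain g where g: "F x - F y = g * (min x 0 - min y 0)" "0 \<le> g" "g \<le> exp 0"
      unfolding F_def using exp_difference_quotient[of "min x 0" 0 "min y 0"] by auto
    have "\<bar>g * (min x 0 - min y 0)\<bar> \<le> 1 * \<bar>min x 0 - min y 0\<bar>"
      unfolding abs_mult using g by (intro mult_right_mono) auto
    also have "\<dots> \<le> 1 * \<bar>x - y\<bar>" by auto
    finally show ?thesis using g by simp
  qed
  obtain w z where wz: "\<And>s. (w has_real_derivative z s) (at s)"
    "\<And>s. (z has_real_derivative z s - exp (- k * s) * F (w s)) (at s)"
    "(w \<longlongrightarrow> 0) at_top" "(z \<longlongrightarrow> 0) at_top"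
    using regular_solution_exists[OF k FM FL] by blast
  have z: "0 < z s" for s
    by (rule regular_velocity_sign(2)[OF wz(2,4)]) (auto simp: F_def)
  have "w s \<le> w t" if "s \<le> t" for s t
    by (rule mono_from[of "s - 1" w, OF wz(1) _ _ that]) (use z in \<open>auto intro: less_imp_le\<close>)
  then have w: "w s \<le> 0" for s
    by (intro tendsto_lowerbound[OF wz(3)]) (auto simp: eventually_at_top_linorder)
  define y where "y = (\<lambda>s. w s - k * s)"
  have "orbit k m a y z" for a
    unfolding orbit_def
  proof (intro allI impI conjI)
    fix s
    show "(y has_real_derivative z s - k) (at s)"
      unfolding y_def using wz(1) by (auto intro!: derivative_eq_intros)
    have "exp (y s) = exp (- k * s) * F (w s)"
      using w[of s] by (simp add: y_def F_def min_absorb1 algebra_simps flip: exp_add)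
    then show "(z has_real_derivative z s - m * (z s)\<^sup>2 - exp (y s)) (at s)"
      using wz(2)[of s] True by simp
  qed
  then show ?thesis using z wz by (intro exI[of _ y] exI[of _ z]) (auto simp: y_def)
next
  case False
  then have m: "0 < m" using m by simp
  define p where "p = 1 + 1 / m"
  have p: "1 \<le> p" using m by (simp add: p_def)
  \<comment> \<open>The power is clamped to \<open>[0,1]\<close>, where it is Lipschitz; the upper
    end is the prescribed limit of \<open>w\<close>.\<close>
  define c :: "real \<Rightarrow> real" where "c = (\<lambda>u. max 0 (min u 1))"
  define F :: "real \<Rightarrow> real" where "F = (\<lambda>u. m * c u powr p)"
  have c: "0 \<le> c u" "c u \<le> 1" "\<bar>c u - c v\<bar> \<le> \<bar>u - v\<bar>" for u v by (auto simp: c_def)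
  have FM: "\<bar>F x\<bar> \<le> m" for x
    using powr_le1[of p "c x"] p c m by (simp add: F_def abs_mult)
  have FL: "\<bar>F x - F y\<bar> \<le> (m * p) * \<bar>x - y\<bar>" for x y
  proof -
    have "m * \<bar>c x powr p - c y powr p\<bar> \<le> m * (p * \<bar>c x - c y\<bar>)"
      using m by (intro mult_left_mono powr_lipschitz_unit p c) auto
    also have "\<dots> \<le> m * (p * \<bar>x - y\<bar>)" using m p c by (intro mult_left_mono) auto
    finally show ?thesis using m by (simp add: F_def abs_mult mult.assoc flip: right_diff_distrib)
  qed
  obtain w z where wz: "\<And>s. (w has_real_derivative z s) (at s)"
    "\<And>s. (z has_real_derivative z s - exp (- k * s) * F (w s)) (at s)"
    "(w \<longlongrightarrow> 1) at_top" "(z \<longlongrightarrow> 0) at_top"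
    using regular_solution_exists[OF k FM FL] by blast
  have z: "0 \<le> z s" for s
    by (rule regular_velocity_sign(1)[OF wz(2,4)]) (use m in \<open>auto simp: F_def\<close>)
  have wmono: "w s \<le> w t" if "s \<le> t" for s t
    by (rule mono_from[of "s - 1" w, OF wz(1) _ _ that]) (use z in auto)
  then have w1: "w s \<le> 1" for s
    by (intro tendsto_lowerbound[OF wz(3)]) (auto simp: eventually_at_top_linorder)
  define y where "y = (\<lambda>s. ln (w s) / m - k * s)"
  define Q where "Q = (\<lambda>s. z s / (m * w s))"
  have D: "(y has_real_derivative Q s - k) (at s)"
    "(Q has_real_derivative Q s - m * (Q s)\<^sup>2 - exp (y s)) (at s)" if w: "0 < w s" for s
  proof -
    show "(y has_real_derivative Q s - k) (at s)"
      unfolding y_def Q_def using wz(1)[of s] w m by (auto intro!: derivative_eq_intros simp: field_simps)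
    have "exp (y s) = w s powr (1 / m) * exp (- k * s)"
      using w by (simp add: y_def powr_def exp_diff exp_minus field_simps)
    moreover have "F (w s) = m * (w s * w s powr (1 / m))"
      using w w1[of s] by (simp add: F_def c_def p_def powr_add)
    ultimately have F: "exp (- k * s) * F (w s) = m * w s * exp (y s)" by simp
    have "(Q has_real_derivative ((z s - m * w s * exp (y s)) * (m * w s) - z s * (m * z s)) / (m * w s * (m * w s))) (at s)"
      unfolding Q_def using wz(1)[of s] wz(2)[of s, unfolded F] w m
      by (intro DERIV_divide DERIV_cmult) auto
    moreover have "((z s - m * w s * exp (y s)) * (m * w s) - z s * (m * z s)) / (m * w s * (m * w s))
        = Q s - m * (Q s)\<^sup>2 - exp (y s)"
      using w m by (simp add: Q_def field_simps power2_eq_square)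
    ultimately show "(Q has_real_derivative Q s - m * (Q s)\<^sup>2 - exp (y s)) (at s)" by simp
  qed
  have Qlim: "(Q \<longlongrightarrow> 0) at_top"
    using tendsto_divide[OF wz(4) tendsto_mult[OF tendsto_const wz(3)], of m] m by (simp add: Q_def)
  have "((\<lambda>s. ln (w s) / m) \<longlongrightarrow> ln 1 / m) at_top"
    using m by (intro tendsto_intros wz) auto
  then have llim: "((\<lambda>s. y s + k * s) \<longlongrightarrow> 0) at_top" by (simp add: y_def)
  have ktop: "filterlim (\<lambda>s. k * s) at_top at_top"
    using k by (intro filterlim_tendsto_pos_mult_at_top[OF tendsto_const _ filterlim_ident])
  then have "filterlim (\<lambda>s. - (k * s)) at_bot at_top" by (simp add: filterlim_uminus_at_top)
  then have "filterlim (\<lambda>s. (y s + k * s) + - (k * s)) at_bot at_top"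
    by (simp only: filterlim_tendsto_add_at_bot_iff[OF llim])
  then have ybot: "filterlim y at_bot at_top" by simp
  \<comment> \<open>To the right of the last point with \<open>w \<le> 0\<close> there is an orbit,
    and its energy bounds \<open>Q = w' / (m w)\<close>. Hence \<open>ln w\<close> cannot fall to
    minus infinity in finite time. Through the energy bound, \<open>2 m k < 1\<close> excludes a
    zero.\<close>
  have wpos: "0 < w s" for s
  proof (rule ccontr)
    assume neg: "\<not> 0 < w s"
    define A where "A = {s. w s \<le> 0}"
    have wc: "continuous_on S w" for S
      by (intro continuous_at_imp_continuous_on ballI DERIV_isCont[OF wz(1)])
    have "closed A" unfolding A_def by (intro closed_Collect_le wc continuous_on_const)
    have "\<forall>\<^sub>F s in at_top. 0 < w s" using wz(3) by (rule order_tendstoD) simp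
    then obtain S where S: "\<And>s. S \<le> s \<Longrightarrow> 0 < w s" by (auto simp: eventually_at_top_linorder)
    have "bdd_above A" unfolding A_def bdd_above_def using S by (meson linear mem_Collect_eq not_less)
    moreover have "s \<in> A" using neg by (simp add: A_def)
    ultimately have "Sup A \<in> A" using \<open>closed A\<close> closed_contains_Sup by blast
    define s1 where "s1 = Sup A"
    have s1: "w s1 \<le> 0" using \<open>Sup A \<in> A\<close> by (simp add: A_def s1_def)
    have above: "0 < w t" if "s1 < t" for t
      using cSup_upper[OF _ \<open>bdd_above A\<close>, of t] that by (force simp: A_def s1_def)
    have o: "orbit k m s1 y Q" unfolding orbit_def using D above by blast
    obtain B s2 where B: "s1 + 1 \<le> s2" "\<And>t. s1 < t \<Longrightarrow> t \<le> s2 \<Longrightarrow> \<bar>Q t - k\<bar> \<le> B"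
      using regular_orbit_bounds[OF _ k mk ybot Qlim, of "s1 + 1"] o m by (metis less_imp_le)
    define K where "K = m * (B + k)"
    have "w s2 * exp (- K * s2) \<le> w s1 * exp (- K * s1)"
    proof (rule DERIV_nonpos_imp_decreasing_open[of s1 s2 "\<lambda>s. w s * exp (- K * s)"])
      fix t assume t: "s1 < t" "t < s2"
      have "Q t \<le> B + k" using B(2)[of t] t by linarith
      then have "m * w t * Q t \<le> m * w t * (B + k)"
        using above[OF t(1)] m by (intro mult_left_mono) auto
      moreover have "z t = m * w t * Q t" using above[OF t(1)] m by (simp add: Q_def)
      ultimately have "(z t - K * w t) * exp (- K * t) \<le> 0"
        by (intro mult_nonpos_nonneg) (auto simp: K_def algebra_simps)
      moreover have "((\<lambda>s. w s * exp (- K * s)) has_real_derivative (z t - K * w t) * exp (- K * t)) (at t)"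
        using wz(1)[of t] by (auto intro!: derivative_eq_intros simp: algebra_simps)
      ultimately show "\<exists>l. ((\<lambda>s. w s * exp (- K * s)) has_real_derivative l) (at t) \<and> l \<le> 0" by blast
    qed (use B(1) in \<open>auto intro!: continuous_intros wc\<close>)
    moreover have "0 < w s2 * exp (- K * s2)" using above[of s2] B(1) by simp
    ultimately have "0 < w s1 * exp (- K * s1)" by linarith
    then have "0 < w s1" by (simp add: zero_less_mult_iff)
    then show False using s1 by simp
  qed
  have o: "orbit k m a y Q" for a unfolding orbit_def using D wpos by blast
  have "0 < Q s" for s
  proof (rule orbit_Q_pos[OF o])
    fix t assume t: "s - 1 < t"
    have "ln (w (s - 1)) / m \<le> ln (w t) / m"
      using wmono[of "s - 1" t] t wpos m by (intro divide_right_mono) (auto simp: ln_le_cancel_iff)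
    then show "ln (w (s - 1)) / m \<le> y t + k * t" by (simp add: y_def)
  qed (use m in auto)
  then show ?thesis using o llim Qlim by blast
qed

lemma has_derivative_norm_axis:
  fixes x :: "real^2"
  assumes "x \<noteq> 0"
  shows "(norm has_derivative (\<lambda>h. (x \<bullet> h) / norm x)) (at x)"
proof -
  have "(norm has_derivative (\<lambda>h. h \<bullet> sgn x)) (at x)"
    using has_derivative_norm[OF assms] by (simp add: inner_commute)
  moreover have "(\<lambda>h. h \<bullet> sgn x) = (\<lambda>h. (x \<bullet> h) / norm x)"
    by (auto simp: sgn_div_norm inner_commute divide_inverse_commute)
  ultimately show ?thesis by simp
qed

section \<open>Radial profiles\<close>

lemma partial_deriv_eqI:
  assumes "(u has_derivative u') (at x)"
  shows "partial_deriv i u x = u' (axis i 1)"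
  using frechet_derivative_at[OF assms] by (simp add: partial_deriv_def)

lemma has_derivative_radial:
  fixes x :: "real^2"
  assumes "(u has_real_derivative d) (at (norm x))" "x \<noteq> 0"
  shows "(radial u has_derivative (\<lambda>h. d * ((x \<bullet> h) / norm x))) (at x)"
proof -
  have "(u has_derivative (\<lambda>h. d * h)) (at (norm x))"
    using assms(1) by (simp add: has_field_derivative_def)
  from has_derivative_compose[OF has_derivative_norm_axis[OF assms(2)] this]
  show ?thesis by (simp add: radial_def[abs_def])
qed

lemma partial_deriv_radial:
  fixes x :: "real^2"
  assumes "(u has_real_derivative d) (at (norm x))" "x \<noteq> 0"
  shows "partial_deriv i (radial u) x = d * (x $ i / norm x)"
  using partial_deriv_eqI[OF has_derivative_radial[OF assms], of i] by (simp add: inner_axis)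

lemma laplacian_radial:
  fixes x :: "real^2"
  assumes u: "\<And>r. a < r \<Longrightarrow> r < b \<Longrightarrow> (u has_real_derivative d1 r) (at r)"
    and d: "(d1 has_real_derivative d2) (at (norm x))"
    and x: "a < norm x" "norm x < b" and a: "0 \<le> a"
  shows "laplacian (radial u) x = d2 + d1 (norm x) / norm x"
proof -
  have x0: "x \<noteq> 0" using x a by auto
  have pp: "partial_deriv i (partial_deriv i (radial u)) x
      = d2 * (x $ i)\<^sup>2 / (norm x)\<^sup>2 + d1 (norm x) * (1 / norm x - (x $ i)\<^sup>2 / norm x ^ 3)" for i
  proof -
    define P where "P = (\<lambda>y::real^2. d1 (norm y) * (y $ i / norm y))"
    define P' where "P' = (\<lambda>h. d1 (norm x) * ((h $ i * norm x - x $ i * ((x \<bullet> h) / norm x)) / (norm x * norm x))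
        + d2 * ((x \<bullet> h) / norm x) * (x $ i / norm x))"
    have n: "(norm has_derivative (\<lambda>h. (x \<bullet> h) / norm x)) (at x)"
      by (rule has_derivative_norm_axis[OF x0])
    have "((\<lambda>y::real^2. y $ i) has_derivative (\<lambda>h. h $ i)) (at x)"
      by (intro bounded_linear.has_derivative[OF bounded_linear_vec_nth] has_derivative_ident)
    from has_derivative_divide'[OF this n]
    have q: "((\<lambda>y::real^2. y $ i / norm y) has_derivative
        (\<lambda>h. (h $ i * norm x - x $ i * ((x \<bullet> h) / norm x)) / (norm x * norm x))) (at x)"
      using x0 by simp
    have dd: "((\<lambda>y::real^2. d1 (norm y)) has_derivative (\<lambda>h. d2 * ((x \<bullet> h) / norm x))) (at x)"
      using has_derivative_radial[OF d x0] by (simp add: radial_def[abs_def])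
    have P: "(P has_derivative P') (at x)"
      unfolding P_def P'_def by (rule has_derivative_mult[OF dd q])
    define T where "T = {y::real^2. a < norm y \<and> norm y < b}"
    have "open T" unfolding T_def
      by (intro open_Collect_conj open_Collect_less continuous_intros)
    have "(partial_deriv i (radial u) has_derivative P') (at x)"
    proof (rule has_derivative_transform_within_open[OF P \<open>open T\<close>])
      show "x \<in> T" using x by (simp add: T_def)
      fix y assume "y \<in> T"
      then show "P y = partial_deriv i (radial u) y"
        using a by (subst partial_deriv_radial[OF u]) (auto simp: T_def P_def)
    qed
    then have "partial_deriv i (partial_deriv i (radial u)) x = P' (axis i 1)"
      by (rule partial_deriv_eqI)
    then show ?thesis
      using x0 by (simp add: P'_def inner_axis power2_eq_square power3_eq_cube field_simps)
  qed
  have n2: "(norm x)\<^sup>2 = (x $ 1)\<^sup>2 + (x $ 2)\<^sup>2"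
    unfolding power2_norm_eq_inner inner_vec_def sum_2 by (simp add: power2_eq_square)
  define r where "r = norm x"
  have r: "r \<noteq> 0" using x0 by (simp add: r_def)
  have "laplacian (radial u) x = d2 * ((x $ 1)\<^sup>2 + (x $ 2)\<^sup>2) / r\<^sup>2
      + d1 r * (2 / r - ((x $ 1)\<^sup>2 + (x $ 2)\<^sup>2) / r ^ 3)"
    unfolding laplacian_def sum_2 pp r_def by (simp add: algebra_simps add_divide_distrib)
  also have "\<dots> = d2 + d1 r / r"
    unfolding n2[symmetric] r_def[symmetric] using r by (simp add: power2_eq_square power3_eq_cube field_simps)
  finally show ?thesis by (simp add: r_def)
qed

lemma at_within_unit_not_bot:
  fixes r :: real
  assumes "0 < r" "r \<le> 1"
  shows "at r within {0<..1} \<noteq> bot"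
proof -
  have "r islimpt {0<..<r}" by (rule islimpt_greaterThanLessThan2[OF assms(1)])
  then have "r islimpt {0<..1}" by (rule islimpt_subset) (use assms in auto)
  then show ?thesis by (simp add: trivial_limit_within)
qed

text \<open>Profiles are prescribed only up to \<open>r = 1\<close>. Agreement with a function
  differentiable across \<open>r = 1\<close> yields the one-sided derivative there.\<close>

lemma rderiv_eqI:
  assumes "(v has_real_derivative d) (at r)" "\<And>s. 0 < s \<Longrightarrow> s \<le> 1 \<Longrightarrow> u s = v s" "0 < r" "r \<le> 1"
  shows "(u has_real_derivative d) (at r within {0<..1})" and "rderiv u r = d"
proof -
  show 1: "(u has_real_derivative d) (at r within {0<..1})"
    by (rule has_field_derivative_transform_within[OF has_field_derivative_at_within[OF assms(1)], of 1])
      (use assms in auto)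
  show "rderiv u r = d"
    unfolding rderiv_def
    by (rule vector_derivative_within[OF at_within_unit_not_bot])
      (use assms 1 in \<open>auto simp: has_real_derivative_iff_has_vector_derivative\<close>)
qed

lemma C2_profileI:
  assumes v: "\<And>r. 0 < r \<Longrightarrow> r \<le> 1 \<Longrightarrow> (v has_real_derivative d1 r) (at r)"
    and d: "\<And>r. 0 < r \<Longrightarrow> r \<le> 1 \<Longrightarrow> (d1 has_real_derivative d2 r) (at r)"
    and c: "continuous_on {0<..1} d2"
    and u: "\<And>r. 0 < r \<Longrightarrow> r \<le> 1 \<Longrightarrow> u r = v r"
  shows "C2_profile u" and "\<And>r. 0 < r \<Longrightarrow> r \<le> 1 \<Longrightarrow> rderiv u r = d1 r"
    and "\<And>r. 0 < r \<Longrightarrow> r \<le> 1 \<Longrightarrow> rderiv (rderiv u) r = d2 r"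
proof -
  show 1: "rderiv u r = d1 r" if "0 < r" "r \<le> 1" for r
    by (rule rderiv_eqI(2)[OF v u]) (use that in auto)
  show 2: "rderiv (rderiv u) r = d2 r" if "0 < r" "r \<le> 1" for r
    by (rule rderiv_eqI(2)[OF d 1]) (use that in auto)
  have "(u has_real_derivative d1 r) (at r within {0<..1})" if "0 < r" "r \<le> 1" for r
    by (rule rderiv_eqI(1)[OF v u]) (use that in auto)
  then have "u differentiable_on {0<..1}"
    unfolding differentiable_on_def real_differentiable_def by (meson greaterThanAtMost_iff)
  moreover have "(rderiv u has_real_derivative d2 r) (at r within {0<..1})" if "0 < r" "r \<le> 1" for r
    by (rule rderiv_eqI(1)[OF d 1]) (use that in auto)
  then have "rderiv u differentiable_on {0<..1}"
    unfolding differentiable_on_def real_differentiable_def by (meson greaterThanAtMost_iff)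
  moreover have "continuous_on {0<..1} (rderiv (rderiv u))"
    using c by (rule continuous_on_eq) (use 2 in auto)
  ultimately show "C2_profile u" by (simp add: C2_profile_def)
qed

lemma differentiable_on_rderiv:
  assumes "u differentiable_on {0<..1}" "0 < r" "r < 1"
  shows "(u has_real_derivative rderiv u r) (at r)"
proof -
  have "at r within {0<..1} = at r"
    using assms by (intro at_within_interior) auto
  then show ?thesis
    using assms unfolding differentiable_on_def rderiv_def
    by (metis greaterThanAtMost_iff has_real_derivative_iff_has_vector_derivative less_eq_real_def
        vector_derivative_works)
qed

lemma C2_profile_derivs:
  assumes "C2_profile u" "0 < r" "r < 1"
  shows "(u has_real_derivative rderiv u r) (at r)"
    and "(rderiv u has_real_derivative rderiv (rderiv u) r) (at r)"
  using assms differentiable_on_rderiv by (auto simp: C2_profile_def)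

lemma radial_equation:
  assumes u: "C2_profile u"
    and pde: "\<forall>x\<in>B1 - {0}. - laplacian (radial u) x = lam * Vk k (norm x) * f (radial u x)"
    and r: "0 < r" "r < 1"
  shows "- (rderiv (rderiv u) r + rderiv u r / r) = lam * Vk k r * f (u r)"
proof -
  define x :: "real^2" where "x = r *\<^sub>R axis 1 1"
  have n: "norm x = r" using r by (simp add: x_def norm_axis_1)
  then have "x \<in> B1 - {0}" using r by auto
  then have "- laplacian (radial u) x = lam * Vk k r * f (u r)"
    using pde n by (auto simp: radial_def)
  moreover have "laplacian (radial u) x = rderiv (rderiv u) r + rderiv u (norm x) / norm x"
    by (rule laplacian_radial[of 0 1]) (use C2_profile_derivs[OF u] r n in auto)
  ultimately show ?thesis using n by simp
qed

section \<open>The change of variable between the radius and \<open>s\<close>\<close>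

definition log_depth :: "real \<Rightarrow> real" where
  "log_depth r = ln (1 - ln r)"

definition depth_radius :: "real \<Rightarrow> real" where
  "depth_radius s = exp (1 - exp s)"

lemma neg_ln_div_exp: "0 < r \<Longrightarrow> - ln (r / exp 1) = 1 - ln r" for r :: real
  by (simp add: ln_div)

lemma exp_log_depth: "0 < r \<Longrightarrow> r \<le> 1 \<Longrightarrow> exp (log_depth r) = 1 - ln r"
  by (simp add: log_depth_def) (smt (verit) ln_le_zero_iff exp_ln)

lemma log_depth_radius [simp]: "log_depth (depth_radius s) = s"
  by (simp add: log_depth_def depth_radius_def)

lemma depth_radius_log: "0 < r \<Longrightarrow> r \<le> 1 \<Longrightarrow> depth_radius (log_depth r) = r"
  by (simp add: depth_radius_def exp_log_depth)

lemma log_depth_pos: "0 < r \<Longrightarrow> r < 1 \<Longrightarrow> 0 < log_depth r"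
  unfolding log_depth_def by (intro ln_gt_zero) simp

lemma log_depth_nonneg: "0 < r \<Longrightarrow> r \<le> 1 \<Longrightarrow> 0 \<le> log_depth r"
  by (simp add: log_depth_def)

lemma log_depth_1 [simp]: "log_depth 1 = 0"
  by (simp add: log_depth_def)

lemma depth_radius_0 [simp]: "depth_radius 0 = 1"
  by (simp add: depth_radius_def)

lemma depth_radius_pos [simp]: "0 < depth_radius s"
  by (simp add: depth_radius_def)

lemma depth_radius_less: "0 < s \<Longrightarrow> depth_radius s < 1"
  by (simp add: depth_radius_def)

lemma log_depth_deriv:
  assumes "0 < r" "r \<le> 1"
  shows "(log_depth has_real_derivative - 1 / (r * exp (log_depth r))) (at r)"
proof -
  have "0 < 1 - ln r" using assms by (smt (verit) ln_le_zero_iff)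
  then show ?thesis
    unfolding exp_log_depth[OF assms] log_depth_def[abs_def]
    using assms by (auto intro!: derivative_eq_intros simp: divide_simps)
qed

lemma depth_radius_deriv:
  "(depth_radius has_real_derivative - exp s * depth_radius s) (at s)"
  unfolding depth_radius_def[abs_def] by (auto intro!: derivative_eq_intros)

lemma depth_radius_tendsto: "filterlim depth_radius (at_right 0) at_top"
proof (rule tendsto_imp_filterlim_at_right)
  have "filterlim (\<lambda>s::real. - exp s) at_bot at_top"
    using exp_at_top by (simp add: filterlim_uminus_at_top)
  then have "filterlim (\<lambda>s::real. 1 + - exp s) at_bot at_top"
    by (simp only: filterlim_tendsto_add_at_bot_iff[OF tendsto_const])
  then show "(depth_radius \<longlongrightarrow> 0) at_top"
    unfolding depth_radius_def[abs_def] by (intro filterlim_compose[OF exp_at_bot]) simp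
qed auto

lemma log_depth_tendsto: "filterlim log_depth at_top (at_right 0)"
proof -
  have "filterlim (\<lambda>r::real. - ln r) at_top (at_right 0)"
    using ln_at_0 by (simp add: filterlim_uminus_at_bot)
  then have "filterlim (\<lambda>r::real. 1 + - ln r) at_top (at_right 0)"
    by (rule filterlim_tendsto_add_at_top[OF tendsto_const])
  then show ?thesis
    unfolding log_depth_def[abs_def] by (intro filterlim_compose[OF ln_at_top]) simp
qed

text \<open>The denominator is the square of \<open>dr/ds\<close>, so in the variable
  \<open>s\<close> the singular weight becomes the plain exponential
  \<open>exp (- k s)\<close>.\<close>

lemma Vk_log_depth:
  assumes "0 < r" "r \<le> 1"
  shows "Vk k r = exp (- k * log_depth r) / (r * exp (log_depth r))\<^sup>2"
proof -
  have "0 < 1 - ln r" using assms by (smt (verit) ln_le_zero_iff)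
  then have "(1 - ln r) powr (2 + k) = exp ((2 + k) * log_depth r)"
    by (simp add: powr_def log_depth_def)
  also have "\<dots> = (exp (log_depth r))\<^sup>2 * exp (k * log_depth r)"
    by (simp add: power2_eq_square algebra_simps flip: exp_add)
  finally show ?thesis
    unfolding Vk_def neg_ln_div_exp[OF assms(1)]
    by (simp add: power_mult_distrib exp_minus field_simps)
qed

lemma uniform_limit_Pair:
  assumes "uniform_limit S f l F" "uniform_limit S g l' F"
  shows "uniform_limit S (\<lambda>n x. (f n x, g n x)) (\<lambda>x. (l x, l' x)) F"
proof (rule uniform_limitI)
  fix e :: real assume "0 < e"
  then have "\<forall>\<^sub>F n in F. \<forall>x\<in>S. dist (f n x) (l x) < e / 2" "\<forall>\<^sub>F n in F. \<forall>x\<in>S. dist (g n x) (l' x) < e / 2"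
    by (auto intro!: uniform_limitD assms simp del: less_divide_eq_numeral1)
  then show "\<forall>\<^sub>F n in F. \<forall>x\<in>S. dist (f n x, g n x) (l x, l' x) < e"
  proof eventually_elim
    case (elim n)
    show ?case
    proof
      fix x assume "x \<in> S"
      then have "dist (f n x) (l x) < e / 2" "dist (g n x) (l' x) < e / 2" using elim by auto
      moreover have "dist (f n x, g n x) (l x, l' x) \<le> dist (f n x) (l x) + dist (g n x) (l' x)"
        unfolding dist_Pair_Pair by (rule sqrt_sum_squares_le_sum) auto
      ultimately show "dist (f n x, g n x) (l x, l' x) < e" by linarith
    qed
  qed
qed

text \<open>Eventually all values \<open>a n r\<close> lie in the unit ball around \<open>c\<close>,
  so uniform continuity of \<open>P\<close> is used on a compact set only.\<close>

lemma uniform_limit_continuous_image: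
  fixes a :: "'i \<Rightarrow> real \<Rightarrow> 'b::euclidean_space" and P :: "real \<times> 'b \<Rightarrow> real"
  assumes K: "compact K" and a: "uniform_limit K a (\<lambda>_. c) F"
    and P: "continuous_on (K \<times> UNIV) P"
  shows "uniform_limit K (\<lambda>n r. P (r, a n r)) (\<lambda>r. P (r, c)) F"
proof (rule uniform_limitI)
  fix e :: real assume e: "0 < e"
  have "uniformly_continuous_on (K \<times> cball c 1) P"
    by (intro compact_uniformly_continuous compact_Times K compact_cball continuous_on_subset[OF P]) auto
  then obtain d where d: "d > 0" "\<And>z z'. z \<in> K \<times> cball c 1 \<Longrightarrow> z' \<in> K \<times> cball c 1 \<Longrightarrow> dist z' z < d \<Longrightarrow> dist (P z') (P z) < e"
    using e unfolding uniformly_continuous_on_def by meson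
  have "\<forall>\<^sub>F n in F. \<forall>r\<in>K. dist (a n r) c < min d 1"
    using d(1) by (intro uniform_limitD[OF a]) simp
  then show "\<forall>\<^sub>F n in F. \<forall>r\<in>K. dist (P (r, a n r)) (P (r, c)) < e"
  proof eventually_elim
    case (elim n)
    then show ?case
      by (intro ballI d(2)) (auto simp: dist_Pair_Pair dist_commute less_imp_le)
  qed
qed

section \<open>Solutions as orbits\<close>

text \<open>Here \<open>L\<close> is the inverse of \<open>g\<close>, but only on \<open>[0,\<infinity>)\<close>: in the power case \<open>g\<close> omits the values
  up to \<open>- 1\<close>.\<close>

locale nonlinearity =
  fixes k m b :: real and f g L :: "real \<Rightarrow> real"
  assumes k: "0 < k" and m: "0 \<le> m" and mk: "m * k < 1" and b: "0 < b"
    and g0: "g 0 = 0"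
    and g_deriv: "\<And>x. (g has_real_derivative b * exp (m * x)) (at x)"
    and f_g: "\<And>x. f (g x) = exp ((1 + m) * x)"
    and L_g: "\<And>x. L (g x) = x"
    and g_L: "\<And>u. 0 \<le> u \<Longrightarrow> g (L u) = u"
    and L_deriv: "\<And>u. 0 \<le> u \<Longrightarrow> (L has_real_derivative exp (- (m * L u)) / b) (at u)"
    and L_top: "filterlim L at_top at_top"
begin

lemma L_0: "L 0 = 0"
  using L_g[of 0] g0 by simp

lemma g_less: "x < y \<Longrightarrow> g x < g y"
  by (rule DERIV_pos_imp_increasing) (use g_deriv b in \<open>auto intro!: exI[where x = "b * exp (m * _)"]\<close>)

lemma g_pos: "0 < x \<Longrightarrow> 0 < g x"
  using g_less[of 0 x] g0 by simp

lemma L_pos: "0 < u \<Longrightarrow> 0 < L u"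
  using g_less[of "L u" 0] g_L[of u] g0 L_0 by (metis less_eq_real_def linorder_neqE_linordered_idom not_less_iff_gr_or_eq)

lemma L_nonneg: "0 \<le> u \<Longrightarrow> 0 \<le> L u"
  using L_pos[of u] L_0 by (cases "u = 0") auto

lemma equilibrium_pos: "0 < k * (1 - m * k)"
  using k mk by simp

lemma g_continuous: "continuous_on S g"
  by (intro continuous_at_imp_continuous_on ballI DERIV_isCont[OF g_deriv])

text \<open>\<open>lam = b * exp (y 0)\<close> says that \<open>\<xi>\<close> vanishes at
  \<open>s = 0\<close>, which is the boundary condition. An orbit defined beyond
  \<open>s = 0\<close>, as \<open>a < 0\<close> demands, covers the one-sided derivatives at
  \<open>r = 1\<close>.\<close>

lemma orbit_solution:
  assumes lam: "lam = b * exp (y 0)" and o: "orbit k m a y Q" and a: "a < 0"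
    and u: "\<And>r. 0 < r \<Longrightarrow> r \<le> 1 \<Longrightarrow> u r = g (y (log_depth r) + k * log_depth r - y 0)"
  shows "C2_profile u"
    and "\<And>r. 0 < r \<Longrightarrow> r \<le> 1 \<Longrightarrow> rderiv u r =
      - (b * exp (m * (y (log_depth r) + k * log_depth r - y 0)) * Q (log_depth r)) / (r * exp (log_depth r))"
    and "\<And>r. 0 < r \<Longrightarrow> r \<le> 1 \<Longrightarrow> rderiv (rderiv u) r =
      - rderiv u r / r - lam * Vk k r * exp ((1 + m) * (y (log_depth r) + k * log_depth r - y 0))"
    and "\<And>r. 0 < r \<Longrightarrow> r \<le> 1 \<Longrightarrow> - (rderiv (rderiv u) r + rderiv u r / r) = lam * Vk k r * f (u r)"
    and "\<forall>x\<in>B1 - {0}. - laplacian (radial u) x = lam * Vk k (norm x) * f (radial u x)"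
    and "u 1 = 0"
    and "(\<And>s. 0 < Q s) \<Longrightarrow> 0 < r \<Longrightarrow> r < 1 \<Longrightarrow> 0 < u r"
proof -
  define X where "X = (\<lambda>s. y s + k * s - y 0)"
  \<comment> \<open>The flux \<open>- r exp s u'\<close>. Its equation has no quadratic term and is
    the radial equation written in \<open>s\<close>.\<close>
  define N where "N = (\<lambda>s. b * exp (m * X s) * Q s)"
  note oD = orbitD[OF o]
  have dX: "(X has_real_derivative Q s) (at s)" if "a < s" for s
    unfolding X_def using oD[OF that] by (auto intro!: derivative_eq_intros)
  have dN: "(N has_real_derivative N s - lam * exp (- k * s) * exp ((1 + m) * X s)) (at s)" if "a < s" for s
  proof -
    have "(N has_real_derivative b * (exp (m * X s) * (m * Q s)) * Q s + (b * exp (m * X s)) * (Q s - m * (Q s)\<^sup>2 - exp (y s))) (at s)"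
      unfolding N_def using dX[OF that] oD[OF that]
      by (auto intro!: derivative_eq_intros)
    moreover have "b * exp (m * X s) * exp (y s) = lam * exp (- k * s) * exp ((1 + m) * X s)"
      unfolding lam X_def by (simp add: mult.assoc flip: exp_add) (simp add: algebra_simps)
    ultimately show ?thesis by (simp add: N_def algebra_simps power2_eq_square)
  qed
  have s: "a < log_depth r" if "0 < r" "r \<le> 1" for r
    using log_depth_nonneg[OF that] a by linarith
  define v where "v = (\<lambda>r. g (X (log_depth r)))"
  have dXl: "((\<lambda>r. X (log_depth r)) has_real_derivative Q (log_depth r) * (- 1 / (r * exp (log_depth r)))) (at r)"
    if r: "0 < r" "r \<le> 1" for r
    by (rule DERIV_chain2[where f = X and g = log_depth, OF dX[OF s[OF r]] log_depth_deriv[OF r]])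
  define d1 where "d1 = (\<lambda>r. - N (log_depth r) / (r * exp (log_depth r)))"
  define d2 where "d2 = (\<lambda>r. - d1 r / r - lam * (exp (- k * log_depth r) / (r * exp (log_depth r))\<^sup>2) * exp ((1 + m) * X (log_depth r)))"
  have dv: "(v has_real_derivative d1 r) (at r)" if r: "0 < r" "r \<le> 1" for r
  proof -
    have "(v has_real_derivative (b * exp (m * X (log_depth r))) * (Q (log_depth r) * (- 1 / (r * exp (log_depth r))))) (at r)"
      unfolding v_def by (rule DERIV_chain2[OF g_deriv dXl[OF r]])
    then show ?thesis by (simp add: d1_def N_def mult.assoc)
  qed
  have dd: "(d1 has_real_derivative d2 r) (at r)" if r: "0 < r" "r \<le> 1" for r
  proof -
    define E where "E = exp (log_depth r)"
    define A where "A = lam * exp (- k * log_depth r) * exp ((1 + m) * X (log_depth r))"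
    have E: "0 < E" by (simp add: E_def)
    note ld = log_depth_deriv[OF r, folded E_def]
    have 1: "((\<lambda>r. N (log_depth r)) has_real_derivative (N (log_depth r) - A) * (- 1 / (r * E))) (at r)"
      unfolding A_def by (rule DERIV_chain2[where f = N and g = log_depth, OF dN[OF s[OF r]] ld])
    have 2: "((\<lambda>r. r * exp (log_depth r)) has_real_derivative E - 1) (at r)"
      using ld r E by (auto intro!: derivative_eq_intros simp flip: E_def)
    have "(d1 has_real_derivative
        (- ((N (log_depth r) - A) * (- 1 / (r * E))) * (r * E) - (- N (log_depth r)) * (E - 1)) / ((r * E) * (r * E))) (at r)"
      unfolding d1_def
      by (rule DERIV_cong[OF DERIV_divide[OF DERIV_minus[OF 1] 2]]) (use r E in \<open>simp_all flip: E_def\<close>)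
    moreover have "(- ((N (log_depth r) - A) * (- 1 / (r * E))) * (r * E) - (- N (log_depth r)) * (E - 1)) / ((r * E) * (r * E))
        = N (log_depth r) / (r * E) / r - A / (r * E)\<^sup>2"
      using r E by (simp add: field_simps power2_eq_square)
    ultimately show ?thesis by (simp add: d2_def d1_def A_def E_def)
  qed
  have ldc: "continuous_on {0<..1} log_depth"
    by (intro continuous_at_imp_continuous_on ballI DERIV_isCont[OF log_depth_deriv]) auto
  have Xc: "continuous_on {0<..1} (\<lambda>r. X (log_depth r))"
    by (intro continuous_at_imp_continuous_on ballI DERIV_isCont[OF dXl]) auto
  have d1c: "continuous_on {0<..1} d1"
    by (intro continuous_at_imp_continuous_on ballI DERIV_isCont[OF dd]) auto
  have d2c: "continuous_on {0<..1} d2"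
    unfolding d2_def by (intro continuous_intros ldc Xc d1c) auto
  have uv: "u r = v r" if "0 < r" "r \<le> 1" for r using u[OF that] by (simp add: v_def X_def)
  show C2: "C2_profile u" by (rule C2_profileI(1)[OF dv dd d2c uv])
  have R1': "rderiv u r = d1 r" if "0 < r" "r \<le> 1" for r
    by (rule C2_profileI(2)[OF dv dd d2c uv]) (use that in auto)
  have R2': "rderiv (rderiv u) r = d2 r" if "0 < r" "r \<le> 1" for r
    by (rule C2_profileI(3)[OF dv dd d2c uv]) (use that in auto)
  show R1: "rderiv u r = - (b * exp (m * (y (log_depth r) + k * log_depth r - y 0)) * Q (log_depth r)) / (r * exp (log_depth r))"
    if "0 < r" "r \<le> 1" for r
    using R1'[OF that] by (simp add: d1_def N_def X_def)
  show R2: "rderiv (rderiv u) r = - rderiv u r / r - lam * Vk k r * exp ((1 + m) * (y (log_depth r) + k * log_depth r - y 0))"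
    if r: "0 < r" "r \<le> 1" for r
    using R2'[OF r] unfolding R1'[OF r] d2_def Vk_log_depth[OF r] by (simp add: X_def)
  show R3: "- (rderiv (rderiv u) r + rderiv u r / r) = lam * Vk k r * f (u r)" if r: "0 < r" "r \<le> 1" for r
    unfolding R2[OF r] u[OF r] f_g by simp
  show "\<forall>x\<in>B1 - {0}. - laplacian (radial u) x = lam * Vk k (norm x) * f (radial u x)"
  proof
    fix x :: "real^2" assume x: "x \<in> B1 - {0}"
    then have n: "0 < norm x" "norm x < 1" by auto
    have "laplacian (radial u) x = rderiv (rderiv u) (norm x) + rderiv u (norm x) / norm x"
      by (rule laplacian_radial[of 0 1]) (use C2_profile_derivs[OF C2] n in auto)
    then show "- laplacian (radial u) x = lam * Vk k (norm x) * f (radial u x)"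
      using R3[of "norm x"] n by (simp add: radial_def)
  qed
  show "u 1 = 0" using u[of 1] by (simp add: g0)
  assume Q: "\<And>s. 0 < Q s" and r: "0 < r" "r < 1"
  have "X 0 < X (log_depth r)"
    by (rule DERIV_pos_imp_increasing[OF log_depth_pos[OF r]]) (use dX a Q in \<open>meson less_le_trans\<close>)
  then show "0 < u r" using uv[of r] r g_pos by (simp add: v_def X_def)
qed

text \<open>The equation is posed for \<open>r < 1\<close>, which gives the orbit for
  \<open>s > 0\<close>. Positivity keeps \<open>u\<close> in the range where \<open>L\<close>
  inverts \<open>g\<close>.\<close>

lemma solution_orbit:
  assumes lam: "0 < lam" and C2: "C2_profile u"
    and pde: "\<forall>x\<in>B1 - {0}. - laplacian (radial u) x = lam * Vk k (norm x) * f (radial u x)"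
    and pos: "\<And>r. 0 < r \<Longrightarrow> r < 1 \<Longrightarrow> 0 < u r"
  shows "\<exists>Q. orbit k m 0 (\<lambda>s. L (u (depth_radius s)) - k * s + ln (lam / b)) Q"
proof -
  define r where "r = depth_radius"
  \<comment> \<open>\<open>A\<close> is the flux divided by \<open>b\<close>. The factor
    \<open>E\<close> converts it into \<open>Q = \<xi>'\<close>, and the derivative
    \<open>- m Q E\<close> of this factor creates the quadratic term.\<close>
  define E where "E = (\<lambda>s. exp (- (m * L (u (r s)))))"
  define A where "A = (\<lambda>s. - (rderiv u (r s) * r s * exp s) / b)"
  define Q where "Q = (\<lambda>s. A s * E s)"
  define y where "y = (\<lambda>s. L (u (r s)) - k * s + ln (lam / b))"
  have r: "0 < r s" "r s < 1" if "0 < s" for s using that by (auto simp: r_def depth_radius_less)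
  have dr: "(r has_real_derivative - exp s * r s) (at s)" for s
    unfolding r_def by (rule depth_radius_deriv)
  have dL: "((\<lambda>s. L (u (r s))) has_real_derivative Q s) (at s)" if s: "0 < s" for s
  proof -
    have "((\<lambda>s. L (u (r s))) has_real_derivative (exp (- (m * L (u (r s)))) / b) * (rderiv u (r s) * (- exp s * r s))) (at s)"
      by (intro DERIV_chain2[OF L_deriv] DERIV_chain2[OF C2_profile_derivs(1)[OF C2]] dr r s less_imp_le pos)
    then show ?thesis by (simp add: Q_def A_def E_def mult_ac)
  qed
  have dE: "(E has_real_derivative - m * Q s * E s) (at s)" if s: "0 < s" for s
    unfolding E_def using dL[OF s] by (auto intro!: derivative_eq_intros)
  have dA: "(A has_real_derivative A s - lam / b * exp (- k * s) * f (u (r s))) (at s)" if s: "0 < s" for s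
  proof -
    have dw: "((\<lambda>s. rderiv u (r s)) has_real_derivative rderiv (rderiv u) (r s) * (- exp s * r s)) (at s)"
      by (rule DERIV_chain2[where f = "rderiv u" and g = r, OF C2_profile_derivs(2)[OF C2 r[OF s]] dr])
    have "(A has_real_derivative
        - ((rderiv (rderiv u) (r s) * (- exp s * r s) * r s + rderiv u (r s) * (- exp s * r s)) * exp s
          + rderiv u (r s) * r s * exp s) / b) (at s)"
      unfolding A_def
      by (rule DERIV_cdivide) (use dw dr[of s] in \<open>auto intro!: derivative_eq_intros simp: algebra_simps\<close>)
    moreover have "rderiv (rderiv u) (r s) = - rderiv u (r s) / r s - lam * Vk k (r s) * f (u (r s))"
      using radial_equation[OF C2 pde r(1)[OF s] r(2)[OF s]] by linarith
    moreover have "Vk k (r s) = exp (- k * s) / (r s * exp s)\<^sup>2"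
      using Vk_log_depth[of "r s"] r[OF s] by (simp add: r_def)
    ultimately show ?thesis
      using r[OF s] b by (elim DERIV_cong) (simp add: A_def field_simps power2_eq_square)
  qed
  have "orbit k m 0 y Q"
    unfolding orbit_def
  proof (intro allI impI conjI)
    fix s :: real assume s: "0 < s"
    show "(y has_real_derivative Q s - k) (at s)"
      unfolding y_def using dL[OF s] by (auto intro!: derivative_eq_intros)
    have "(Q has_real_derivative (A s - lam / b * exp (- k * s) * f (u (r s))) * E s + (- m * Q s * E s) * A s) (at s)"
      unfolding Q_def[abs_def] by (rule DERIV_mult[OF dA[OF s] dE[OF s, unfolded Q_def]])
    moreover have "lam / b * exp (- k * s) * f (u (r s)) * E s = exp (y s)"
    proof -
      have "f (u (r s)) = exp ((1 + m) * L (u (r s)))"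
        using f_g[of "L (u (r s))"] g_L[of "u (r s)"] pos[OF r[OF s]] by simp
      moreover have "exp (y s) = lam / b * exp (- k * s) * exp (L (u (r s)))"
        using lam b by (simp add: y_def exp_add exp_diff exp_minus divide_inverse mult_ac)
      ultimately show ?thesis by (simp add: E_def mult.assoc flip: exp_add) (simp add: algebra_simps)
    qed
    ultimately show "(Q has_real_derivative Q s - m * (Q s)\<^sup>2 - exp (y s)) (at s)"
      by (elim DERIV_cong) (simp add: Q_def algebra_simps power2_eq_square)
  qed
  then show ?thesis unfolding y_def r_def by blast
qed

text \<open>The orbit of a solution stops at \<open>s = 0\<close>. Continuity of \<open>u\<close> at
  \<open>r = 1\<close> carries the boundary value over, and \<open>h 0 = 0\<close> later determines
  \<open>\<lambda>\<close>.\<close>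

lemma profile_match:
  assumes C2: "C2_profile u" and u1: "u 1 = 0" and pos: "\<And>r. 0 < r \<Longrightarrow> r < 1 \<Longrightarrow> 0 < u r"
    and eta: "isCont h 0" and eq: "\<And>s. 0 < s \<Longrightarrow> L (u (depth_radius s)) = h s"
  shows "h 0 = 0" and "\<And>r. 0 < r \<Longrightarrow> r \<le> 1 \<Longrightarrow> u r = g (h (log_depth r))"
proof -
  have "continuous_on {0<..1} u"
    using C2 differentiable_imp_continuous_on by (auto simp: C2_profile_def)
  then have "(u \<longlongrightarrow> u 1) (at 1 within {0<..1})"
    by (simp add: continuous_on_def)
  then have u: "(u \<longlongrightarrow> 0) (at 1 within {0<..1})" by (simp only: u1)
  have "isCont depth_radius 0" by (rule DERIV_isCont[OF depth_radius_deriv])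
  then have "(depth_radius \<longlongrightarrow> 1) (at_right 0)"
    by (auto simp: isCont_def intro: filterlim_mono at_le)
  then have "filterlim depth_radius (at 1 within {0<..1}) (at_right 0)"
    unfolding filterlim_at using depth_radius_less less_imp_neq[OF depth_radius_less]
    by (auto simp: eventually_at_right_field intro!: exI[of _ 1] less_imp_le)
  then have "((\<lambda>s. u (depth_radius s)) \<longlongrightarrow> 0) (at_right 0)"
    by (rule filterlim_compose[OF u])
  then have "((\<lambda>s. L (u (depth_radius s))) \<longlongrightarrow> L 0) (at_right 0)"
    by (rule isCont_tendsto_compose[OF DERIV_isCont[OF L_deriv], rotated]) simp
  then have "((\<lambda>s. L (u (depth_radius s))) \<longlongrightarrow> 0) (at_right 0)"
    by (simp only: L_0)
  then have "(h \<longlongrightarrow> 0) (at_right 0)"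
    by (rule Lim_transform_eventually) (auto simp: eq eventually_at_right_field intro!: exI[of _ 1])
  moreover have "(h \<longlongrightarrow> h 0) (at_right 0)"
    using eta by (auto simp: isCont_def intro: filterlim_mono at_le)
  ultimately show h0: "h 0 = 0" by (intro tendsto_unique[of "at_right (0::real)" h]) auto
  fix r :: real assume r: "0 < r" "r \<le> 1"
  show "u r = g (h (log_depth r))"
  proof (cases "r = 1")
    case False
    then have r1: "r < 1" using r by simp
    have "L (u r) = h (log_depth r)"
      using eq[OF log_depth_pos[OF r(1) r1]] depth_radius_log[OF r] by simp
    then show ?thesis using g_L[of "u r"] pos[OF r(1) r1] by simp
  qed (simp add: u1 h0 g0)
qed

lemma radial_pos_iff:
  "(\<forall>x\<in>B1 - {0}. radial u x > 0) \<longleftrightarrow> (\<forall>r. 0 < r \<and> r < 1 \<longrightarrow> 0 < u r)"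
  "(\<forall>x\<in>B1. radial u x > 0) \<longleftrightarrow> (\<forall>r. 0 \<le> r \<and> r < 1 \<longrightarrow> 0 < u r)"
  "(\<forall>x::real^2\<in>sphere 0 1. radial u x = 0) \<longleftrightarrow> u 1 = 0"
proof -
  have n: "norm (r *\<^sub>R (axis 1 1 :: real^2)) = r" if "0 \<le> r" for r
    using that by (simp add: norm_axis_1)
  show "(\<forall>x\<in>B1 - {0}. radial u x > 0) \<longleftrightarrow> (\<forall>r. 0 < r \<and> r < 1 \<longrightarrow> 0 < u r)"
  proof (intro iffI allI impI ballI)
    fix r :: real assume *: "\<forall>x\<in>B1 - {0}. radial u x > 0" and r: "0 < r \<and> r < 1"
    then have "r *\<^sub>R (axis 1 1 :: real^2) \<in> B1 - {0}" using n[of r] by force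
    from bspec[OF * this] show "0 < u r" using n[of r] r by (simp add: radial_def)
  qed (auto simp: radial_def)
  show "(\<forall>x\<in>B1. radial u x > 0) \<longleftrightarrow> (\<forall>r. 0 \<le> r \<and> r < 1 \<longrightarrow> 0 < u r)"
  proof (intro iffI allI impI ballI)
    fix r :: real assume *: "\<forall>x\<in>B1. radial u x > 0" and r: "0 \<le> r \<and> r < 1"
    then have "r *\<^sub>R (axis 1 1 :: real^2) \<in> B1" using n[of r] by auto
    from bspec[OF * this] show "0 < u r" using n[of r] r by (simp add: radial_def)
  qed (auto simp: radial_def)
  show "(\<forall>x::real^2\<in>sphere 0 1. radial u x = 0) \<longleftrightarrow> u 1 = 0"
  proof
    assume *: "\<forall>x::real^2\<in>sphere 0 1. radial u x = 0"
    have "axis 1 1 \<in> sphere (0::real^2) 1" by (simp add: norm_axis_1)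
    from bspec[OF * this] show "u 1 = 0" by (simp add: radial_def norm_axis_1)
  qed (auto simp: radial_def)
qed

lemma equilibrium_orbit:
  "orbit k m a (\<lambda>s. ln (k * (1 - m * k))) (\<lambda>s. k)"
  using equilibrium_pos by (auto simp: orbit_def power2_eq_square algebra_simps intro!: derivative_eq_intros)

text \<open>This is the constant orbit at the equilibrium. It exists as soon as
  \<open>k (1 - m k)\<close> is positive, that is, for \<open>m k < 1\<close>, which in the power
  case reads \<open>p > p_s\<close>.\<close>

theorem singular_solution:
  assumes U: "\<And>r. 0 < r \<Longrightarrow> r \<le> 1 \<Longrightarrow> U r = g (k * log_depth r)"
  shows "radial_singular_solution k f (b * (k * (1 - m * k))) U"
proof -
  let ?H = "k * (1 - m * k)"
  have lam: "b * ?H = b * exp (ln ?H)" using equilibrium_pos by simp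
  have U': "U r = g (ln ?H + k * log_depth r - ln ?H)" if "0 < r" "r \<le> 1" for r using U[OF that] by simp
  note S = orbit_solution[where y = "\<lambda>s. ln ?H" and Q = "\<lambda>s. k" and a = "-1" and u = U, OF lam equilibrium_orbit _ U']
  have "filterlim (\<lambda>r. g (k * log_depth r)) at_top (at_right 0)"
  proof (rule filterlim_compose[of g at_top at_top])
    show "filterlim (\<lambda>r. k * log_depth r) at_top (at_right 0)"
      using k log_depth_tendsto by (intro filterlim_tendsto_pos_mult_at_top[OF tendsto_const])
    show "filterlim g at_top at_top"
      unfolding filterlim_at_top
    proof
      fix Z :: real
      have "Z \<le> g x" if "L (max Z 0) < x" for x
        using g_less[OF that] g_L[of "max Z 0"] by simp
      then show "\<forall>\<^sub>F x in at_top. Z \<le> g x"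
        by (intro eventually_mono[OF eventually_gt_at_top[of "L (max Z 0)"]])
    qed
  qed
  then have "filterlim U at_top (at_right 0)"
    by (rule filterlim_cong[THEN iffD1, OF refl refl, rotated])
      (auto simp: eventually_at_right_field U intro!: exI[of _ 1])
  then show ?thesis
    unfolding radial_singular_solution_def radial_pos_iff
  proof (intro conjI)
    show "0 < b * ?H" using b equilibrium_pos by simp
    show "C2_profile U" by (rule S(1)) auto
    show "\<forall>x\<in>B1 - {0}. - laplacian (radial U) x = b * ?H * Vk k (norm x) * f (radial U x)" by (rule S(5)) auto
    show "- (rderiv (rderiv U) 1 + rderiv U 1 / 1) = b * ?H * Vk k 1 * f (U 1)" by (rule S(4)) auto
    show "\<forall>r. 0 < r \<and> r < 1 \<longrightarrow> 0 < U r" by (intro allI impI S(7)) (use k in auto)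
    show "U 1 = 0" by (rule S(6)) auto
  qed
qed

end

section \<open>Uniqueness of the singular solution, and the curve of regular solutions\<close>

context nonlinearity
begin

text \<open>The unknown \<open>lam\<close> enters the orbit only as an additive constant. Constancy
  of the orbit gives \<open>L (U r)\<close> up to this constant, which the boundary value then
  fixes.\<close>

theorem singular_solution_unique:
  assumes mk2: "2 * m * k < 1" and sol: "radial_singular_solution k f lam U"
  shows "lam = b * (k * (1 - m * k))" and "\<And>r. 0 < r \<Longrightarrow> r \<le> 1 \<Longrightarrow> U r = g (k * log_depth r)"
proof -
  let ?H = "k * (1 - m * k)"
  have lam: "0 < lam" and C2: "C2_profile U" and U1: "U 1 = 0"
    and pde: "\<forall>x\<in>B1 - {0}. - laplacian (radial U) x = lam * Vk k (norm x) * f (radial U x)"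
    and pos: "\<And>r. 0 < r \<Longrightarrow> r < 1 \<Longrightarrow> 0 < U r" and top: "filterlim U at_top (at_right 0)"
    using sol unfolding radial_singular_solution_def radial_pos_iff by auto
  define y where "y = (\<lambda>s. L (U (depth_radius s)) - k * s + ln (lam / b))"
  obtain Q where o: "orbit k m 0 y Q"
    using solution_orbit[OF lam C2 pde pos] unfolding y_def by blast
  have "filterlim (\<lambda>s. L (U (depth_radius s))) at_top at_top"
    by (intro filterlim_compose[OF L_top] filterlim_compose[OF top] depth_radius_tendsto)
  then have "filterlim (\<lambda>s. ln (lam / b) + L (U (depth_radius s))) at_top at_top"
    by (rule filterlim_tendsto_add_at_top[OF tendsto_const])
  then have ytop: "filterlim (\<lambda>s. y s + k * s) at_top at_top" by (simp add: y_def add.commute)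
  have yb: "ln (lam / b) \<le> y s + k * s" if "0 < s" for s
    using L_nonneg[OF less_imp_le[OF pos[OF depth_radius_pos depth_radius_less[OF that]]]]
    by (simp add: y_def)
  have y: "y s = ln ?H" if s: "0 < s" for s
    by (rule singular_orbit_constant[OF o m k mk2 ytop yb s])
  define h where "h = (\<lambda>s. k * s + (ln ?H - ln (lam / b)))"
  have hL: "L (U (depth_radius s)) = h s" if "0 < s" for s
    using y[OF that] by (simp add: y_def h_def)
  have hc: "isCont h 0" unfolding h_def by (intro continuous_intros)
  have h0: "h 0 = 0" by (rule profile_match(1)[OF C2 U1 pos hc hL])
  then have "ln ?H = ln (lam / b)" by (simp add: h_def)
  then have "?H = lam / b" using equilibrium_pos lam b by (metis divide_pos_pos ln_inj_iff)
  then show "lam = b * ?H" using b by (simp add: field_simps)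
  fix r :: real assume r: "0 < r" "r \<le> 1"
  have "h (log_depth r) = k * log_depth r" using h0 by (simp add: h_def)
  moreover have "U r = g (h (log_depth r))"
    by (rule profile_match(2)[OF C2 U1 pos hc hL]) (use r in auto)
  ultimately show "U r = g (k * log_depth r)" by simp
qed

text \<open>Translating the regular orbit by \<open>l / k\<close> changes the limit of
  \<open>y + k s\<close> from \<open>0\<close> to \<open>l\<close>. The translate has the value
  \<open>y (- l / k)\<close> at \<open>s = 0\<close>, and this value fixes
  \<open>\<lambda>\<close>.\<close>

definition curve_lam :: "(real \<Rightarrow> real) \<Rightarrow> real \<Rightarrow> real" where
  "curve_lam y l = b * exp (y (- l / k))"

text \<open>The value at \<open>0\<close> is the limit for \<open>r\<close> tending to
  \<open>0\<close>; \<open>undefined\<close> outside \<open>[0,1]\<close> is what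
  \<open>extensional\<close> demands.\<close>

definition curve_profile :: "(real \<Rightarrow> real) \<Rightarrow> real \<Rightarrow> real \<Rightarrow> real" where
  "curve_profile y l r = (if r = 0 then g (l - y (- l / k))
     else if 0 < r \<and> r \<le> 1 then g (y (log_depth r - l / k) + k * log_depth r - y (- l / k))
     else undefined)"

end

text \<open>The condition \<open>2 m k < 1\<close> strengthens the \<open>m k < 1\<close> of the
  base locale; in the power case it is \<open>p > p_c\<close> instead of
  \<open>p > p_s\<close>.\<close>

locale regular_curve = nonlinearity +
  fixes y Q :: "real \<Rightarrow> real"
  assumes mk2: "2 * m * k < 1"
    and orb: "\<And>a. orbit k m a y Q" and Qpos: "\<And>s. 0 < Q s"
    and ylim: "((\<lambda>s. y s + k * s) \<longlongrightarrow> 0) at_top" and Qlim: "(Q \<longlongrightarrow> 0) at_top"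
begin

lemma shifted_orbit: "orbit k m a (\<lambda>s. y (s - l / k)) (\<lambda>s. Q (s - l / k))"
  unfolding orbit_def
proof (intro allI impI conjI)
  fix s
  note D = orbitD[OF orb, of "s - l / k - 1" "s - l / k"]
  have sh: "((\<lambda>s. s - l / k) has_real_derivative 1) (at s)"
    by (auto intro!: derivative_eq_intros)
  show "((\<lambda>s. y (s - l / k)) has_real_derivative Q (s - l / k) - k) (at s)"
    using DERIV_chain2[where f = y and g = "\<lambda>s. s - l / k", OF D(1) sh] by simp
  show "((\<lambda>s. Q (s - l / k)) has_real_derivative
      Q (s - l / k) - m * (Q (s - l / k))\<^sup>2 - exp (y (s - l / k))) (at s)"
    using DERIV_chain2[where f = Q and g = "\<lambda>s. s - l / k", OF D(2) sh] by simp
qed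

lemma shift_at_top: "filterlim (\<lambda>s. s - l / k) at_top at_top"
  using filterlim_tendsto_add_at_top[OF tendsto_const[of "- (l / k)"] filterlim_ident]
  by simp

lemma shifted_lim: "((\<lambda>s. y (s - l / k) + k * s) \<longlongrightarrow> l) at_top"
proof -
  have "((\<lambda>s. (y (s - l / k) + k * (s - l / k)) + l) \<longlongrightarrow> 0 + l) at_top"
    by (intro tendsto_add tendsto_const filterlim_compose[OF ylim shift_at_top])
  moreover have "(y (s - l / k) + k * (s - l / k)) + l = y (s - l / k) + k * s" for s
    using k by (simp add: field_simps)
  ultimately show ?thesis by simp
qed

lemma shifted_Qlim: "((\<lambda>s. Q (s - l / k)) \<longlongrightarrow> 0) at_top"
  by (rule filterlim_compose[OF Qlim shift_at_top])

lemma shifted_increasing: "y (s - l / k) + k * s \<le> l"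
proof (rule tendsto_lowerbound[OF shifted_lim])
  have "y (s - l / k) + k * s \<le> y (t - l / k) + k * t" if "s \<le> t" for t
  proof (rule mono_from[of "s - 1" "\<lambda>s. y (s - l / k) + k * s" "\<lambda>s. Q (s - l / k)", OF _ _ _ that])
    fix x
    show "((\<lambda>s. y (s - l / k) + k * s) has_real_derivative Q (x - l / k)) (at x)"
      using orbitD(1)[OF shifted_orbit, of "x - 1" x] by (auto intro!: derivative_eq_intros)
  qed (use Qpos in \<open>auto intro: less_imp_le\<close>)
  then show "\<forall>\<^sub>F t in at_top. y (s - l / k) + k * s \<le> y (t - l / k) + k * t"
    by (auto simp: eventually_at_top_linorder)
qed auto

lemma curve_solution:
  "radial_solution k f (curve_lam y l) (curve_profile y l)"
  "curve_profile y l \<in> extensional {0..1}"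
  "L (curve_profile y l 0) + ln (curve_lam y l / b) = l"
proof -
  let ?u = "curve_profile y l"
  define y' where "y' = (\<lambda>s. y (s - l / k))"
  define Q' where "Q' = (\<lambda>s. Q (s - l / k))"
  have o: "orbit k m (-1) y' Q'" unfolding y'_def Q'_def by (rule shifted_orbit)
  have lam: "curve_lam y l = b * exp (y' 0)" by (simp add: curve_lam_def y'_def)
  have u: "?u r = g (y' (log_depth r) + k * log_depth r - y' 0)" if "0 < r" "r \<le> 1" for r
    using that by (simp add: curve_profile_def y'_def)
  note S = orbit_solution[OF lam o _ u]
  have C2: "C2_profile ?u" by (rule S(1)) auto
  have u0: "?u 0 = g (l - y' 0)" by (simp add: curve_profile_def y'_def)
  \<comment> \<open>Serves the positivity at the origin, where the profile takes the limit value
    \<open>g (l - y' 0)\<close>.\<close>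
  have "y' 0 < y' 1 + k * 1"
  proof -
    have "y' 0 + k * 0 < y' 1 + k * 1"
    proof (rule DERIV_pos_imp_increasing[where f = "\<lambda>s. y' s + k * s"])
      fix x :: real assume "0 \<le> x" "x \<le> 1"
      then have "((\<lambda>s. y' s + k * s) has_real_derivative Q' x) (at x)"
        using orbitD(1)[OF o, of x] by (auto intro!: derivative_eq_intros)
      then show "\<exists>z. ((\<lambda>s. y' s + k * s) has_real_derivative z) (at x) \<and> 0 < z"
        using Qpos by (auto simp: Q'_def)
    qed simp
    then show ?thesis by simp
  qed
  then have y0: "y' 0 < l" using shifted_increasing[of 1 l] by (simp add: y'_def)
  have lim0: "(?u \<longlongrightarrow> ?u 0) (at_right 0)"
  proof -
    have "((\<lambda>s. y' s + k * s - y' 0) \<longlongrightarrow> l - y' 0) at_top"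
      unfolding y'_def by (intro tendsto_diff shifted_lim tendsto_const)
    then have "((\<lambda>r. y' (log_depth r) + k * log_depth r - y' 0) \<longlongrightarrow> l - y' 0) (at_right 0)"
      by (rule filterlim_compose[OF _ log_depth_tendsto])
    then have "((\<lambda>r. g (y' (log_depth r) + k * log_depth r - y' 0)) \<longlongrightarrow> g (l - y' 0)) (at_right 0)"
      by (rule isCont_tendsto_compose[OF DERIV_isCont[OF g_deriv]])
    then show ?thesis
      unfolding u0
      by (rule Lim_transform_eventually) (auto simp: u eventually_at_right_field intro!: exI[of _ 1])
  qed
  have cont: "continuous_on {0..1} ?u"
    unfolding continuous_on_def
  proof
    fix r :: real assume r: "r \<in> {0..1}"
    show "(?u \<longlongrightarrow> ?u r) (at r within {0..1})"
    proof (cases "r = 0")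
      case True
      have "at 0 within {0..1} = at_right (0::real)"
        by (rule at_within_Icc_at_right) simp
      then show ?thesis using lim0 True by simp
    next
      case False
      have "continuous_on {0<..1} ?u"
        using C2 differentiable_imp_continuous_on by (auto simp: C2_profile_def)
      then have "(?u \<longlongrightarrow> ?u r) (at r within {0<..1})"
        using False r by (auto simp: continuous_on_def)
      moreover have "at r within {0<..1} = at r within {0..1}"
        by (rule at_within_nhd[of _ "{0<..}"]) (use False r in auto)
      ultimately show ?thesis by simp
    qed
  qed
  have pos: "0 < ?u r" if "0 \<le> r" "r < 1" for r
  proof (cases "r = 0")
    case True
    then show ?thesis using g_pos[of "l - y' 0"] y0 u0 by simp
  next
    case False
    show ?thesis by (rule S(7)) (use False that Qpos in \<open>auto simp: Q'_def\<close>)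
  qed
  show "radial_solution k f (curve_lam y l) ?u"
    unfolding radial_solution_def radial_pos_iff
  proof (intro conjI)
    show "0 < curve_lam y l" using b by (simp add: curve_lam_def)
    show "\<forall>x\<in>B1 - {0}. - laplacian (radial ?u) x = curve_lam y l * Vk k (norm x) * f (radial ?u x)"
      by (rule S(5)) auto
    show "?u 1 = 0" by (rule S(6)) auto
  qed (use C2 cont pos in auto)
  show "?u \<in> extensional {0..1}"
    by (auto simp: extensional_def curve_profile_def)
  show "L (?u 0) + ln (curve_lam y l / b) = l"
    using b by (simp add: u0 L_g curve_lam_def y'_def)
qed

text \<open>Continuity of \<open>u\<close> at the origin turns the parameter into the limit
  \<open>l\<close> of \<open>y + k s\<close> at infinity, and this limit identifies the
  orbit.\<close>

lemma curve_unique: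
  assumes sol: "radial_solution k f lam u" and ext: "u \<in> extensional {0..1}"
    and par: "L (u 0) + ln (lam / b) = l"
  shows "lam = curve_lam y l" and "u = curve_profile y l"
proof -
  have lam: "0 < lam" and C2: "C2_profile u" and cont: "continuous_on {0..1} u" and u1: "u 1 = 0"
    and pde: "\<forall>x\<in>B1 - {0}. - laplacian (radial u) x = lam * Vk k (norm x) * f (radial u x)"
    and pos0: "\<And>r. 0 \<le> r \<Longrightarrow> r < 1 \<Longrightarrow> 0 < u r"
    using sol unfolding radial_solution_def radial_pos_iff by auto
  have pos: "0 < u r" if "0 < r" "r < 1" for r using pos0 that by simp
  define y1 where "y1 = (\<lambda>s. L (u (depth_radius s)) - k * s + ln (lam / b))"
  obtain Q1 where o1: "orbit k m 0 y1 Q1"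
    using solution_orbit[OF lam C2 pde pos] unfolding y1_def by blast
  have "(u \<longlongrightarrow> u 0) (at 0 within {0..1})" using cont by (simp add: continuous_on_def)
  moreover have "at 0 within {0..1} = at_right (0::real)"
    by (rule at_within_Icc_at_right) simp
  ultimately have "(u \<longlongrightarrow> u 0) (at_right 0)" by simp
  then have "((\<lambda>s. u (depth_radius s)) \<longlongrightarrow> u 0) at_top"
    by (rule filterlim_compose[OF _ depth_radius_tendsto])
  then have "((\<lambda>s. L (u (depth_radius s))) \<longlongrightarrow> L (u 0)) at_top"
    by (rule isCont_tendsto_compose[OF DERIV_isCont[OF L_deriv], rotated]) (use pos0[of 0] in simp)
  then have "((\<lambda>s. L (u (depth_radius s)) + ln (lam / b)) \<longlongrightarrow> l) at_top"
    unfolding par[symmetric] by (intro tendsto_add tendsto_const)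
  then have l1: "((\<lambda>s. y1 s + k * s) \<longlongrightarrow> l) at_top" by (simp add: y1_def)
  have C1: "ln (lam / b) \<le> y1 s + k * s" if "0 < s" for s
    using L_nonneg[OF less_imp_le[OF pos[OF depth_radius_pos depth_radius_less[OF that]]]]
    by (simp add: y1_def)
  have q1: "(Q1 \<longlongrightarrow> 0) at_top" by (rule regular_orbit_Q_tendsto(2)[OF o1 m k mk2 C1 l1])
  have p1: "0 < Q1 s" if "0 < s" for s by (rule orbit_Q_pos[OF o1 m C1 that])
  have y: "y1 s = y (s - l / k)" if s: "0 < s" for s
    by (rule regular_orbit_unique[OF o1 shifted_orbit m k l1 shifted_lim q1 shifted_Qlim p1 Qpos s])
  define h where "h = (\<lambda>s. y (s - l / k) + k * s - ln (lam / b))"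
  have hL: "L (u (depth_radius s)) = h s" if "0 < s" for s
    using y[OF that] by (simp add: y1_def h_def)
  have "isCont (\<lambda>s. y (s - l / k)) 0"
    by (rule DERIV_isCont[OF orbitD(1)[OF shifted_orbit, of "-1" 0]]) simp
  then have hc: "isCont h 0" unfolding h_def by (intro continuous_intros)
  have h0: "h 0 = 0" by (rule profile_match(1)[OF C2 u1 pos hc hL])
  then have ln: "y (- l / k) = ln (lam / b)" by (simp add: h_def)
  then show lam': "lam = curve_lam y l" using lam b by (simp add: curve_lam_def)
  have "u r = curve_profile y l r" for r
  proof (cases "r \<in> {0..1}")
    case True
    show ?thesis
    proof (cases "r = 0")
      case True
      have "L (u 0) = l - y (- l / k)" using par ln by simp
      then have "u 0 = g (l - y (- l / k))" using g_L[of "u 0"] pos0[of 0] by simp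
      then show ?thesis using True by (simp add: curve_profile_def)
    next
      case False
      then have r: "0 < r" "r \<le> 1" using True by auto
      have "u r = g (h (log_depth r))"
        by (rule profile_match(2)[OF C2 u1 pos hc hL]) (use r in auto)
      then show ?thesis using r ln by (simp add: curve_profile_def h_def)
    qed
  next
    case False
    then show ?thesis using ext by (auto simp: extensional_def curve_profile_def)
  qed
  then show "u = curve_profile y l" by blast
qed

text \<open>On \<open>K\<close> the variable \<open>s\<close> is bounded above, so the shift by
  \<open>l / k\<close> moves all of \<open>K\<close> towards minus infinity at once.\<close>

lemma shift_uniform:
  assumes K: "compact K" "K \<subseteq> {0<..1}" and F: "(F \<longlongrightarrow> c) at_bot"
  shows "uniform_limit K (\<lambda>l r. F (log_depth r - l / k)) (\<lambda>_. c) at_top"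
proof (rule uniform_limitI)
  fix e :: real assume "0 < e"
  then have "\<forall>\<^sub>F s in at_bot. dist (F s) c < e" using F by (rule tendstoD[rotated])
  then obtain T where T: "\<And>s. s \<le> T \<Longrightarrow> dist (F s) c < e" by (auto simp: eventually_at_bot_linorder)
  have "continuous_on K log_depth"
    using K(2) by (intro continuous_at_imp_continuous_on ballI DERIV_isCont[OF log_depth_deriv]) auto
  then have "bdd_above (log_depth ` K)"
    by (intro bounded_imp_bdd_above compact_imp_bounded compact_continuous_image K)
  then obtain S where S: "\<And>r. r \<in> K \<Longrightarrow> log_depth r \<le> S" by (auto simp: bdd_above_def)
  show "\<forall>\<^sub>F l in at_top. \<forall>r\<in>K. dist (F (log_depth r - l / k)) c < e"
    using eventually_ge_at_top[of "k * (S - T)"]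
  proof eventually_elim
    case (elim l)
    then have "S - T \<le> l / k" using k by (simp add: field_simps)
    then show ?case using S by (intro ballI T) force
  qed
qed

text \<open>By the differential equation, the profile and its first two radial derivatives are fixed
  continuous functions of \<open>r\<close>, \<open>y\<close>, \<open>Q\<close> and the value of
  \<open>y\<close> at the boundary. Convergence of the orbit at minus infinity therefore yields all
  three uniform limits.\<close>

theorem curve_limit:
  "((\<lambda>l. curve_lam y l) \<longlongrightarrow> b * (k * (1 - m * k))) at_top"
  "(\<And>r. 0 < r \<Longrightarrow> r \<le> 1 \<Longrightarrow> U r = g (k * log_depth r)) \<Longrightarrow> C2_loc_limit (curve_profile y) U at_top"
proof -
  let ?H = "k * (1 - m * k)"
  define yy where "yy = ln ?H"
  have "filterlim (\<lambda>s. k * s) at_top at_top"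
    using k by (intro filterlim_tendsto_pos_mult_at_top[OF tendsto_const _ filterlim_ident])
  then have "filterlim (\<lambda>s. - (k * s)) at_bot at_top" by (simp add: filterlim_uminus_at_top)
  then have "filterlim (\<lambda>s. (y s + k * s) + - (k * s)) at_bot at_top"
    by (simp only: filterlim_tendsto_add_at_bot_iff[OF ylim])
  then have ybot: "filterlim y at_bot at_top" by simp
  have lims: "(y \<longlongrightarrow> yy) at_bot" "(Q \<longlongrightarrow> k) at_bot"
    unfolding yy_def using regular_orbit_at_bot[OF orb m k mk2 ybot Qlim] by auto
  have y0lim: "((\<lambda>l. y (- l / k)) \<longlongrightarrow> yy) at_top"
  proof (rule filterlim_compose[OF lims(1)])
    have "filterlim (\<lambda>l. (1 / k) * l) at_top at_top"
      using k by (intro filterlim_tendsto_pos_mult_at_top[OF tendsto_const _ filterlim_ident]) auto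
    then show "filterlim (\<lambda>l. - l / k) at_bot at_top" by (simp add: filterlim_uminus_at_top)
  qed
  have "((\<lambda>l. b * exp (y (- l / k))) \<longlongrightarrow> b * exp yy) at_top" by (intro tendsto_intros y0lim)
  then show "((\<lambda>l. curve_lam y l) \<longlongrightarrow> b * ?H) at_top"
    using equilibrium_pos by (simp add: curve_lam_def[abs_def] yy_def)
  assume U: "\<And>r. 0 < r \<Longrightarrow> r \<le> 1 \<Longrightarrow> U r = g (k * log_depth r)"
  have lamU: "b * ?H = b * exp yy" using equilibrium_pos by (simp add: yy_def)
  have oU: "orbit k m (-1) (\<lambda>s. yy) (\<lambda>s. k)" unfolding yy_def by (rule equilibrium_orbit)
  have U': "U r = g (yy + k * log_depth r - yy)" if "0 < r" "r \<le> 1" for r using U[OF that] by simp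
  note SU = orbit_solution[where y = "\<lambda>s. yy" and Q = "\<lambda>s. k" and a = "-1" and u = U, OF lamU oU _ U']
  have u: "curve_profile y l r = g (y (log_depth r - l / k) + k * log_depth r - y (0 - l / k))"
    if "0 < r" "r \<le> 1" for r l
    using that by (simp add: curve_profile_def)
  have laml: "curve_lam y l = b * exp (y (0 - l / k))" for l by (simp add: curve_lam_def)
  note Sl = orbit_solution[where y = "\<lambda>s. y (s - l / k)" and Q = "\<lambda>s. Q (s - l / k)" and a = "-1"
      and u = "curve_profile y l" for l, OF laml shifted_orbit _ u]
  show "C2_loc_limit (curve_profile y) U at_top"
    unfolding C2_loc_limit_def
  proof (intro allI impI)
    fix K :: "real set" assume K: "compact K \<and> K \<subseteq> {0<..1}"
    then have Kr: "0 < r" "r \<le> 1" if "r \<in> K" for r using that by auto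
    define A where "A = (\<lambda>l r. ((y (log_depth r - l / k), Q (log_depth r - l / k)), y (0 - l / k)))"
    have A: "uniform_limit K A (\<lambda>_. ((yy, k), yy)) at_top"
      unfolding A_def
    proof (intro uniform_limit_Pair shift_uniform lims)
      show "uniform_limit K (\<lambda>l r. y (0 - l / k)) (\<lambda>_. yy) at_top"
        using y0lim by (intro uniform_limitI) (auto dest: tendstoD elim!: eventually_mono)
    qed (use K in auto)
    have ld: "continuous_on (K \<times> UNIV) (\<lambda>z. log_depth (fst z))"
    proof (rule continuous_on_compose2[of "{0<..1}" log_depth])
      show "continuous_on {0<..1} log_depth"
        by (intro continuous_at_imp_continuous_on ballI DERIV_isCont[OF log_depth_deriv]) auto
    qed (use K in \<open>auto intro!: continuous_intros\<close>)
    define X where "X = (\<lambda>z :: real \<times> (real \<times> real) \<times> real. fst (fst (snd z)) + k * log_depth (fst z) - snd (snd z))"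
    have X: "continuous_on (K \<times> UNIV) X"
      unfolding X_def by (intro continuous_intros ld)
    define P1 where "P1 = (\<lambda>z. - (b * exp (m * X z) * snd (fst (snd z))) / (fst z * exp (log_depth (fst z))))"
    have P1: "continuous_on (K \<times> UNIV) P1"
      unfolding P1_def by (intro continuous_intros ld X) (use Kr in fastforce)
    define P2 where "P2 = (\<lambda>z. - P1 z / fst z - b * exp (snd (snd z)) * (exp (- k * log_depth (fst z)) / (fst z * exp (log_depth (fst z)))\<^sup>2) * exp ((1 + m) * X z))"
    have P2: "continuous_on (K \<times> UNIV) P2"
      unfolding P2_def by (intro continuous_intros ld X P1) (use Kr in fastforce)+
    have gX: "continuous_on (K \<times> UNIV) (\<lambda>z. g (X z))"
      by (rule continuous_on_compose2[OF g_continuous[of UNIV] X]) auto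
    have "uniform_limit K (\<lambda>l r. g (X (r, A l r))) (\<lambda>r. g (X (r, ((yy, k), yy)))) at_top"
      by (rule uniform_limit_continuous_image[OF _ A gX]) (use K in auto)
    moreover have "g (X (r, A l r)) = curve_profile y l r" if "r \<in> K" for l r
      using u[OF Kr[OF that]] by (simp add: X_def A_def)
    moreover have "g (X (r, ((yy, k), yy))) = U r" if "r \<in> K" for r
      using U'[OF Kr[OF that]] by (simp add: X_def)
    ultimately have 0: "uniform_limit K (curve_profile y) U at_top"
      by (simp cong: uniform_limit_cong')
    have "uniform_limit K (\<lambda>l r. P1 (r, A l r)) (\<lambda>r. P1 (r, ((yy, k), yy))) at_top"
      by (rule uniform_limit_continuous_image[OF _ A P1]) (use K in auto)
    moreover have R1: "P1 (r, A l r) = rderiv (curve_profile y l) r" if "r \<in> K" for l r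
    proof -
      have "rderiv (curve_profile y l) r = - (b * exp (m * (y (log_depth r - l / k) + k * log_depth r - y (0 - l / k)))
          * Q (log_depth r - l / k)) / (r * exp (log_depth r))"
        by (rule Sl(2)) (use Kr[OF that] in auto)
      then show ?thesis by (simp only: P1_def X_def A_def fst_conv snd_conv)
    qed
    moreover have R1': "P1 (r, ((yy, k), yy)) = rderiv U r" if "r \<in> K" for r
    proof -
      have "rderiv U r = - (b * exp (m * (yy + k * log_depth r - yy)) * k) / (r * exp (log_depth r))"
        by (rule SU(2)) (use Kr[OF that] in auto)
      then show ?thesis by (simp only: P1_def X_def fst_conv snd_conv)
    qed
    ultimately have 1: "uniform_limit K (\<lambda>l. rderiv (curve_profile y l)) (rderiv U) at_top"
      by (simp cong: uniform_limit_cong')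
    have "uniform_limit K (\<lambda>l r. P2 (r, A l r)) (\<lambda>r. P2 (r, ((yy, k), yy))) at_top"
      by (rule uniform_limit_continuous_image[OF _ A P2]) (use K in auto)
    moreover have "P2 (r, A l r) = rderiv (rderiv (curve_profile y l)) r" if "r \<in> K" for l r
    proof -
      have "rderiv (rderiv (curve_profile y l)) r = - rderiv (curve_profile y l) r / r
          - curve_lam y l * Vk k r * exp ((1 + m) * (y (log_depth r - l / k) + k * log_depth r - y (0 - l / k)))"
        by (rule Sl(3)) (use Kr[OF that] in auto)
      then show ?thesis
        unfolding R1[OF that, symmetric] laml Vk_log_depth[OF Kr[OF that]]
        by (simp only: P2_def X_def A_def fst_conv snd_conv)
    qed
    moreover have "P2 (r, ((yy, k), yy)) = rderiv (rderiv U) r" if "r \<in> K" for r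
    proof -
      have "rderiv (rderiv U) r = - rderiv U r / r
          - (b * ?H) * Vk k r * exp ((1 + m) * (yy + k * log_depth r - yy))"
        by (rule SU(3)) (use Kr[OF that] in auto)
      then show ?thesis
        unfolding R1'[OF that, symmetric] lamU Vk_log_depth[OF Kr[OF that]]
        by (simp only: P2_def X_def fst_conv snd_conv)
    qed
    ultimately have 2: "uniform_limit K (\<lambda>l. rderiv (rderiv (curve_profile y l))) (rderiv (rderiv U)) at_top"
      by (simp cong: uniform_limit_cong')
    show "uniform_limit K (curve_profile y) U at_top \<and>
        uniform_limit K (\<lambda>l. rderiv (curve_profile y l)) (rderiv U) at_top \<and>
        uniform_limit K (\<lambda>l. rderiv (rderiv (curve_profile y l))) (rderiv (rderiv U)) at_top"
      using 0 1 2 by simp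
  qed
qed

end

section \<open>The space \<open>H\<^sup>1\<^sub>0\<close>\<close>

text \<open>For \<open>i = 0\<close> this is the classical smooth function that is flat at
  \<open>0\<close>; the other members carry the powers of \<open>1 / x\<close> that its derivatives
  produce.\<close>

definition bump :: "nat \<Rightarrow> real \<Rightarrow> real" where
  "bump i x = (if 0 < x then inverse x ^ i * exp (- inverse x) else 0)"

lemma bump_tendsto_0: "(bump i \<longlongrightarrow> 0) (at 0)"
proof (rule filterlim_split_at)
  show "(bump i \<longlongrightarrow> 0) (at_left 0)"
    by (rule Lim_transform_eventually[OF tendsto_const])
      (auto simp: bump_def eventually_at_left_field intro!: exI[of _ "-1"])
  have "((\<lambda>x. inverse x ^ i / exp (inverse x)) \<longlongrightarrow> (0::real)) (at_right 0)"
    by (rule filterlim_compose[OF tendsto_power_div_exp_0 filterlim_inverse_at_top_right])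
  then show "(bump i \<longlongrightarrow> 0) (at_right 0)"
    by (rule Lim_transform_eventually)
      (auto simp: bump_def exp_minus divide_inverse eventually_at_right_field intro!: exI[of _ 1])
qed

lemma inverse_power_deriv:
  fixes x :: real
  assumes "x \<noteq> 0"
  shows "((\<lambda>x. inverse x ^ i) has_real_derivative - (real i * inverse x ^ (i + 1))) (at x)"
proof (induction i)
  case (Suc i)
  have "((\<lambda>x. inverse x * inverse x ^ i) has_real_derivative
      - (inverse x ^ Suc (Suc 0)) * inverse x ^ i + - (real i * inverse x ^ (i + 1)) * inverse x) (at x)"
    by (rule DERIV_mult[OF DERIV_inverse[OF assms] Suc])
  then show ?case by (simp add: algebra_simps)
qed simp

text \<open>At \<open>0\<close> the difference quotient of \<open>bump i\<close> is
  \<open>bump (i + 1)\<close>, which tends to \<open>0\<close>.\<close>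

lemma bump_deriv:
  "(bump i has_real_derivative bump (i + 2) x - real i * bump (i + 1) x) (at x)"
proof -
  consider "x < 0" | "x = 0" | "0 < x" by linarith
  then show ?thesis
  proof cases
    case 1
    have "((\<lambda>_. 0) has_real_derivative 0) (at x)" by simp
    then have "(bump i has_real_derivative 0) (at x)"
      by (rule has_field_derivative_transform_within_open[of _ _ _ "{..<0}"])
        (use 1 in \<open>auto simp: bump_def\<close>)
    then show ?thesis using 1 by (simp add: bump_def)
  next
    case 2
    have "((\<lambda>h. (bump i (0 + h) - bump i 0) / h) \<longlongrightarrow> 0) (at 0)"
      by (rule Lim_transform_eventually[OF bump_tendsto_0[of "Suc i"]])
        (auto simp: bump_def eventually_at_filter divide_inverse)
    then show ?thesis using 2 by (simp add: DERIV_def bump_def)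
  next
    case 3
    have "((\<lambda>x. inverse x ^ i) has_real_derivative - (real i * inverse x ^ (i + 1))) (at x)"
      using 3 by (intro inverse_power_deriv) simp
    moreover have "((\<lambda>x. exp (- inverse x)) has_real_derivative inverse x ^ 2 * exp (- inverse x)) (at x)"
      using 3 by (auto intro!: derivative_eq_intros simp: power2_eq_square)
    ultimately have "((\<lambda>x. inverse x ^ i * exp (- inverse x)) has_real_derivative
        - (real i * inverse x ^ (i + 1)) * exp (- inverse x) + inverse x ^ 2 * exp (- inverse x) * inverse x ^ i) (at x)"
      by (rule DERIV_mult)
    then have "(bump i has_real_derivative
        - (real i * inverse x ^ (i + 1)) * exp (- inverse x) + inverse x ^ 2 * exp (- inverse x) * inverse x ^ i) (at x)"
      by (rule has_field_derivative_transform_within_open[of _ _ _ "{0<..}"])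
        (use 3 in \<open>auto simp: bump_def\<close>)
    then show ?thesis using 3 by (simp add: bump_def power2_eq_square algebra_simps)
  qed
qed

lemma bump_nonneg: "0 \<le> bump i x" and bump_0_le: "bump 0 x \<le> 1"
  by (auto simp: bump_def)

lemma bump_0_at_top: "filterlim g at_top F \<Longrightarrow> ((\<lambda>n. bump 0 (g n)) \<longlongrightarrow> 1) F"
proof -
  assume g: "filterlim g at_top F"
  have "((\<lambda>n. exp (- inverse (g n))) \<longlongrightarrow> exp (- 0)) F"
    by (intro tendsto_intros filterlim_compose[OF tendsto_inverse_0_at_top g]) (rule filterlim_ident)
  moreover have "\<forall>\<^sub>F n in F. exp (- inverse (g n)) = bump 0 (g n)"
    using filterlim_at_top_dense[THEN iffD1, OF g, rule_format, of 0]
    by eventually_elim (simp add: bump_def)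
  ultimately show ?thesis using Lim_transform_eventually by fastforce
qed

text \<open>The exponents make the family closed, up to linear combinations, under differentiation in \<open>q\<close>,
  which stands for the squared radius; this reduces smoothness of the test functions to continuity.\<close>

definition cutoff :: "nat \<Rightarrow> nat \<Rightarrow> nat \<Rightarrow> real \<Rightarrow> nat \<Rightarrow> real \<Rightarrow> real" where
  "cutoff n i j a d q = (1 - ln q / 2) powr a * inverse q ^ d * (bump i (real n * q - 1) * bump j (real n - 1 - real n * q))"

lemma cutoff_eq_0:
  assumes "real n * q \<le> 1 \<or> real n - 1 \<le> real n * q"
  shows "cutoff n i j a d q = 0"
  using assms by (auto simp: cutoff_def bump_def)

text \<open>The cutoff lives on \<open>1/n < q < 1 - 1/n\<close>. The outer regions are open and
  trivial. On the closed remainder, end points included, \<open>q\<close> lies in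
  \<open>(0,1]\<close>, so the power and logarithm factors are differentiable, and the bumps are
  differentiable everywhere.\<close>

lemma cutoff_deriv:
  assumes n: "0 < n"
  shows "(cutoff n i j a d has_real_derivative
      - (a / 2) * cutoff n i j (a - 1) (d + 1) q - real d * cutoff n i j a (d + 1) q
      + n * (cutoff n (i + 2) j a d q - real i * cutoff n (i + 1) j a d q)
      - n * (cutoff n i (j + 2) a d q - real j * cutoff n i (j + 1) a d q)) (at q)"
proof -
  consider "real n * q < 1" | "real n - 1 < real n * q" | "1 \<le> real n * q" "real n * q \<le> real n - 1" by linarith
  then show ?thesis
  proof cases
    case 1
    have "((\<lambda>_. 0) has_real_derivative 0) (at q)" by simp
    then have "(cutoff n i j a d has_real_derivative 0) (at q)"
      by (rule has_field_derivative_transform_within_open[of _ _ _ "{q. real n * q < 1}"])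
        (use 1 in \<open>auto simp: cutoff_eq_0 intro!: open_Collect_less continuous_intros\<close>)
    then show ?thesis using 1 by (simp add: cutoff_eq_0)
  next
    case 2
    have "((\<lambda>_. 0) has_real_derivative 0) (at q)" by simp
    then have "(cutoff n i j a d has_real_derivative 0) (at q)"
      by (rule has_field_derivative_transform_within_open[of _ _ _ "{q. real n - 1 < real n * q}"])
        (use 2 in \<open>auto simp: cutoff_eq_0 intro!: open_Collect_less continuous_intros\<close>)
    then show ?thesis using 2 by (simp add: cutoff_eq_0)
  next
    case 3
    have q: "0 < q" using 3(1) n by (smt (verit) mult_nonneg_nonpos of_nat_0_le_iff)
    have "real n * q \<le> real n * 1" using 3(2) by linarith
    then have "q \<le> 1" using n by (simp only: mult_le_cancel_left_pos of_nat_0_less_iff)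
    then have "ln q \<le> 0" using q by simp
    then have t: "0 < 1 - ln q / 2" by linarith
    have 1: "((\<lambda>q. (1 - ln q / 2) powr a) has_real_derivative - (a / 2) * ((1 - ln q / 2) powr (a - 1) * inverse q)) (at q)"
    proof -
      have "((\<lambda>q. 1 - ln q / 2) has_real_derivative - (inverse q / 2)) (at q)"
        by (rule DERIV_cong[OF DERIV_diff[OF DERIV_const DERIV_cdivide[OF DERIV_ln[OF q]]]]) simp
      from DERIV_chain2[where f = "\<lambda>z. z powr a", OF has_real_derivative_powr[OF t] this]
      show ?thesis by (simp add: mult_ac)
    qed
    have 2: "((\<lambda>q. inverse q ^ d) has_real_derivative - (real d * inverse q ^ (d + 1))) (at q)"
      using q by (intro inverse_power_deriv) simp
    have l1: "((\<lambda>q. real n * q - 1) has_real_derivative real n) (at q)"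
      and l2: "((\<lambda>q. real n - 1 - real n * q) has_real_derivative - real n) (at q)"
      by (auto intro!: derivative_eq_intros)
    have 3: "((\<lambda>q. bump i (real n * q - 1)) has_real_derivative (bump (i + 2) (real n * q - 1) - real i * bump (i + 1) (real n * q - 1)) * n) (at q)"
      by (rule DERIV_chain2[OF bump_deriv l1])
    have 4: "((\<lambda>q. bump j (real n - 1 - real n * q)) has_real_derivative (bump (j + 2) (real n - 1 - real n * q) - real j * bump (j + 1) (real n - 1 - real n * q)) * (- real n)) (at q)"
      by (rule DERIV_chain2[OF bump_deriv l2])
    show ?thesis
      unfolding cutoff_def[abs_def]
      by (rule DERIV_cong[OF DERIV_mult[OF DERIV_mult[OF 1 2] DERIV_mult[OF 3 4]]])
        (simp add: algebra_simps)
  qed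
qed

section \<open>Smoothness of radial functions on the plane\<close>

lemma Ck_plane_differentiable: "Ck_plane (Suc n) u \<Longrightarrow> u differentiable (at x)"
  by (simp add: differentiable_on_def)

lemma Ck_plane_Suc: "Ck_plane (Suc n) u \<Longrightarrow> Ck_plane n u"
  by (induction n arbitrary: u) (auto simp: differentiable_imp_continuous_on)

lemma has_derivative_frechet: "u differentiable (at x) \<Longrightarrow> (u has_derivative frechet_derivative u (at x)) (at x)"
  by (simp add: frechet_derivative_works)

lemma Ck_plane_add: "Ck_plane n u \<Longrightarrow> Ck_plane n v \<Longrightarrow> Ck_plane n (\<lambda>x. u x + v x)"
proof (induction n arbitrary: u v)
  case 0
  then show ?case by (auto intro: continuous_intros)
next
  case (Suc n)
  have d: "u differentiable (at x)" "v differentiable (at x)" for x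
    using Suc.prems Ck_plane_differentiable by blast+
  have "partial_deriv i (\<lambda>x. u x + v x) = (\<lambda>x. partial_deriv i u x + partial_deriv i v x)" for i
    by (rule ext, subst partial_deriv_eqI[OF has_derivative_add[OF has_derivative_frechet has_derivative_frechet]])
      (auto simp: d partial_deriv_def)
  then show ?case using Suc by (auto simp: differentiable_on_def d intro!: differentiable_add)
qed

lemma Ck_plane_cmult: "Ck_plane n u \<Longrightarrow> Ck_plane n (\<lambda>x. c * u x)"
proof (induction n arbitrary: u)
  case 0
  then show ?case by (auto intro: continuous_intros)
next
  case (Suc n)
  have d: "u differentiable (at x)" for x
    using Suc.prems Ck_plane_differentiable by blast
  have "partial_deriv i (\<lambda>x. c * u x) = (\<lambda>x. c * partial_deriv i u x)" for i
    by (rule ext, subst partial_deriv_eqI[OF has_derivative_mult_right[OF has_derivative_frechet]])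
      (auto simp: d partial_deriv_def)
  then show ?case using Suc by (auto simp: differentiable_on_def d intro!: differentiable_mult)
qed

lemma has_derivative_nth: "((\<lambda>x::real^2. x $ i) has_derivative (\<lambda>h. h $ i)) F"
  by (rule bounded_linear.has_derivative[OF bounded_linear_vec_nth has_derivative_ident])

text \<open>A partial derivative of a function of \<open>x \<bullet> x\<close> is a coordinate times
  another such function, so smoothness is inherited through this product.\<close>

lemma Ck_plane_coord_mult: "Ck_plane n u \<Longrightarrow> Ck_plane n (\<lambda>x. x $ i * u x)"
proof (induction n arbitrary: u)
  case 0
  then show ?case by (auto intro!: continuous_intros)
next
  case (Suc n)
  have d: "u differentiable (at x)" for x
    using Suc.prems Ck_plane_differentiable by blast
  have D: "((\<lambda>x. x $ i * u x) has_derivative (\<lambda>h. x $ i * frechet_derivative u (at x) h + h $ i * u x)) (at x)" for x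
    by (rule has_derivative_mult[OF has_derivative_nth has_derivative_frechet[OF d]])
  have "partial_deriv j (\<lambda>x. x $ i * u x) = (\<lambda>x. x $ i * partial_deriv j u x + (axis j 1 :: real^2) $ i * u x)" for j
    by (rule ext, subst partial_deriv_eqI[OF D]) (auto simp: partial_deriv_def)
  moreover have "(\<lambda>x. x $ i * u x) differentiable_on UNIV"
    using D by (auto simp: differentiable_on_def differentiable_def)
  moreover have "Ck_plane n (\<lambda>x. x $ i * partial_deriv j u x + (axis j 1 :: real^2) $ i * u x)" for j
    using Suc by (intro Ck_plane_add Ck_plane_cmult Suc.IH Ck_plane_Suc[OF Suc.prems]) auto
  ultimately show ?case by simp
qed

lemma has_derivative_inner_self:
  fixes x :: "real^2"
  assumes "(F has_real_derivative D) (at (x \<bullet> x))"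
  shows "((\<lambda>x. F (x \<bullet> x)) has_derivative (\<lambda>h. D * (2 * (x \<bullet> h)))) (at x)"
proof -
  have "((\<lambda>x::real^2. x \<bullet> x) has_derivative (\<lambda>h. x \<bullet> h + h \<bullet> x)) (at x)"
    by (auto intro!: derivative_eq_intros)
  then have 1: "((\<lambda>x::real^2. x \<bullet> x) has_derivative (\<lambda>h. 2 * (x \<bullet> h))) (at x)"
    by (simp add: inner_commute)
  have "(F has_derivative (\<lambda>h. D * h)) (at (x \<bullet> x))"
    using assms by (simp add: has_field_derivative_def)
  from has_derivative_compose[OF 1 this] show ?thesis .
qed

lemma partial_deriv_inner_self:
  fixes x :: "real^2"
  assumes "(F has_real_derivative D) (at (x \<bullet> x))"
  shows "partial_deriv i (\<lambda>x. F (x \<bullet> x)) x = x $ i * (2 * D)"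
  using partial_deriv_eqI[OF has_derivative_inner_self[OF assms]] by (simp add: inner_axis)

lemma Ck_plane_inner_self_Suc:
  assumes F: "\<And>q. 0 \<le> q \<Longrightarrow> (F has_real_derivative D q) (at q)" and D: "Ck_plane n (\<lambda>x. D (x \<bullet> x))"
  shows "Ck_plane (Suc n) (\<lambda>x::real^2. F (x \<bullet> x))"
proof -
  have "partial_deriv i (\<lambda>x::real^2. F (x \<bullet> x)) = (\<lambda>x. x $ i * (2 * D (x \<bullet> x)))" for i
    by (rule ext, rule partial_deriv_inner_self[OF F]) simp
  then show ?thesis
    using D has_derivative_inner_self[OF F]
    by (auto simp: differentiable_on_def differentiable_def intro!: Ck_plane_coord_mult Ck_plane_cmult)
qed

lemma Ck_plane_cutoff:
  assumes "0 < n"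
  shows "Ck_plane N (\<lambda>x. cutoff n i j a d (x \<bullet> x))"
proof (induction N arbitrary: i j a d)
  case 0
  have "continuous_on UNIV (cutoff n i j a d)"
    by (intro continuous_at_imp_continuous_on ballI DERIV_isCont[OF cutoff_deriv[OF assms]])
  then show ?case by (auto intro!: continuous_on_compose2[of UNIV "cutoff n i j a d"] continuous_intros)
next
  case (Suc N)
  show ?case
  proof (rule Ck_plane_inner_self_Suc[OF cutoff_deriv[OF assms]])
    have "Ck_plane N (\<lambda>x. (- (a / 2)) * cutoff n i j (a - 1) (d + 1) (x \<bullet> x)
      + ((- real d) * cutoff n i j a (d + 1) (x \<bullet> x)
      + (n * (cutoff n (i + 2) j a d (x \<bullet> x) + (- real i) * cutoff n (i + 1) j a d (x \<bullet> x))
      + (- real n) * (cutoff n i (j + 2) a d (x \<bullet> x) + (- real j) * cutoff n i (j + 1) a d (x \<bullet> x)))))"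
      by (intro Ck_plane_add Ck_plane_cmult Suc.IH)
    then show "Ck_plane N (\<lambda>x. - (a / 2) * cutoff n i j (a - 1) (d + 1) (x \<bullet> x) - real d * cutoff n i j a (d + 1) (x \<bullet> x)
      + n * (cutoff n (i + 2) j a d (x \<bullet> x) - real i * cutoff n (i + 1) j a d (x \<bullet> x))
      - n * (cutoff n i (j + 2) a d (x \<bullet> x) - real j * cutoff n i (j + 1) a d (x \<bullet> x)))"
      by (simp add: algebra_simps)
  qed
qed

lemma partial_deriv_locally_0:
  assumes "open S" "x \<in> S" "\<And>y. y \<in> S \<Longrightarrow> u y = 0"
  shows "partial_deriv i u x = 0"
proof -
  have "(u has_derivative (\<lambda>_. 0)) (at x)"
    by (rule has_derivative_transform_within_open[OF has_derivative_const assms(1,2)]) (use assms(3) in auto)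
  then show ?thesis by (simp add: partial_deriv_eqI)
qed

section \<open>Integration by parts and polar coordinates\<close>

lemma integrable_compact_support:
  fixes u :: "real^2 \<Rightarrow> real"
  assumes "continuous_on UNIV u" "\<And>x. 1 < norm x \<Longrightarrow> u x = 0"
  shows "integrable lborel u"
proof -
  have "integrable lborel (\<lambda>x. indicator (cball 0 1) x *\<^sub>R u x)"
    by (intro borel_integrable_compact compact_cball continuous_on_subset[OF assms(1)]) auto
  moreover have "(\<lambda>x. indicator (cball 0 1) x *\<^sub>R u x) = u"
    using assms(2) by (auto simp: indicator_def fun_eq_iff)
  ultimately show ?thesis by simp
qed

lemma continuous_compact_support_bounded:
  fixes u :: "real^2 \<Rightarrow> real"
  assumes "continuous_on UNIV u" "\<And>x. 1 < norm x \<Longrightarrow> u x = 0"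
  obtains M where "0 \<le> M" "\<And>x. \<bar>u x\<bar> \<le> M"
proof -
  have "bounded (u ` cball 0 1)"
    by (intro compact_imp_bounded compact_continuous_image continuous_on_subset[OF assms(1)]) auto
  then obtain M where "\<forall>z\<in>u ` cball 0 1. norm z \<le> M" unfolding bounded_iff by blast
  then have M: "\<bar>u x\<bar> \<le> M" if "norm x \<le> 1" for x using that by simp
  then have "\<bar>u x\<bar> \<le> max M 0" for x
    using assms(2)[of x] M[of x] by (cases "norm x \<le> 1") (auto simp: le_max_iff_disj)
  then show thesis using that[of "max M 0"] by auto
qed

text \<open>The difference quotients integrate to zero by translation invariance.\<close>

lemma integral_partial_deriv_eq_0:
  fixes u :: "real^2 \<Rightarrow> real"
  assumes C1: "Ck_plane (Suc 0) u" and supp: "\<And>x. 1 < norm x \<Longrightarrow> u x = 0"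
  shows "integral\<^sup>L lborel (partial_deriv i u) = 0"
proof -
  define e :: "real^2" where "e = axis i 1"
  define P where "P = partial_deriv i u"
  have e: "norm e = 1" by (simp add: e_def norm_axis_1)
  have ucont: "continuous_on UNIV u" using Ck_plane_Suc[OF C1] by simp
  have Pcont: "continuous_on UNIV P" using C1 by (simp add: P_def)
  have Psupp: "P x = 0" if "1 < norm x" for x
    unfolding P_def
    by (rule partial_deriv_locally_0[of "{x. 1 < norm x}"])
      (use that supp in \<open>auto intro!: open_Collect_less continuous_intros\<close>)
  obtain M where M: "0 \<le> M" "\<And>x. \<bar>P x\<bar> \<le> M"
    using continuous_compact_support_bounded[OF Pcont Psupp] by blast
  have line: "((\<lambda>s. u (x + s *\<^sub>R e)) has_real_derivative P (x + s *\<^sub>R e)) (at s)" for x s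
  proof -
    have "((\<lambda>s. x + s *\<^sub>R e) has_derivative (\<lambda>h. h *\<^sub>R e)) (at s)"
      by (auto intro!: derivative_eq_intros)
    from has_derivative_compose[OF this has_derivative_frechet[OF Ck_plane_differentiable[OF C1]]]
    have "((\<lambda>s. u (x + s *\<^sub>R e)) has_derivative (\<lambda>h. frechet_derivative u (at (x + s *\<^sub>R e)) (h *\<^sub>R e))) (at s)" .
    moreover have "frechet_derivative u (at y) (h *\<^sub>R e) = P y * h" for y h
      using linear_frechet_derivative[OF Ck_plane_differentiable[OF C1], of y]
      by (simp add: linear_scale P_def partial_deriv_def e_def)
    ultimately show ?thesis by (simp add: has_field_derivative_def)
  qed
  define D where "D = (\<lambda>n x. (u (x + inverse (real (Suc n)) *\<^sub>R e) - u x) / inverse (real (Suc n)))"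
  have Dlim: "(\<lambda>n. D n x) \<longlonglongrightarrow> P x" for x
  proof -
    have "((\<lambda>h. (u (x + (0 + h) *\<^sub>R e) - u (x + 0 *\<^sub>R e)) / h) \<longlongrightarrow> P (x + 0 *\<^sub>R e)) (at 0)"
      using line[of x 0] by (simp only: DERIV_def)
    moreover have "filterlim (\<lambda>n. inverse (real (Suc n))) (at 0) sequentially"
      unfolding filterlim_at using LIMSEQ_inverse_real_of_nat by simp
    ultimately have "((\<lambda>n. (u (x + (0 + inverse (real (Suc n))) *\<^sub>R e) - u (x + 0 *\<^sub>R e)) / inverse (real (Suc n))) \<longlongrightarrow> P (x + 0 *\<^sub>R e)) sequentially"
      by (rule filterlim_compose)
    then show ?thesis by (simp add: D_def)
  qed
  \<comment> \<open>The quotients shift by at most \<open>1\<close>, so the ball of radius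
    \<open>2\<close> contains all their supports.\<close>
  have Dbound: "\<bar>D n x\<bar> \<le> M * indicator (cball 0 2) x" for n x
  proof (cases "norm x \<le> 2")
    case True
    define h where "h = inverse (real (Suc n))"
    have h: "0 < h" by (simp add: h_def)
    obtain z where "u (x + h *\<^sub>R e) - u (x + 0 *\<^sub>R e) = (h - 0) * P (x + z *\<^sub>R e)"
      using MVT2[OF h, of "\<lambda>s. u (x + s *\<^sub>R e)" "\<lambda>s. P (x + s *\<^sub>R e)"] line by blast
    then have "D n x = P (x + z *\<^sub>R e)" using h by (simp add: D_def h_def field_simps)
    then show ?thesis using M True by simp
  next
    case False
    have "inverse (real (Suc n)) \<le> 1" by (simp add: inverse_le_1_iff)
    then have "norm (inverse (real (Suc n)) *\<^sub>R e) \<le> 1" using e by simp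
    then have "1 < norm (x + inverse (real (Suc n)) *\<^sub>R e)"
      using False norm_triangle_ineq4[of "x + inverse (real (Suc n)) *\<^sub>R e" "inverse (real (Suc n)) *\<^sub>R e"] by simp
    then show ?thesis using False supp by (simp add: D_def)
  qed
  have um: "u \<in> borel_measurable borel" using ucont by (rule borel_measurable_continuous_onI)
  have ui: "integrable lborel u" by (rule integrable_compact_support[OF ucont supp])
  have shift: "integral\<^sup>L lborel (\<lambda>x. u (x + y)) = integral\<^sup>L lborel u"
    "integrable lborel (\<lambda>x. u (x + y))" for y
  proof -
    have "integral\<^sup>L (distr lborel borel ((+) y)) u = integral\<^sup>L lborel (\<lambda>x. u (y + x))"
      by (rule integral_distr) (use um in auto)
    then show "integral\<^sup>L lborel (\<lambda>x. u (x + y)) = integral\<^sup>L lborel u"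
      by (simp add: lborel_distr_plus add.commute)
    have "integrable (distr lborel borel ((+) y)) u" using ui by (simp add: lborel_distr_plus)
    then have "integrable lborel (\<lambda>x. u (y + x))"
      by (subst (asm) integrable_distr_eq) (use um in auto)
    then show "integrable lborel (\<lambda>x. u (x + y))" by (simp add: add.commute)
  qed
  have D0: "integral\<^sup>L lborel (D n) = 0" for n
    unfolding D_def using shift ui by simp
  have "(\<lambda>n. integral\<^sup>L lborel (D n)) \<longlonglongrightarrow> integral\<^sup>L lborel P"
  proof (rule integral_dominated_convergence)
    show "P \<in> borel_measurable lborel"
      using borel_measurable_continuous_onI[OF Pcont] by simp
    show "D n \<in> borel_measurable lborel" for n
      unfolding D_def using um by measurable
    have "integrable lborel (\<lambda>x::real^2. indicator (cball 0 2) x *\<^sub>R M)"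
      by (intro borel_integrable_compact compact_cball continuous_intros)
    then show "integrable lborel (\<lambda>x::real^2. M * indicator (cball 0 2) x)"
      by (simp add: mult.commute)
  qed (use Dlim Dbound in auto)
  then show ?thesis by (simp add: D0 P_def LIMSEQ_const_iff)
qed

lemma gradient_inner: "gradient u x \<bullet> gradient v x = (\<Sum>i\<in>UNIV. partial_deriv i u x * partial_deriv i v x)"
  by (simp add: gradient_def inner_vec_def)

text \<open>\<open>v\<close> vanishes near the boundary and thus localises the products of
  \<open>u\<close> with its partial derivatives, while \<open>u\<close> is any \<open>C^1\<close>
  function. The same \<open>v\<close> can so be tested against a truncation and against an arbitrary
  test function.\<close>

lemma green_identity:
  fixes u v :: "real^2 \<Rightarrow> real"
  assumes u: "Ck_plane (Suc 0) u" and v: "Ck_plane (Suc (Suc 0)) v"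
    and r: "r < 1" and supp: "\<And>x. r < norm x \<Longrightarrow> v x = 0"
  shows "integrable lborel (\<lambda>x. gradient u x \<bullet> gradient v x)"
    and "integrable lborel (\<lambda>x. u x * laplacian v x)"
    and "integral\<^sup>L lborel (\<lambda>x. gradient u x \<bullet> gradient v x) = - integral\<^sup>L lborel (\<lambda>x. u x * laplacian v x)"
proof -
  have vi: "Ck_plane (Suc 0) (partial_deriv i v)" for i using v by simp
  have psupp: "partial_deriv i v x = 0" if "r < norm x" for i x
    by (rule partial_deriv_locally_0[of "{x. r < norm x}"])
      (use that supp in \<open>auto intro!: open_Collect_less continuous_intros\<close>)
  have ppsupp: "partial_deriv i (partial_deriv i v) x = 0" if "r < norm x" for i x
    by (rule partial_deriv_locally_0[of "{x. r < norm x}"])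
      (use that psupp in \<open>auto intro!: open_Collect_less continuous_intros\<close>)
  define W where "W = (\<lambda>i x. u x * partial_deriv i v x)"
  have uc: "continuous_on UNIV u" and pu: "continuous_on UNIV (partial_deriv i u)"
    and pv: "continuous_on UNIV (partial_deriv i v)"
    and ppv: "continuous_on UNIV (partial_deriv i (partial_deriv i v))" for i
    using u Ck_plane_Suc[OF u] vi[of i] Ck_plane_Suc[OF vi[of i]] by auto
  have D: "((\<lambda>x. u x * partial_deriv i v x) has_derivative
      (\<lambda>h. u x * frechet_derivative (partial_deriv i v) (at x) h + frechet_derivative u (at x) h * partial_deriv i v x)) (at x)" for i x
    by (intro has_derivative_mult has_derivative_frechet Ck_plane_differentiable[OF u] Ck_plane_differentiable[OF vi])
  have pW: "partial_deriv j (W i) = (\<lambda>x. u x * partial_deriv j (partial_deriv i v) x + partial_deriv j u x * partial_deriv i v x)" for i j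
    unfolding W_def by (rule ext, subst partial_deriv_eqI[OF D]) (simp add: partial_deriv_def)
  have "Ck_plane (Suc 0) (W i)" for i
  proof -
    have "W i differentiable_on UNIV"
      unfolding W_def using D by (auto simp: differentiable_on_def differentiable_def)
    moreover have "continuous_on UNIV (partial_deriv j (W i))" for j
      unfolding pW using vi[of i] by (intro continuous_intros uc pu pv) auto
    ultimately show ?thesis by simp
  qed
  then have 0: "integral\<^sup>L lborel (partial_deriv i (W i)) = 0" for i
    by (rule integral_partial_deriv_eq_0) (use psupp r in \<open>auto simp: W_def\<close>)
  have i1: "integrable lborel (\<lambda>x. partial_deriv i u x * partial_deriv i v x)" for i
    by (intro integrable_compact_support continuous_intros pu pv) (use psupp r in auto)
  have i2: "integrable lborel (\<lambda>x. u x * partial_deriv i (partial_deriv i v) x)" for i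
    by (intro integrable_compact_support continuous_intros uc ppv) (use ppsupp r in auto)
  have sums: "gradient u x \<bullet> gradient v x = (\<Sum>i\<in>UNIV. partial_deriv i u x * partial_deriv i v x)"
    "u x * laplacian v x = (\<Sum>i\<in>UNIV. u x * partial_deriv i (partial_deriv i v) x)" for x
    by (simp_all add: gradient_inner laplacian_def sum_distrib_left)
  show "integrable lborel (\<lambda>x. gradient u x \<bullet> gradient v x)"
    unfolding sums by (intro Bochner_Integration.integrable_sum i1)
  show "integrable lborel (\<lambda>x. u x * laplacian v x)"
    unfolding sums by (intro Bochner_Integration.integrable_sum i2)
  have "integral\<^sup>L lborel (\<lambda>x. partial_deriv i u x * partial_deriv i v x)
      = - integral\<^sup>L lborel (\<lambda>x. u x * partial_deriv i (partial_deriv i v) x)" for i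
    using 0[of i] unfolding pW by (simp add: i1 i2)
  then show "integral\<^sup>L lborel (\<lambda>x. gradient u x \<bullet> gradient v x) = - integral\<^sup>L lborel (\<lambda>x. u x * laplacian v x)"
    unfolding sums by (simp add: i1 i2 sum_negf)
qed

text \<open>Finite measures on the line are determined by their values on the rays above
  \<open>a\<close>; there both sides give the area of an annulus.\<close>

lemma nn_integral_radial:
  fixes f :: "real \<Rightarrow> ennreal"
  assumes f: "f \<in> borel_measurable borel"
  shows "(\<integral>\<^sup>+x. f (norm x) * indicator B1 x \<partial>(lborel :: (real^2) measure))
    = (\<integral>\<^sup>+r. f r * (ennreal (2 * pi * r) * indicator {0<..<1} r) \<partial>lborel)"
proof -
  have I: "(indicator B1 :: real^2 \<Rightarrow> ennreal) \<in> borel_measurable borel"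
    by (rule borel_measurable_indicator) simp
  define M where "M = distr (density lborel (indicator B1)) borel (norm :: real^2 \<Rightarrow> real)"
  define N where "N = density lborel (\<lambda>r::real. ennreal (2 * pi * r) * indicator {0<..<1} r)"
  have area: "emeasure lborel (ball (0::real^2) r) = ennreal (pi * r\<^sup>2)"
    "emeasure lborel (cball (0::real^2) r) = ennreal (pi * r\<^sup>2)" if "0 \<le> r" for r
    using that by (simp_all add: emeasure_ball emeasure_cball unit_ball_vol_2)
  have M: "emeasure M {a<..} = ennreal (pi * (1 - (max a 0)\<^sup>2))" if a: "a < 1" for a
  proof -
    have "emeasure M {a<..} = emeasure (density lborel (indicator B1)) {x::real^2. a < norm x}"
      unfolding M_def by (subst emeasure_distr) (auto simp: vimage_def)
    also have "\<dots> = (\<integral>\<^sup>+x. indicator B1 x * indicator {x::real^2. a < norm x} x \<partial>lborel)"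
      by (rule emeasure_density) (use I in auto)
    also have "\<dots> = (\<integral>\<^sup>+x. indicator (B1 \<inter> {x::real^2. a < norm x}) x \<partial>lborel)"
      by (intro nn_integral_cong) (auto simp: indicator_def)
    also have "\<dots> = emeasure lborel (B1 \<inter> {x::real^2. a < norm x})"
      by (rule nn_integral_indicator) auto
    also have "\<dots> = ennreal (pi * (1 - (max a 0)\<^sup>2))"
    proof (cases "a < 0")
      case True
      then have "B1 \<inter> {x::real^2. a < norm x} = B1" by (auto intro: less_le_trans)
      then show ?thesis using True area(1)[of 1] by simp
    next
      case False
      then have "B1 \<inter> {x::real^2. a < norm x} = B1 - cball 0 a" by auto
      moreover have "emeasure lborel (B1 - cball (0::real^2) a) = emeasure lborel B1 - emeasure lborel (cball (0::real^2) a)"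
        by (rule emeasure_Diff) (use a False area(2)[of a] in auto)
      moreover have "a\<^sup>2 \<le> 1" using a False by (simp add: power_le_one)
      ultimately show ?thesis using False area(1)[of 1] area(2)[of a]
        by (simp add: ennreal_minus right_diff_distrib)
    qed
    finally show ?thesis .
  qed
  have M1: "emeasure M {a<..} = 0" if a: "1 \<le> a" for a
  proof -
    have "emeasure M {a<..} = emeasure (density lborel (indicator B1)) {x::real^2. a < norm x}"
      unfolding M_def by (subst emeasure_distr) (auto simp: vimage_def)
    also have "\<dots> = (\<integral>\<^sup>+x. indicator B1 x * indicator {x::real^2. a < norm x} x \<partial>lborel)"
      by (rule emeasure_density) (use I in auto)
    also have "\<dots> = (\<integral>\<^sup>+x. 0 \<partial>(lborel :: (real^2) measure))"
      by (intro nn_integral_cong) (use a in \<open>auto simp: indicator_def\<close>)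
    finally show ?thesis by simp
  qed
  have N: "emeasure N {a<..} = ennreal (pi * (1 - (max a 0)\<^sup>2))" if a: "a < 1" for a
  proof -
    have "emeasure N {a<..} = (\<integral>\<^sup>+r. ennreal (2 * pi * r) * indicator {0<..<1} r * indicator {a<..} r \<partial>lborel)"
      unfolding N_def by (rule emeasure_density) auto
    also have "\<dots> = (\<integral>\<^sup>+r. ennreal (2 * pi * r) * indicator {max a 0..1} r \<partial>lborel)"
    proof (rule nn_integral_cong_AE)
      have "AE r in lborel. r \<notin> {max a 0, 1::real}"
        by (rule AE_not_in) (auto intro: finite_imp_null_set_lborel)
      then show "AE r in lborel. ennreal (2 * pi * r) * indicator {0<..<1} r * indicator {a<..} r
          = ennreal (2 * pi * r) * indicator {max a 0..1} r"
        by eventually_elim (auto simp: indicator_def max_def split: if_splits)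
    qed
    also have "\<dots> = ennreal (pi * 1\<^sup>2 - pi * (max a 0)\<^sup>2)"
      by (rule nn_integral_FTC_Icc) (use a in \<open>auto intro!: derivative_eq_intros simp: has_real_derivative_iff_has_vector_derivative[symmetric]\<close>)
    finally show ?thesis by (simp add: right_diff_distrib)
  qed
  have N1: "emeasure N {a<..} = 0" if a: "1 \<le> a" for a
  proof -
    have "emeasure N {a<..} = (\<integral>\<^sup>+r. ennreal (2 * pi * r) * indicator {0<..<1} r * indicator {a<..} r \<partial>lborel)"
      unfolding N_def by (rule emeasure_density) auto
    also have "\<dots> = (\<integral>\<^sup>+r. 0 \<partial>(lborel :: real measure))"
      by (intro nn_integral_cong) (use a in \<open>auto simp: indicator_def\<close>)
    finally show ?thesis by simp
  qed
  have "M = N"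
  proof (rule measure_eqI_lessThan)
    show "sets M = sets borel" "sets N = sets borel" by (simp_all add: M_def N_def)
    show "emeasure M {a<..} < \<infinity>" for a
      using M[of a] M1[of a] by (cases "a < 1") auto
    show "emeasure M {a<..} = emeasure N {a<..}" for a
      using M[of a] M1[of a] N[of a] N1[of a] by (cases "a < 1") auto
  qed
  then have "nn_integral M f = nn_integral N f" by simp
  moreover have "nn_integral M f = (\<integral>\<^sup>+x. f (norm x) * indicator B1 x \<partial>(lborel :: (real^2) measure))"
    unfolding M_def using f I
    by (subst nn_integral_distr, simp, simp, subst nn_integral_density) (auto simp: mult.commute)
  moreover have "nn_integral N f = (\<integral>\<^sup>+r. f r * (ennreal (2 * pi * r) * indicator {0<..<1} r) \<partial>lborel)"
    unfolding N_def using f by (subst nn_integral_density) (auto simp: mult.commute)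
  ultimately show ?thesis by simp
qed

lemma set_integrable_nn:
  fixes f :: "'a \<Rightarrow> real"
  assumes "set_integrable M A f" "\<And>x. x \<in> A \<Longrightarrow> 0 \<le> f x"
  shows "(\<integral>\<^sup>+x. ennreal (f x) * indicator A x \<partial>M) < \<infinity>"
proof -
  have "(\<integral>\<^sup>+x. ennreal (norm (indicator A x *\<^sub>R f x)) \<partial>M) < \<infinity>"
    using assms(1) by (simp add: set_integrable_def integrable_iff_bounded)
  also have "(\<integral>\<^sup>+x. ennreal (norm (indicator A x *\<^sub>R f x)) \<partial>M) = (\<integral>\<^sup>+x. ennreal (f x) * indicator A x \<partial>M)"
    by (intro nn_integral_cong) (use assms(2) in \<open>auto simp: indicator_def\<close>)
  finally show ?thesis .
qed

lemma set_integrable_radial: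
  fixes f :: "real \<Rightarrow> real"
  assumes f: "f \<in> borel_measurable borel" "\<And>r. 0 < r \<Longrightarrow> r < 1 \<Longrightarrow> 0 \<le> f r"
    and fin: "set_integrable lborel {0<..<1} (\<lambda>r. f r * r)"
  shows "set_integrable lebesgue B1 (\<lambda>x. f (norm x))"
proof -
  have "(\<lambda>x::real^2. f (norm x)) \<in> borel_measurable borel"
    by (rule measurable_compose[OF _ f(1)]) (intro borel_measurable_continuous_onI continuous_intros)
  then have m: "(\<lambda>x::real^2. indicator B1 x *\<^sub>R f (norm x)) \<in> borel_measurable borel"
    by (intro borel_measurable_scaleR borel_measurable_indicator) auto
  have "(\<integral>\<^sup>+x. ennreal (norm (indicator B1 x *\<^sub>R f (norm x))) \<partial>(lborel :: (real^2) measure))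
      = (\<integral>\<^sup>+x. ennreal \<bar>f (norm x)\<bar> * indicator B1 x \<partial>(lborel :: (real^2) measure))"
    by (intro nn_integral_cong) (auto simp: indicator_def)
  also have "\<dots> = (\<integral>\<^sup>+r. ennreal \<bar>f r\<bar> * (ennreal (2 * pi * r) * indicator {0<..<1} r) \<partial>lborel)"
    by (rule nn_integral_radial) (use f in measurable)
  also have "\<dots> = (\<integral>\<^sup>+r. ennreal (2 * pi) * (ennreal (f r * r) * indicator {0<..<1} r) \<partial>lborel)"
    by (intro nn_integral_cong) (use f(2) in \<open>auto simp: indicator_def ennreal_mult' mult_ac simp flip: ennreal_mult'\<close>)
  also have "\<dots> = ennreal (2 * pi) * (\<integral>\<^sup>+r. ennreal (f r * r) * indicator {0<..<1} r \<partial>lborel)"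
    by (rule nn_integral_cmult) (use f(1) in measurable)
  also have "\<dots> < \<infinity>"
    using set_integrable_nn[OF fin] f(2) by (auto simp: ennreal_mult_less_top)
  finally have "integrable lborel (\<lambda>x::real^2. indicator B1 x *\<^sub>R f (norm x))"
    using m by (simp add: integrable_iff_bounded)
  then show ?thesis
    unfolding set_integrable_def using m by (subst integrable_completion) auto
qed

lemma lebesgue_measurableI:
  "f \<in> borel_measurable borel \<Longrightarrow> f \<in> borel_measurable lebesgue" for f :: "real^2 \<Rightarrow> 'b::euclidean_space"
  by (rule measurable_completion) simp

lemma AE_lebesgue_neq_0: "AE x in lebesgue. x \<noteq> (0::real^2)"
proof -
  have "AE x in lborel. x \<notin> {0::real^2}"
    by (rule AE_not_in) (auto intro: finite_imp_null_set_lborel)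
  then show ?thesis by (intro AE_completion) auto
qed

text \<open>A singular profile has an arbitrary value at the origin, which the indicator of one
  point accounts for.\<close>

lemma punctured_ball_measurable:
  fixes f :: "real^2 \<Rightarrow> 'b::euclidean_space"
  assumes "continuous_on (B1 - {0}) f"
  shows "set_borel_measurable lebesgue B1 f"
proof -
  have "(\<lambda>x. indicator (B1 - {0}) x *\<^sub>R f x) \<in> borel_measurable borel"
    by (rule borel_measurable_continuous_on_indicator[OF _ assms]) auto
  moreover have "(\<lambda>x::real^2. indicator {0} x *\<^sub>R f 0) \<in> borel_measurable borel"
    by (intro borel_measurable_scaleR borel_measurable_indicator borel_measurable_const) auto
  ultimately have "(\<lambda>x. indicator (B1 - {0}) x *\<^sub>R f x + indicator {0} x *\<^sub>R f 0) \<in> borel_measurable borel"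
    by (rule borel_measurable_add)
  moreover have "(\<lambda>x. indicator (B1 - {0}) x *\<^sub>R f x + indicator {0} x *\<^sub>R f 0) = (\<lambda>x. indicator B1 x *\<^sub>R f x)"
    by (auto simp: indicator_def fun_eq_iff)
  ultimately show ?thesis
    unfolding set_borel_measurable_def by (intro lebesgue_measurableI) simp
qed

section \<open>Truncations of a singular profile\<close>

text \<open>With \<open>t = 1 - ln r\<close>, the profile \<open>k ln t\<close> has
  \<open>c = k\<close> and \<open>e = - 1\<close>, and \<open>t powr \<theta> - 1\<close> has
  \<open>c = \<theta>\<close> and \<open>e = \<theta> - 1\<close>. Growth at most linear in
  \<open>t\<close> is enough for square integrability.\<close>

locale log_profile =
  fixes c e C :: real and U :: "real \<Rightarrow> real"
  assumes c: "0 < c" and C: "0 \<le> C" and U1: "U 1 = 0"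
    and U_deriv: "\<And>r. 0 < r \<Longrightarrow> r \<le> 1 \<Longrightarrow> (U has_real_derivative - (c * (1 - ln r) powr e / r)) (at r)"
    and U_le: "\<And>r. 0 < r \<Longrightarrow> r \<le> 1 \<Longrightarrow> U r \<le> C * (1 - ln r)"
begin

text \<open>As a function of \<open>q = r^2\<close>, the profile has derivative
  \<open>- (c / 2) t powr e / q\<close>; this is that derivative times the cutoff.\<close>

definition slope :: "nat \<Rightarrow> real \<Rightarrow> real" where
  "slope n q = - (c / 2) * cutoff n 0 0 e 1 q"

text \<open>The derivative is truncated and integrated back from the boundary, so the gradient is
  \<open>kap\<close> times \<open>gradU\<close>, with no derivative of the cutoff in it. The base
  point \<open>- 1\<close> makes \<open>q = 0\<close> an interior point.\<close>

definition Phi :: "nat \<Rightarrow> real \<Rightarrow> real" where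
  "Phi n q = integral {-1..q} (slope n) - integral {-1..1} (slope n)"

definition kap :: "nat \<Rightarrow> real \<Rightarrow> real" where
  "kap n q = bump 0 (real n * q - 1) * bump 0 (real n - 1 - real n * q)"

definition gradU :: "real^2 \<Rightarrow> real^2" where
  "gradU x = (- (c * (1 - ln (norm x)) powr e / (norm x)\<^sup>2)) *\<^sub>R x"

lemma kap_bounds: "0 \<le> kap n q" "kap n q \<le> 1"
  unfolding kap_def by (intro mult_nonneg_nonneg mult_le_one bump_nonneg bump_0_le)+

lemma slope_kap:
  assumes "0 < r"
  shows "2 * slope n (r\<^sup>2) = - (c * (1 - ln r) powr e / r\<^sup>2) * kap n (r\<^sup>2)"
proof -
  have ln: "ln (r\<^sup>2) / 2 = ln r" using assms by (simp add: ln_realpow)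
  show ?thesis
    unfolding slope_def cutoff_def kap_def ln using assms by (simp add: field_simps)
qed

lemma slope_continuous: "0 < n \<Longrightarrow> continuous_on S (slope n)"
  unfolding slope_def
  by (intro continuous_intros continuous_at_imp_continuous_on ballI DERIV_isCont[OF cutoff_deriv])

lemma Phi_deriv:
  assumes n: "0 < n" and q: "-1 < q"
  shows "(Phi n has_real_derivative slope n q) (at q)"
proof -
  have "((\<lambda>q. integral {-1..q} (slope n)) has_real_derivative slope n q) (at q within {-1..q+1})"
    using q by (intro integral_has_real_derivative slope_continuous[OF n]) auto
  moreover have "at q within {-1..q+1} = at q" using q by (intro at_within_Icc_at) auto
  ultimately show ?thesis
    unfolding Phi_def[abs_def] by (auto intro!: derivative_eq_intros)
qed

lemma Phi_1 [simp]: "Phi n 1 = 0"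
  by (simp add: Phi_def)

lemma Phi_eq_0:
  assumes n: "0 < n" and q: "real n - 1 \<le> real n * q"
  shows "Phi n q = 0"
proof -
  have 0: "slope n z = 0" if "real n - 1 \<le> real n * z" for z
    using that by (simp add: slope_def cutoff_eq_0)
  have "0 < real n * (q + 1)" using q n by (simp add: distrib_left)
  then have q1: "-1 < q" using n by (simp add: zero_less_mult_iff)
  consider "q < 1" | "q = 1" | "1 < q" by linarith
  then show ?thesis
  proof cases
    case 1
    obtain z where "q < z" "z < 1" "Phi n 1 - Phi n q = (1 - q) * slope n z"
      using MVT2[OF 1, of "Phi n" "slope n"] Phi_deriv[OF n] q1 by fastforce
    moreover have "real n * q \<le> real n * z" using \<open>q < z\<close> by (intro mult_left_mono) auto
    ultimately show ?thesis using 0[of z] q by simp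
  next
    case 3
    obtain z where "1 < z" "z < q" "Phi n q - Phi n 1 = (q - 1) * slope n z"
      using MVT2[OF 3, of "Phi n" "slope n"] Phi_deriv[OF n] by fastforce
    moreover have "real n * 1 \<le> real n * z" using \<open>1 < z\<close> by (intro mult_left_mono) auto
    ultimately show ?thesis using 0[of z] by simp
  qed simp
qed

lemma Phi_test_function:
  assumes n: "0 < n"
  shows "test_function (\<lambda>x. Phi n (x \<bullet> x))"
proof -
  have Ck: "Ck_plane (Suc N) (\<lambda>x::real^2. Phi n (x \<bullet> x))" for N
  proof (rule Ck_plane_inner_self_Suc)
    show "Ck_plane N (\<lambda>x. slope n (x \<bullet> x))"
      unfolding slope_def by (intro Ck_plane_cmult Ck_plane_cutoff n)
  qed (rule Phi_deriv[OF n], simp)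
  have Ck': "Ck_plane N (\<lambda>x::real^2. Phi n (x \<bullet> x))" for N
    by (rule Ck_plane_Suc[OF Ck])
  define S where "S = {x::real^2. real n * (x \<bullet> x) \<le> real n - 1}"
  have "closed S" unfolding S_def by (intro closed_Collect_le continuous_intros)
  moreover have "{x::real^2. Phi n (x \<bullet> x) \<noteq> 0} \<subseteq> S"
    unfolding S_def using Phi_eq_0[OF n] by (auto simp: not_le intro: less_imp_le) (meson linear)
  ultimately have cl: "closure {x::real^2. Phi n (x \<bullet> x) \<noteq> 0} \<subseteq> S" by (rule closure_minimal[rotated])
  have "S \<subseteq> B1"
  proof
    fix x :: "real^2" assume "x \<in> S"
    then have "real n * (x \<bullet> x) < real n * 1" by (simp add: S_def)
    then have "x \<bullet> x < 1" using n by (simp only: mult_less_cancel_left_pos of_nat_0_less_iff)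
    then have "(norm x)\<^sup>2 < 1\<^sup>2" by (simp add: power2_norm_eq_inner)
    then have "norm x < 1" by (rule power_less_imp_less_base) simp
    then show "x \<in> B1" by simp
  qed
  then have B: "closure {x::real^2. Phi n (x \<bullet> x) \<noteq> 0} \<subseteq> B1" using cl by blast
  then have "bounded (closure {x::real^2. Phi n (x \<bullet> x) \<noteq> 0})"
    by (rule bounded_subset[OF bounded_ball])
  then show ?thesis
    unfolding test_function_def using Ck' B by (auto simp: compact_eq_bounded_closed)
qed

lemma gradient_Phi:
  assumes n: "0 < n"
  shows "gradient (\<lambda>x. Phi n (x \<bullet> x)) x = (2 * slope n (x \<bullet> x)) *\<^sub>R x"
  unfolding gradient_def
  by (subst partial_deriv_inner_self[OF Phi_deriv[OF n]]) (auto simp: vec_eq_iff intro: less_le_trans[of _ 0])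

lemma gradient_Phi_gradU:
  assumes n: "0 < n" and x: "x \<noteq> 0"
  shows "gradient (\<lambda>x. Phi n (x \<bullet> x)) x = kap n (x \<bullet> x) *\<^sub>R gradU x"
proof -
  have "2 * slope n ((norm x)\<^sup>2) = - (c * (1 - ln (norm x)) powr e / (norm x)\<^sup>2) * kap n ((norm x)\<^sup>2)"
    by (rule slope_kap) (use x in simp)
  then show ?thesis
    unfolding gradient_Phi[OF n] gradU_def by (simp add: power2_norm_eq_inner mult.commute)
qed

lemma norm_gradU:
  assumes "x \<noteq> 0"
  shows "norm (gradU x) = c * (1 - ln (norm x)) powr e / norm x"
  using assms c by (simp add: gradU_def power2_eq_square)

lemma Phi_square_deriv:
  assumes n: "0 < n" and r: "0 < r"
  shows "((\<lambda>r. Phi n (r\<^sup>2)) has_real_derivative - (c * (1 - ln r) powr e / r) * kap n (r\<^sup>2)) (at r)"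
proof -
  have "((\<lambda>r. r\<^sup>2) has_real_derivative 2 * r) (at r)" by (auto intro!: derivative_eq_intros)
  from DERIV_chain2[where f = "Phi n", OF Phi_deriv[OF n] this]
  have "((\<lambda>r. Phi n (r\<^sup>2)) has_real_derivative slope n (r\<^sup>2) * (2 * r)) (at r)"
    by (smt (verit) zero_le_power2)
  moreover have "slope n (r\<^sup>2) * (2 * r) = - (c * (1 - ln r) powr e / r) * kap n (r\<^sup>2)"
  proof -
    have "slope n (r\<^sup>2) * (2 * r) = (2 * slope n (r\<^sup>2)) * r" by simp
    also have "\<dots> = - (c * (1 - ln r) powr e / r) * kap n (r\<^sup>2)"
      unfolding slope_kap[OF r] using r by (simp add: power2_eq_square)
    finally show ?thesis .
  qed
  ultimately show ?thesis by simp
qed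

lemma weight_nonneg: "0 < r \<Longrightarrow> 0 \<le> c * (1 - ln r) powr e / r"
  using c by simp

text \<open>Both functions vanish at \<open>r = 1\<close>, and the slope of the truncation is that
  of \<open>U\<close> times a factor in \<open>[0,1]\<close>.\<close>

lemma Phi_bounds:
  assumes n: "0 < n" and r: "0 < r" "r \<le> 1"
  shows "0 \<le> Phi n (r\<^sup>2)" and "Phi n (r\<^sup>2) \<le> U r"
proof -
  have "Phi n (1\<^sup>2) \<le> Phi n (r\<^sup>2)"
  proof (rule DERIV_nonpos_imp_nonincreasing[OF r(2), of "\<lambda>r. Phi n (r\<^sup>2)"])
    fix x assume x: "r \<le> x" "x \<le> 1"
    have "0 \<le> (c * (1 - ln x) powr e / x) * kap n (x\<^sup>2)"
      by (intro mult_nonneg_nonneg weight_nonneg kap_bounds) (use x r in auto)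
    then have "- (c * (1 - ln x) powr e / x) * kap n (x\<^sup>2) \<le> 0" by linarith
    then show "\<exists>y. ((\<lambda>r. Phi n (r\<^sup>2)) has_real_derivative y) (at x) \<and> y \<le> 0"
      using Phi_square_deriv[OF n, of x] x r by auto
  qed
  then show "0 \<le> Phi n (r\<^sup>2)" by simp
  have "U 1 - Phi n (1\<^sup>2) \<le> U r - Phi n (r\<^sup>2)"
  proof (rule DERIV_nonpos_imp_nonincreasing[OF r(2), of "\<lambda>r. U r - Phi n (r\<^sup>2)"])
    fix x assume x: "r \<le> x" "x \<le> 1"
    then have x0: "0 < x" using r by simp
    have "((\<lambda>r. U r - Phi n (r\<^sup>2)) has_real_derivative
        - (c * (1 - ln x) powr e / x) - - (c * (1 - ln x) powr e / x) * kap n (x\<^sup>2)) (at x)"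
      by (intro DERIV_diff U_deriv Phi_square_deriv n x0 x)
    moreover have "(c * (1 - ln x) powr e / x) * kap n (x\<^sup>2) \<le> (c * (1 - ln x) powr e / x) * 1"
      by (intro mult_left_mono kap_bounds weight_nonneg x0)
    ultimately show "\<exists>y. ((\<lambda>r. U r - Phi n (r\<^sup>2)) has_real_derivative y) (at x) \<and> y \<le> 0"
      by (intro exI conjI) (assumption, linarith)
  qed
  then show "Phi n (r\<^sup>2) \<le> U r" by (simp add: U1)
qed

lemma U_nonneg: "0 < r \<Longrightarrow> r \<le> 1 \<Longrightarrow> 0 \<le> U r"
  using Phi_bounds[of 1 r] by linarith

lemma bump_scaled_tendsto:
  assumes "0 < a"
  shows "(\<lambda>n. bump 0 (real (Suc n) * a - 1)) \<longlonglongrightarrow> 1"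
proof (rule bump_0_at_top)
  have "filterlim (\<lambda>n. a * real (Suc n)) at_top sequentially"
    using assms by (intro filterlim_tendsto_pos_mult_at_top[OF tendsto_const]
        filterlim_compose[OF filterlim_real_sequentially filterlim_Suc]) auto
  then have "filterlim (\<lambda>n. -1 + a * real (Suc n)) at_top sequentially"
    by (rule filterlim_tendsto_add_at_top[OF tendsto_const])
  then show "filterlim (\<lambda>n. real (Suc n) * a - 1) at_top sequentially"
    by (simp add: mult.commute)
qed

lemma kap_tendsto:
  assumes "0 < q" "q < 1"
  shows "(\<lambda>n. kap (Suc n) q) \<longlonglongrightarrow> 1"
proof -
  have "(\<lambda>n. bump 0 (real (Suc n) * q - 1) * bump 0 (real (Suc n) * (1 - q) - 1)) \<longlonglongrightarrow> 1 * 1"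
    by (intro tendsto_mult bump_scaled_tendsto) (use assms in auto)
  then show ?thesis by (simp add: kap_def algebra_simps)
qed

lemma bump_0_mono: "x \<le> y \<Longrightarrow> bump 0 x \<le> bump 0 y"
  by (auto simp: bump_def le_imp_inverse_le)

text \<open>\<open>U - Phi\<close> at \<open>r\<close> collects the slope lost between
  \<open>r\<close> and \<open>1\<close>. Beyond a point \<open>x\<close> near \<open>1\<close> the
  loss is at most \<open>U x\<close>; between \<open>r\<close> and \<open>x\<close> the factor
  \<open>kap\<close> is at least \<open>kk n\<close>, which tends to \<open>1\<close>.\<close>

lemma Phi_tendsto:
  assumes r: "0 < r" "r \<le> 1"
  shows "(\<lambda>n. Phi (Suc n) (r\<^sup>2)) \<longlonglongrightarrow> U r"
proof (rule tendstoI)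
  fix d :: real assume d: "0 < d"
  have "(U \<longlongrightarrow> U 1) (at_left 1)"
    using DERIV_isCont[OF U_deriv[of 1]] by (auto simp: isCont_def intro: filterlim_mono at_le)
  then have "\<forall>\<^sub>F x in at_left 1. \<bar>U x\<bar> < d / 2"
    using d by (auto dest!: tendstoD[where e = "d / 2"] simp: U1)
  moreover have "\<forall>\<^sub>F x::real in at_left 1. 0 < x \<and> x < 1"
    by (auto simp: eventually_at_left_field intro!: exI[of _ 0])
  ultimately have "\<forall>\<^sub>F x in at_left 1. \<bar>U x\<bar> < d / 2 \<and> 0 < x \<and> x < 1" by (rule eventually_conj)
  then obtain x where x: "\<bar>U x\<bar> < d / 2" "0 < x" "x < 1"
    using eventually_happens'[OF trivial_limit_at_left_real] by blast
  define kk where "kk = (\<lambda>n. bump 0 (real (Suc n) * r\<^sup>2 - 1) * bump 0 (real (Suc n) * (1 - x\<^sup>2) - 1))"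
  have "kk \<longlonglongrightarrow> 1 * 1"
    unfolding kk_def
    by (intro tendsto_mult bump_scaled_tendsto) (use r x in \<open>auto simp: power2_less_1_iff abs_square_less_1\<close>)
  then have "(\<lambda>n. (1 - kk n) * U r) \<longlonglongrightarrow> (1 - 1) * U r" by (intro tendsto_intros) simp
  then have "\<forall>\<^sub>F n in sequentially. \<bar>(1 - kk n) * U r\<bar> < d / 2"
    using d by (auto dest!: tendstoD[where e = "d / 2"])
  then show "\<forall>\<^sub>F n in sequentially. dist (Phi (Suc n) (r\<^sup>2)) (U r) < d"
  proof eventually_elim
    case (elim n)
    note B = Phi_bounds[of "Suc n", OF _ r]
    have kk: "0 \<le> kk n" "kk n \<le> 1"
      unfolding kk_def by (intro mult_nonneg_nonneg mult_le_one bump_nonneg bump_0_le)+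
    have "U r - Phi (Suc n) (r\<^sup>2) \<le> d / 2 + (1 - kk n) * U r"
    proof (cases "r \<le> x")
      case True
      have "(U r - Phi (Suc n) (r\<^sup>2)) - (1 - kk n) * U r \<le> (U x - Phi (Suc n) (x\<^sup>2)) - (1 - kk n) * U x"
      proof (rule DERIV_nonneg_imp_nondecreasing[OF True, of "\<lambda>r. (U r - Phi (Suc n) (r\<^sup>2)) - (1 - kk n) * U r"])
        fix z assume z: "r \<le> z" "z \<le> x"
        then have z0: "0 < z" "z \<le> 1" using r x by auto
        define w where "w = c * (1 - ln z) powr e / z"
        have "((\<lambda>r. (U r - Phi (Suc n) (r\<^sup>2)) - (1 - kk n) * U r) has_real_derivative
            (- w - - w * kap (Suc n) (z\<^sup>2)) - (1 - kk n) * - w) (at z)"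
          unfolding w_def by (intro DERIV_diff DERIV_cmult U_deriv Phi_square_deriv z0) simp
        moreover have "kk n \<le> kap (Suc n) (z\<^sup>2)"
        proof -
          have "bump 0 (real (Suc n) * r\<^sup>2 - 1) \<le> bump 0 (real (Suc n) * z\<^sup>2 - 1)"
            by (intro bump_0_mono diff_mono mult_left_mono power_mono) (use z r in auto)
          moreover have "real (Suc n) * z\<^sup>2 \<le> real (Suc n) * x\<^sup>2"
            by (intro mult_left_mono power_mono) (use z z0 in auto)
          then have "bump 0 (real (Suc n) * (1 - x\<^sup>2) - 1) \<le> bump 0 (real (Suc n) - 1 - real (Suc n) * z\<^sup>2)"
            by (intro bump_0_mono) (simp add: right_diff_distrib)
          ultimately show ?thesis unfolding kk_def kap_def by (intro mult_mono bump_nonneg)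
        qed
        then have "0 \<le> w * (kap (Suc n) (z\<^sup>2) - kk n)"
          using weight_nonneg[OF z0(1)] by (intro mult_nonneg_nonneg) (auto simp: w_def)
        ultimately show "\<exists>y. ((\<lambda>r. (U r - Phi (Suc n) (r\<^sup>2)) - (1 - kk n) * U r) has_real_derivative y) (at z) \<and> 0 \<le> y"
          by (intro exI conjI) (assumption, simp add: algebra_simps)
      qed
      also have "\<dots> \<le> U x"
      proof -
        have "0 \<le> (1 - kk n) * U x"
          by (intro mult_nonneg_nonneg U_nonneg) (use kk x in auto)
        then show ?thesis using Phi_bounds(1)[of "Suc n" x] x by simp
      qed
      finally show ?thesis using x by linarith
    next
      case False
      have "U r \<le> U x"
      proof (rule DERIV_nonpos_imp_nonincreasing[of x r U])
        fix z assume "x \<le> z" "z \<le> r"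
        then have z: "0 < z" "z \<le> 1" using x r by auto
        show "\<exists>y. (U has_real_derivative y) (at z) \<and> y \<le> 0"
          using U_deriv[OF z] weight_nonneg[OF z(1)] by (intro exI conjI) (assumption, linarith)
      qed (use False in simp)
      moreover have "0 \<le> (1 - kk n) * U r" using kk U_nonneg[OF r] by (intro mult_nonneg_nonneg) auto
      ultimately show ?thesis using x B(1) by simp
    qed
    moreover have "(1 - kk n) * U r < d / 2" using elim by linarith
    ultimately show ?case using B by (simp add: dist_real_def)
  qed
qed

lemma set_integrable_square: "set_integrable lebesgue B1 (\<lambda>x. (norm (radial U x))\<^sup>2)"
  and radial_measurable: "set_borel_measurable lebesgue B1 (radial U)"
proof -
  have Uc: "continuous_on {0<..1} U"
    by (intro continuous_at_imp_continuous_on ballI DERIV_isCont[OF U_deriv]) auto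
  have rc: "continuous_on (B1 - {0}) (radial U)"
    unfolding radial_def by (rule continuous_on_compose2[OF Uc]) (auto intro!: continuous_intros)
  then show m: "set_borel_measurable lebesgue B1 (radial U)" by (rule punctured_ball_measurable)
  have "set_integrable lborel {0<..<1::real} (\<lambda>r. 1)"
    by (simp add: set_integrable_def)
  then have "set_integrable lborel {0<..<1::real} (\<lambda>r. (1 / r) * r)"
    by (rule set_integrable_cong[THEN iffD1, rotated -1]) auto
  then have "set_integrable lebesgue B1 (\<lambda>x::real^2. 1 / norm x)"
    by (intro set_integrable_radial[of "\<lambda>r. 1 / r"]) auto
  then have "set_integrable lebesgue B1 (\<lambda>x::real^2. 4 * C\<^sup>2 * (1 / norm x))"
    by (rule set_integrable_mult_right)
  moreover have "set_borel_measurable lebesgue B1 (\<lambda>x. (norm (radial U x))\<^sup>2)"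
    by (rule punctured_ball_measurable) (intro continuous_intros rc)
  moreover have "AE x in lebesgue. x \<in> B1 \<longrightarrow> norm ((norm (radial U x))\<^sup>2) \<le> norm (4 * C\<^sup>2 * (1 / norm x))"
    using AE_lebesgue_neq_0
  proof eventually_elim
    case (elim x)
    show ?case
    proof
      assume "x \<in> B1"
      define r where "r = norm x"
      have r: "0 < r" "r \<le> 1" using elim \<open>x \<in> B1\<close> by (auto simp: r_def)
      \<comment> \<open>The logarithm is compared with \<open>1 / sqrt r\<close>, whose square is
        integrable over the disc.\<close>
      have "ln (1 / sqrt r) \<le> 1 / sqrt r - 1" using r by (intro ln_le_minus_one) simp
      moreover have "ln (1 / sqrt r) = - (ln r / 2)" using r by (simp add: ln_div ln_sqrt)
      moreover have "1 \<le> 1 / sqrt r" using r by simp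
      ultimately have "1 - ln r \<le> 2 / sqrt r" by (simp add: field_simps)
      then have "U r \<le> C * (2 / sqrt r)"
        using U_le[OF r] C by (meson mult_left_mono order_trans)
      then have "(U r)\<^sup>2 \<le> (C * (2 / sqrt r))\<^sup>2" using U_nonneg[OF r] by (intro power_mono)
      also have "\<dots> = 4 * C\<^sup>2 * (1 / r)" using r by (simp add: power_mult_distrib power_divide)
      finally show "norm ((norm (radial U x))\<^sup>2) \<le> norm (4 * C\<^sup>2 * (1 / norm x))"
        using r by (simp add: radial_def r_def)
    qed
  qed
  ultimately show "set_integrable lebesgue B1 (\<lambda>x. (norm (radial U x))\<^sup>2)"
    by (rule set_integrable_bound)
qed

lemma L2_radial: "L2_B1 (radial U)"
  using set_integrable_square radial_measurable by (simp add: L2_B1_def)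

lemma Phi_measurable: "0 < n \<Longrightarrow> (\<lambda>x::real^2. Phi n (x \<bullet> x)) \<in> borel_measurable borel"
proof -
  assume "0 < n"
  then have "Ck_plane 0 (\<lambda>x::real^2. Phi n (x \<bullet> x))"
    using Phi_test_function unfolding test_function_def by blast
  then show ?thesis by (intro borel_measurable_continuous_onI) simp
qed

lemma Phi_L2_tendsto:
  "(\<lambda>n. LINT x:B1|lebesgue. (norm (Phi (Suc n) (x \<bullet> x) - radial U x))\<^sup>2) \<longlonglongrightarrow> 0"
proof -
  have "(\<lambda>n. integral\<^sup>L lebesgue (\<lambda>x. indicator B1 x *\<^sub>R (norm (Phi (Suc n) (x \<bullet> x) - radial U x))\<^sup>2))
      \<longlonglongrightarrow> integral\<^sup>L lebesgue (\<lambda>x::real^2. 0 :: real)"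
  proof (rule integral_dominated_convergence)
    show "integrable lebesgue (\<lambda>x. indicator B1 x *\<^sub>R (norm (radial U x))\<^sup>2)"
      using set_integrable_square by (simp add: set_integrable_def)
    show "(\<lambda>x. indicator B1 x *\<^sub>R (norm (Phi (Suc n) (x \<bullet> x) - radial U x))\<^sup>2) \<in> borel_measurable lebesgue" for n
    proof -
      have 1: "(\<lambda>x. indicator B1 x *\<^sub>R radial U x) \<in> borel_measurable lebesgue"
        using radial_measurable by (simp add: set_borel_measurable_def)
      have 2: "(\<lambda>x::real^2. indicator B1 x *\<^sub>R Phi (Suc n) (x \<bullet> x)) \<in> borel_measurable lebesgue"
        by (intro lebesgue_measurableI borel_measurable_scaleR borel_measurable_indicator Phi_measurable) auto
      have "(\<lambda>x. (norm (indicator B1 x *\<^sub>R Phi (Suc n) (x \<bullet> x) - indicator B1 x *\<^sub>R radial U x))\<^sup>2) \<in> borel_measurable lebesgue"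
        using 1 2 by measurable
      moreover have "(\<lambda>x. (norm (indicator B1 x *\<^sub>R Phi (Suc n) (x \<bullet> x) - indicator B1 x *\<^sub>R radial U x))\<^sup>2)
          = (\<lambda>x. indicator B1 x *\<^sub>R (norm (Phi (Suc n) (x \<bullet> x) - radial U x))\<^sup>2)"
        by (auto simp: indicator_def fun_eq_iff)
      ultimately show ?thesis by simp
    qed
    show "AE x in lebesgue. (\<lambda>n. indicator B1 x *\<^sub>R (norm (Phi (Suc n) (x \<bullet> x) - radial U x))\<^sup>2) \<longlonglongrightarrow> 0"
      using AE_lebesgue_neq_0
    proof eventually_elim
      case (elim x)
      show ?case
      proof (cases "x \<in> B1")
        case True
        have "(\<lambda>n. Phi (Suc n) ((norm x)\<^sup>2) - U (norm x)) \<longlonglongrightarrow> U (norm x) - U (norm x)"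
          by (intro tendsto_diff Phi_tendsto tendsto_const) (use elim True in auto)
        then have "(\<lambda>n. (norm (Phi (Suc n) ((norm x)\<^sup>2) - U (norm x)))\<^sup>2) \<longlonglongrightarrow> (norm (U (norm x) - U (norm x)))\<^sup>2"
          by (intro tendsto_power tendsto_norm)
        then show ?thesis using True by (simp add: radial_def power2_norm_eq_inner)
      qed simp
    qed
    show "AE x in lebesgue. norm (indicator B1 x *\<^sub>R (norm (Phi (Suc n) (x \<bullet> x) - radial U x))\<^sup>2)
        \<le> indicator B1 x *\<^sub>R (norm (radial U x))\<^sup>2" for n
      using AE_lebesgue_neq_0
    proof eventually_elim
      case (elim x)
      show ?case
      proof (cases "x \<in> B1")
        case True
        then have "\<bar>Phi (Suc n) ((norm x)\<^sup>2) - U (norm x)\<bar> \<le> \<bar>U (norm x)\<bar>"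
          using Phi_bounds[of "Suc n" "norm x"] elim by auto
        then show ?thesis using True by (simp add: radial_def power2_norm_eq_inner abs_le_square_iff)
      qed simp
    qed
  qed simp
  then show ?thesis by (simp add: set_lebesgue_integral_def)
qed

lemma gradU_measurable: "set_borel_measurable lebesgue B1 gradU"
proof (rule punctured_ball_measurable)
  have "0 < 1 - ln (norm x)" if "x \<in> B1 - {0}" for x :: "real^2"
  proof -
    have "ln (norm x) \<le> 0" using that by simp
    then show ?thesis by linarith
  qed
  then show "continuous_on (B1 - {0}) gradU"
    unfolding gradU_def by (intro continuous_intros) force+
qed

text \<open>The gradients of the truncations are dominated by \<open>gradU\<close>, so everything
  reduces to its square integrability.\<close>

theorem H10_radial:
  assumes e: "2 * e < - 1"
  shows "H10_B1 (radial U)"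
proof -
  define s where "s = - (2 * e + 1)"
  have s: "0 < s" using e by (simp add: s_def)
  \<comment> \<open>Antiderivative of the radial energy density \<open>f r * r\<close>. It has a
    finite limit at \<open>0\<close> because \<open>s > 0\<close>, which is the hypothesis on
    \<open>e\<close>.\<close>
  define F where "F = (\<lambda>r::real. c\<^sup>2 * (1 - ln r) powr (- s) / s)"
  define f where "f = (\<lambda>r::real. (c * (1 - ln r) powr e / r)\<^sup>2)"
  have pos: "0 < 1 - ln r" if "0 < r" "r \<le> 1" for r :: real
  proof -
    have "ln r \<le> 0" using that by simp
    then show ?thesis by linarith
  qed
  have fr: "f r * r = c\<^sup>2 * (1 - ln r) powr (- s - 1) / r" if "0 < r" "r \<le> 1" for r
  proof -
    have "((1 - ln r) powr e)\<^sup>2 = (1 - ln r) powr (- s - 1)"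
      using pos[OF that] by (simp add: s_def power2_eq_square powr_add[symmetric])
    then show ?thesis using that by (simp add: f_def power_mult_distrib power_divide power2_eq_square)
  qed
  have dF: "(F has_real_derivative c\<^sup>2 * (1 - ln r) powr (- s - 1) / r) (at r)" if r: "0 < r" "r \<le> 1" for r
  proof -
    have "((\<lambda>r. 1 - ln r) has_real_derivative - inverse r) (at r)"
      by (rule DERIV_cong[OF DERIV_diff[OF DERIV_const DERIV_ln[OF r(1)]]]) simp
    from DERIV_chain2[where f = "\<lambda>z. z powr (- s)", OF has_real_derivative_powr[OF pos[OF r]] this]
    have "((\<lambda>r. (1 - ln r) powr (- s)) has_real_derivative - s * (1 - ln r) powr (- s - 1) * - inverse r) (at r)" .
    then show ?thesis
      unfolding F_def
      by (rule DERIV_cong[OF DERIV_cdivide[OF DERIV_cmult]]) (use s in \<open>simp add: divide_inverse\<close>)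
  qed
  have "set_integrable lborel (einterval 0 1) (\<lambda>r. c\<^sup>2 * (1 - ln r) powr (- s - 1) / r)"
  proof (rule interval_integral_FTC_nonneg(1)[where F = F])
    show "((F \<circ> real_of_ereal) \<longlongrightarrow> 0) (at_right 0)"
    proof -
      have "filterlim (\<lambda>r::real. - ln r) at_top (at_right 0)"
        using ln_at_0 by (simp add: filterlim_uminus_at_bot)
      then have "filterlim (\<lambda>r::real. 1 + - ln r) at_top (at_right 0)"
        by (rule filterlim_tendsto_add_at_top[OF tendsto_const])
      then have "((\<lambda>r::real. (1 - ln r) powr (- s)) \<longlongrightarrow> 0) (at_right 0)"
        using s by (intro tendsto_neg_powr) auto
      then have "(F \<longlongrightarrow> c\<^sup>2 * 0 / s) (at_right 0)"
        unfolding F_def using s by (intro tendsto_intros) auto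
      then show ?thesis by (simp add: zero_ereal_def ereal_tendsto_simps1)
    qed
    have "isCont F 1" by (rule DERIV_isCont[OF dF]) auto
    then have "(F \<longlongrightarrow> F 1) (at_left 1)" by (auto simp: isCont_def intro: filterlim_mono at_le)
    then show "((F \<circ> real_of_ereal) \<longlongrightarrow> F 1) (at_left 1)" by (simp add: one_ereal_def ereal_tendsto_simps1)
    fix r :: real assume "0 < ereal r" "ereal r < 1"
    then have r: "0 < r" "r < 1" by (simp_all add: zero_ereal_def one_ereal_def)
    show "DERIV F r :> c\<^sup>2 * (1 - ln r) powr (- s - 1) / r" by (rule dF) (use r in auto)
    show "isCont (\<lambda>r. c\<^sup>2 * (1 - ln r) powr (- s - 1) / r) r"
      using r pos[of r] by (intro continuous_intros) auto
  next
    show "AE r in lborel. 0 < ereal r \<longrightarrow> ereal r < 1 \<longrightarrow> 0 \<le> c\<^sup>2 * (1 - ln r) powr (- s - 1) / r"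
      by (intro AE_I2) (auto simp: zero_ereal_def)
  qed auto
  then have "set_integrable lborel {0<..<1} (\<lambda>r. c\<^sup>2 * (1 - ln r) powr (- s - 1) / r)"
    by (simp add: zero_ereal_def one_ereal_def)
  then have "set_integrable lborel {0<..<1} (\<lambda>r. f r * r)"
    by (rule set_integrable_cong[THEN iffD1, rotated -1]) (auto simp: fr)
  then have "set_integrable lebesgue B1 (\<lambda>x::real^2. f (norm x))"
    by (intro set_integrable_radial) (auto simp: f_def)
  then have gi: "set_integrable lebesgue B1 (\<lambda>x. (norm (gradU x))\<^sup>2)"
    unfolding set_integrable_def
  proof (rule integrable_cong_AE_imp)
    have "(\<lambda>x. (norm (indicator B1 x *\<^sub>R gradU x))\<^sup>2) \<in> borel_measurable lebesgue"
      using gradU_measurable unfolding set_borel_measurable_def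
      by measurable
    moreover have "(\<lambda>x. (norm (indicator B1 x *\<^sub>R gradU x))\<^sup>2) = (\<lambda>x. indicator B1 x *\<^sub>R (norm (gradU x))\<^sup>2)"
      by (auto simp: indicator_def fun_eq_iff)
    ultimately show "(\<lambda>x. indicator B1 x *\<^sub>R (norm (gradU x))\<^sup>2) \<in> borel_measurable lebesgue" by simp
    show "AE x in lebesgue. indicator B1 x *\<^sub>R f (norm x) = indicator B1 x *\<^sub>R (norm (gradU x))\<^sup>2"
      using AE_lebesgue_neq_0 by eventually_elim (simp add: f_def norm_gradU)
  qed
  have L2g: "L2_B1 gradU" using gi gradU_measurable by (simp add: L2_B1_def)
  have "(\<lambda>n. integral\<^sup>L lebesgue (\<lambda>x. indicator B1 x *\<^sub>R (norm (gradient (\<lambda>x. Phi (Suc n) (x \<bullet> x)) x - gradU x))\<^sup>2))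
      \<longlonglongrightarrow> integral\<^sup>L lebesgue (\<lambda>x::real^2. 0 :: real)"
  proof (rule integral_dominated_convergence)
    show "integrable lebesgue (\<lambda>x. indicator B1 x *\<^sub>R (norm (gradU x))\<^sup>2)"
      using gi by (simp add: set_integrable_def)
    have gm: "(\<lambda>x. indicator B1 x *\<^sub>R gradU x) \<in> borel_measurable lebesgue"
      using gradU_measurable by (simp add: set_borel_measurable_def)
    show "(\<lambda>x. indicator B1 x *\<^sub>R (norm (gradient (\<lambda>x. Phi (Suc n) (x \<bullet> x)) x - gradU x))\<^sup>2) \<in> borel_measurable lebesgue" for n
    proof -
      have "(\<lambda>x::real^2. (2 * slope (Suc n) (x \<bullet> x)) *\<^sub>R x) \<in> borel_measurable borel"
        by (intro borel_measurable_continuous_onI continuous_intros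
            continuous_on_compose2[OF slope_continuous[of "Suc n" UNIV]]) auto
      then have "(\<lambda>x::real^2. indicator B1 x *\<^sub>R ((2 * slope (Suc n) (x \<bullet> x)) *\<^sub>R x)) \<in> borel_measurable lebesgue"
        by (intro lebesgue_measurableI borel_measurable_scaleR[OF borel_measurable_indicator]) auto
      with gm have "(\<lambda>x. (norm (indicator B1 x *\<^sub>R ((2 * slope (Suc n) (x \<bullet> x)) *\<^sub>R x) - indicator B1 x *\<^sub>R gradU x))\<^sup>2) \<in> borel_measurable lebesgue"
        by measurable
      moreover have "(\<lambda>x. (norm (indicator B1 x *\<^sub>R ((2 * slope (Suc n) (x \<bullet> x)) *\<^sub>R x) - indicator B1 x *\<^sub>R gradU x))\<^sup>2)
          = (\<lambda>x. indicator B1 x *\<^sub>R (norm (gradient (\<lambda>x. Phi (Suc n) (x \<bullet> x)) x - gradU x))\<^sup>2)"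
        by (auto simp: indicator_def fun_eq_iff gradient_Phi)
      ultimately show ?thesis by simp
    qed
    have eq: "norm (gradient (\<lambda>x. Phi (Suc n) (x \<bullet> x)) x - gradU x) = (1 - kap (Suc n) ((norm x)\<^sup>2)) * norm (gradU x)"
      if "x \<noteq> 0" for n x
    proof -
      have "gradient (\<lambda>x. Phi (Suc n) (x \<bullet> x)) x - gradU x = - ((1 - kap (Suc n) (x \<bullet> x)) *\<^sub>R gradU x)"
        unfolding gradient_Phi_gradU[OF zero_less_Suc that] by (simp add: scaleR_diff_left)
      then show ?thesis using kap_bounds[of "Suc n" "x \<bullet> x"] by (simp add: power2_norm_eq_inner)
    qed
    show "AE x in lebesgue. (\<lambda>n. indicator B1 x *\<^sub>R (norm (gradient (\<lambda>x. Phi (Suc n) (x \<bullet> x)) x - gradU x))\<^sup>2) \<longlonglongrightarrow> 0"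
      using AE_lebesgue_neq_0
    proof eventually_elim
      case (elim x)
      show ?case
      proof (cases "x \<in> B1")
        case True
        have "(\<lambda>n. ((1 - kap (Suc n) ((norm x)\<^sup>2)) * norm (gradU x))\<^sup>2) \<longlonglongrightarrow> ((1 - 1) * norm (gradU x))\<^sup>2"
          by (intro tendsto_intros kap_tendsto) (use elim True in \<open>auto simp: abs_square_less_1\<close>)
        then show ?thesis using True by (simp add: eq[OF elim])
      qed simp
    qed
    show "AE x in lebesgue. norm (indicator B1 x *\<^sub>R (norm (gradient (\<lambda>x. Phi (Suc n) (x \<bullet> x)) x - gradU x))\<^sup>2)
        \<le> indicator B1 x *\<^sub>R (norm (gradU x))\<^sup>2" for n
      using AE_lebesgue_neq_0
    proof eventually_elim
      case (elim x)
      have "(1 - kap (Suc n) ((norm x)\<^sup>2)) * norm (gradU x) \<le> 1 * norm (gradU x)"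
        using kap_bounds[of "Suc n" "(norm x)\<^sup>2"] by (intro mult_right_mono) auto
      moreover have "0 \<le> (1 - kap (Suc n) ((norm x)\<^sup>2)) * norm (gradU x)"
        using kap_bounds[of "Suc n" "(norm x)\<^sup>2"] by (intro mult_nonneg_nonneg) auto
      ultimately have "((1 - kap (Suc n) ((norm x)\<^sup>2)) * norm (gradU x))\<^sup>2 \<le> (norm (gradU x))\<^sup>2"
        by (intro power_mono) auto
      then show ?case by (auto simp: eq[OF elim] indicator_def)
    qed
  qed simp
  then have "(\<lambda>n. LINT x:B1|lebesgue. (norm (gradient (\<lambda>x. Phi (Suc n) (x \<bullet> x)) x - gradU x))\<^sup>2) \<longlonglongrightarrow> 0"
    by (simp add: set_lebesgue_integral_def)
  then show ?thesis
    unfolding H10_B1_def using L2_radial L2g Phi_L2_tendsto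
    by (intro conjI exI[of _ gradU] exI[of _ "\<lambda>n x. Phi (Suc n) (x \<bullet> x)"]) (auto intro: Phi_test_function)
qed

end

section \<open>The profile is no \<open>H^1\<close> limit when its Dirichlet integral
  diverges\<close>

lemma set_integrable_lborel:
  fixes u :: "real^2 \<Rightarrow> real"
  assumes "integrable lborel u" "\<And>x. x \<notin> B1 \<Longrightarrow> u x = 0"
  shows "set_integrable lebesgue B1 u" and "(LINT x:B1|lebesgue. u x) = integral\<^sup>L lborel u"
proof -
  have m: "u \<in> borel_measurable lborel" using assms(1) by auto
  have eq: "(\<lambda>x. indicator B1 x *\<^sub>R u x) = u" using assms(2) by (auto simp: indicator_def fun_eq_iff)
  show "set_integrable lebesgue B1 u"
    unfolding set_integrable_def eq using assms(1) integrable_completion[OF m] by simp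
  show "(LINT x:B1|lebesgue. u x) = integral\<^sup>L lborel u"
    unfolding set_lebesgue_integral_def eq by (rule integral_completion[OF m])
qed

lemma L2_diff:
  fixes u v :: "real^2 \<Rightarrow> 'b::euclidean_space"
  assumes "L2_B1 u" "L2_B1 v"
  shows "set_integrable lebesgue B1 (\<lambda>x. (norm (u x - v x))\<^sup>2)"
proof (rule set_integrable_bound)
  show "set_integrable lebesgue B1 (\<lambda>x. 2 * (norm (u x))\<^sup>2 + 2 * (norm (v x))\<^sup>2)"
    using assms unfolding L2_B1_def by (intro set_integral_add(1) set_integrable_mult_right) auto
  have "(\<lambda>x. indicator B1 x *\<^sub>R u x) \<in> borel_measurable lebesgue"
    "(\<lambda>x. indicator B1 x *\<^sub>R v x) \<in> borel_measurable lebesgue"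
    using assms by (simp_all add: L2_B1_def set_borel_measurable_def)
  then have "(\<lambda>x. (norm (indicator B1 x *\<^sub>R u x - indicator B1 x *\<^sub>R v x))\<^sup>2) \<in> borel_measurable lebesgue"
    by measurable
  moreover have "(\<lambda>x. (norm (indicator B1 x *\<^sub>R u x - indicator B1 x *\<^sub>R v x))\<^sup>2)
      = (\<lambda>x. indicator B1 x *\<^sub>R (norm (u x - v x))\<^sup>2)"
    by (auto simp: indicator_def fun_eq_iff)
  ultimately show "set_borel_measurable lebesgue B1 (\<lambda>x. (norm (u x - v x))\<^sup>2)"
    by (simp add: set_borel_measurable_def)
  have "(norm (u x - v x))\<^sup>2 \<le> 2 * (norm (u x))\<^sup>2 + 2 * (norm (v x))\<^sup>2" for x
  proof -
    have "(norm (u x - v x))\<^sup>2 \<le> (norm (u x) + norm (v x))\<^sup>2"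
      by (intro power_mono norm_triangle_ineq4) auto
    also have "\<dots> \<le> 2 * (norm (u x))\<^sup>2 + 2 * (norm (v x))\<^sup>2"
      using zero_le_power2[of "norm (u x) - norm (v x)"] by (simp add: power2_sum power2_diff)
    finally show ?thesis .
  qed
  then show "AE x in lebesgue. x \<in> B1 \<longrightarrow> norm ((norm (u x - v x))\<^sup>2) \<le> norm (2 * (norm (u x))\<^sup>2 + 2 * (norm (v x))\<^sup>2)"
    by (intro AE_I2) auto
qed

lemma L2_continuous:
  fixes u :: "real^2 \<Rightarrow> 'b::euclidean_space"
  assumes "continuous_on UNIV u"
  shows "L2_B1 u"
proof -
  have m: "u \<in> borel_measurable borel" using assms by (rule borel_measurable_continuous_onI)
  have sm: "set_borel_measurable lebesgue B1 u"
    unfolding set_borel_measurable_def using m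
    by (intro lebesgue_measurableI borel_measurable_scaleR borel_measurable_indicator) auto
  have "integrable lborel (\<lambda>x. indicator (cball 0 1) x *\<^sub>R (norm (u x))\<^sup>2)"
    by (intro borel_integrable_compact compact_cball continuous_intros continuous_on_subset[OF assms]) auto
  then have "set_integrable lborel (cball (0::real^2) 1) (\<lambda>x. (norm (u x))\<^sup>2)"
    by (simp add: set_integrable_def)
  then have i: "set_integrable lborel B1 (\<lambda>x. (norm (u x))\<^sup>2)"
    by (rule set_integrable_subset) auto
  have "(\<lambda>x. indicator B1 x *\<^sub>R (norm (u x))\<^sup>2) \<in> borel_measurable lborel"
    using i by (auto simp: set_integrable_def)
  then have "set_integrable lebesgue B1 (\<lambda>x. (norm (u x))\<^sup>2)"
    using i unfolding set_integrable_def by (subst integrable_completion) auto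
  then show ?thesis using sm by (simp add: L2_B1_def)
qed

lemma gradient_continuous:
  assumes "Ck_plane (Suc 0) u"
  shows "continuous_on UNIV (gradient u)"
  unfolding gradient_def using assms by (intro continuous_on_vec_lambda) simp

context log_profile
begin

text \<open>Let \<open>X\<close> be the gradient of the truncation \<open>j\<close>. Its energy is
  at most the integral of \<open>Y \<bullet> X\<close> for a later truncation with gradient
  \<open>Y\<close>. By Green's formula this is an integral of \<open>phi n\<close> against
  \<open>D\<close>, the Laplacian of truncation \<open>j\<close>; there \<open>phi n\<close> is
  exchanged for \<open>psi i\<close>, as both are close to \<open>U\<close> in \<open>L^2\<close>,
  and Green's formula leads back to \<open>Z \<bullet> X\<close> with \<open>Z\<close> close to
  \<open>g\<close>. A quarter of the energy is absorbed, and the bound is independent of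
  \<open>j\<close>.\<close>

lemma energy_bound:
  assumes j: "0 < j" and g: "L2_B1 g" and psi: "\<And>n. test_function (psi n)"
    and l1: "(\<lambda>n. LINT x:B1|lebesgue. (norm (psi n x - radial U x))\<^sup>2) \<longlonglongrightarrow> 0"
    and l2: "(\<lambda>n. LINT x:B1|lebesgue. (norm (gradient (psi n) x - g x))\<^sup>2) \<longlonglongrightarrow> 0"
  shows "(LINT x:B1|lebesgue. (norm (gradient (\<lambda>x. Phi j (x \<bullet> x)) x))\<^sup>2)
    \<le> 4 / 3 * (2 + 2 * (LINT x:B1|lebesgue. (norm (g x))\<^sup>2) + (LINT x:B1|lebesgue. 1) + 1)"
proof -
  define phi where "phi = (\<lambda>j x::real^2. Phi j (x \<bullet> x))"
  define X where "X = gradient (phi j)"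
  define D where "D = laplacian (phi j)"
  have Ck: "Ck_plane N (phi i)" if "0 < i" for i N
    using Phi_test_function[OF that] by (simp add: test_function_def phi_def)
  \<comment> \<open>A radius strictly between the edge \<open>sqrt (1 - 1 / j)\<close> of the
    support and \<open>1\<close>.\<close>
  define rho where "rho = sqrt (1 - 1 / (2 * real j))"
  have rho: "rho < 1" using j by (simp add: rho_def)
  have psupp: "phi j x = 0" if "rho < norm x" for x
  proof -
    have "1 - 1 / (2 * real j) < (norm x)\<^sup>2"
      using that real_le_rsqrt[of "norm x" "1 - 1 / (2 * real j)"] by (force simp: rho_def)
    then have "real j * (1 - 1 / (2 * real j)) \<le> real j * (norm x)\<^sup>2"
      by (intro mult_left_mono) auto
    then have "real j - 1 \<le> real j * (norm x)\<^sup>2"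
      using j by (simp add: right_diff_distrib)
    then show ?thesis unfolding phi_def by (intro Phi_eq_0 j) (simp add: power2_norm_eq_inner)
  qed
  note green = green_identity[OF _ Ck[OF j] rho psupp, folded X_def D_def]
  have Ck1: "Ck_plane (Suc 0) (psi n)" for n using psi[of n] by (simp add: test_function_def)
  have X0: "X x = 0" if "x \<notin> B1" for x
  proof -
    have "partial_deriv i (phi j) x = 0" for i
      by (rule partial_deriv_locally_0[of "{x. rho < norm x}"])
        (use that rho psupp in \<open>auto intro!: open_Collect_less continuous_intros\<close>)
    then show ?thesis by (simp add: X_def gradient_def vec_eq_iff)
  qed
  have D0: "D x = 0" if "rho < norm x" for x
  proof -
    have p: "partial_deriv i (phi j) y = 0" if "rho < norm y" for i y
      by (rule partial_deriv_locally_0[of "{x. rho < norm x}"])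
        (use that psupp in \<open>auto intro!: open_Collect_less continuous_intros\<close>)
    have "partial_deriv i (partial_deriv i (phi j)) x = 0" for i
      by (rule partial_deriv_locally_0[of "{x. rho < norm x}"])
        (use that p in \<open>auto intro!: open_Collect_less continuous_intros\<close>)
    then show ?thesis by (simp add: D_def laplacian_def)
  qed
  have Dc: "continuous_on UNIV D"
    unfolding D_def laplacian_def using Ck[OF j, of "Suc (Suc 0)"] by (intro continuous_intros) simp
  obtain M where M: "0 \<le> M" "\<And>x. \<bar>D x\<bar> \<le> M"
    using continuous_compact_support_bounded[OF Dc] D0 rho by (metis less_trans)
  \<comment> \<open>\<open>D\<close> depends on \<open>j\<close> alone, so its bound
    \<open>M\<close> is known before \<open>i\<close> and \<open>n\<close> are taken so late that
    the exchange costs a constant.\<close>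
  define eta where "eta = 1 / (M\<^sup>2 + 1)"
  have M1: "0 < M\<^sup>2 + 1" by (simp add: add_nonneg_pos)
  have eta: "0 < eta" "M\<^sup>2 * eta \<le> 1" using M1 by (auto simp: eta_def field_simps)
  have "\<forall>\<^sub>F n in sequentially. (LINT x:B1|lebesgue. (norm (psi n x - radial U x))\<^sup>2) < eta"
    using order_tendstoD(2)[OF l1 eta(1)] .
  moreover have "\<forall>\<^sub>F n in sequentially. (LINT x:B1|lebesgue. (norm (gradient (psi n) x - g x))\<^sup>2) < 1"
    using order_tendstoD(2)[OF l2 zero_less_one] .
  ultimately have "\<forall>\<^sub>F n in sequentially. (LINT x:B1|lebesgue. (norm (psi n x - radial U x))\<^sup>2) < eta
      \<and> (LINT x:B1|lebesgue. (norm (gradient (psi n) x - g x))\<^sup>2) < 1"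
    by (rule eventually_conj)
  then obtain i where i: "(LINT x:B1|lebesgue. (norm (psi i x - radial U x))\<^sup>2) < eta"
    "(LINT x:B1|lebesgue. (norm (gradient (psi i) x - g x))\<^sup>2) < 1"
    using eventually_happens' sequentially_bot by blast
  have "\<forall>\<^sub>F n in sequentially. (LINT x:B1|lebesgue. (norm (phi (Suc n) x - radial U x))\<^sup>2) < eta \<and> j \<le> n"
    unfolding phi_def
    using order_tendstoD(2)[OF Phi_L2_tendsto eta(1)] eventually_ge_at_top by (rule eventually_conj)
  then obtain n0 where n0: "(LINT x:B1|lebesgue. (norm (phi (Suc n0) x - radial U x))\<^sup>2) < eta" "j \<le> n0"
    using eventually_happens' sequentially_bot by blast
  define n where "n = Suc n0"
  have n: "(LINT x:B1|lebesgue. (norm (phi n x - radial U x))\<^sup>2) < eta" "j \<le> n" "0 < n"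
    using n0 by (auto simp: n_def)
  define Y where "Y = gradient (phi n)"
  define Z where "Z = gradient (psi i)"
  \<comment> \<open>Both gradients are multiples of \<open>gradU\<close>, and the factor
    \<open>kap\<close> increases with the index on the disc.\<close>
  have XY: "(norm (X x))\<^sup>2 \<le> Y x \<bullet> X x" for x
  proof (cases "x = 0")
    case True
    then show ?thesis by (simp add: X_def phi_def gradient_Phi[OF j])
  next
    case False
    have eq: "X x = kap j (x \<bullet> x) *\<^sub>R gradU x" "Y x = kap n (x \<bullet> x) *\<^sub>R gradU x"
      unfolding X_def Y_def phi_def by (intro gradient_Phi_gradU j n False)+
    show ?thesis
    proof (cases "x \<bullet> x \<le> 1")
      case True
      have "kap j (x \<bullet> x) \<le> kap n (x \<bullet> x)"
      proof -
        have "real j * (x \<bullet> x) \<le> real n * (x \<bullet> x)" "real j * (1 - x \<bullet> x) \<le> real n * (1 - x \<bullet> x)"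
          using n(2) True by (intro mult_right_mono; simp)+
        then show ?thesis
          unfolding kap_def by (intro mult_mono bump_0_mono bump_nonneg) (auto simp: algebra_simps)
      qed
      then have "kap j (x \<bullet> x) * kap j (x \<bullet> x) \<le> kap n (x \<bullet> x) * kap j (x \<bullet> x)"
        by (intro mult_right_mono kap_bounds)
      then have "(kap j (x \<bullet> x) * kap j (x \<bullet> x)) * (gradU x \<bullet> gradU x) \<le> (kap n (x \<bullet> x) * kap j (x \<bullet> x)) * (gradU x \<bullet> gradU x)"
        by (rule mult_right_mono) simp
      then show ?thesis unfolding eq power2_norm_eq_inner by (simp add: mult_ac)
    next
      case False
      have "kap j (x \<bullet> x) = 0"
      proof -
        have "real j * 1 \<le> real j * (x \<bullet> x)" using False by (intro mult_left_mono) auto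
        then show ?thesis by (simp add: kap_def bump_def)
      qed
      then show ?thesis by (simp add: eq)
    qed
  qed
  have Xi: "set_integrable lebesgue B1 (\<lambda>x. (norm (X x))\<^sup>2)"
    using L2_continuous[OF gradient_continuous[OF Ck[OF j]]] by (simp add: L2_B1_def X_def)
  note gn = green[OF Ck[OF n(3)], folded Y_def] and gi = green[OF Ck1[of i], folded Z_def]
  have B: "set_integrable lebesgue B1 (\<lambda>x. Y x \<bullet> X x)" "set_integrable lebesgue B1 (\<lambda>x. Z x \<bullet> X x)"
    "(LINT x:B1|lebesgue. Y x \<bullet> X x) = integral\<^sup>L lborel (\<lambda>x. Y x \<bullet> X x)"
    "(LINT x:B1|lebesgue. Z x \<bullet> X x) = integral\<^sup>L lborel (\<lambda>x. Z x \<bullet> X x)"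
    by (rule set_integrable_lborel; use gn gi X0 in simp)+
  have Dout: "D x = 0" if "x \<notin> B1" for x using D0[of x] that rho by simp
  have BD: "set_integrable lebesgue B1 (\<lambda>x. phi n x * D x)" "set_integrable lebesgue B1 (\<lambda>x. psi i x * D x)"
    "(LINT x:B1|lebesgue. phi n x * D x) = integral\<^sup>L lborel (\<lambda>x. phi n x * D x)"
    "(LINT x:B1|lebesgue. psi i x * D x) = integral\<^sup>L lborel (\<lambda>x. psi i x * D x)"
    by (rule set_integrable_lborel; use gn gi Dout in simp)+
  have phic: "continuous_on UNIV (phi n)" and psic: "continuous_on UNIV (psi i)"
    using Ck[OF n(3), of 0] Ck_plane_Suc[OF Ck1[of i]] by auto
  have I1: "set_integrable lebesgue B1 (\<lambda>x. (norm (phi n x - radial U x))\<^sup>2)"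
    by (intro L2_diff L2_continuous phic L2_radial)
  have I2: "set_integrable lebesgue B1 (\<lambda>x. (norm (psi i x - radial U x))\<^sup>2)"
    by (intro L2_diff L2_continuous psic L2_radial)
  have I3: "set_integrable lebesgue B1 (\<lambda>x. (norm (Z x - g x))\<^sup>2)"
    unfolding Z_def by (intro L2_diff L2_continuous gradient_continuous Ck1 g)
  have I4: "set_integrable lebesgue B1 (\<lambda>x. (norm (g x))\<^sup>2)" using g by (simp add: L2_B1_def)
  have I5: "set_integrable lebesgue B1 (\<lambda>x::real^2. 1 :: real)"
    using L2_continuous[of "\<lambda>_. 1 :: real"] by (simp add: L2_B1_def)
  \<comment> \<open>A majorant from Young's inequality for both products; the coefficient
    \<open>1 / 4\<close> makes the absorption possible.\<close>
  define R where "R = (\<lambda>x. (2 * (norm (Z x - g x))\<^sup>2 + 2 * (norm (g x))\<^sup>2 + 1 / 4 * (norm (X x))\<^sup>2)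
      + (1 + (M\<^sup>2 / 2) * (norm (psi i x - radial U x))\<^sup>2 + (M\<^sup>2 / 2) * (norm (phi n x - radial U x))\<^sup>2))"
  have Ri: "set_integrable lebesgue B1 R"
    unfolding R_def by (intro set_integral_add(1) set_integrable_mult_right I1 I2 I3 I4 I5 Xi)
  have pt: "Z x \<bullet> X x + (psi i x * D x - phi n x * D x) \<le> R x" for x
  proof -
    have "Z x \<bullet> X x \<le> norm (Z x) * norm (X x)" by (rule norm_cauchy_schwarz)
    also have "\<dots> \<le> (norm (Z x))\<^sup>2 + 1 / 4 * (norm (X x))\<^sup>2"
      using zero_le_power2[of "norm (Z x) - norm (X x) / 2"] by (simp add: power2_diff power_divide)
    also have "(norm (Z x))\<^sup>2 \<le> 2 * (norm (Z x - g x))\<^sup>2 + 2 * (norm (g x))\<^sup>2"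
    proof -
      have "(norm (Z x))\<^sup>2 \<le> (norm (Z x - g x) + norm (g x))\<^sup>2"
        using norm_triangle_ineq[of "Z x - g x" "g x"] by (intro power_mono) auto
      also have "\<dots> \<le> 2 * (norm (Z x - g x))\<^sup>2 + 2 * (norm (g x))\<^sup>2"
        using zero_le_power2[of "norm (Z x - g x) - norm (g x)"] by (simp add: power2_sum power2_diff)
      finally show ?thesis .
    qed
    finally have 1: "Z x \<bullet> X x \<le> 2 * (norm (Z x - g x))\<^sup>2 + 2 * (norm (g x))\<^sup>2 + 1 / 4 * (norm (X x))\<^sup>2" by simp
    define s t where "s = psi i x - radial U x" and "t = phi n x - radial U x"
    have "psi i x * D x - phi n x * D x = (s - t) * D x" by (simp add: s_def t_def algebra_simps)
    also have "\<dots> \<le> \<bar>s - t\<bar> * M"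
      by (rule order_trans[OF abs_ge_self]) (use M(2)[of x] in \<open>simp add: abs_mult mult_left_mono\<close>)
    also have "\<dots> \<le> 1 + (M * \<bar>s - t\<bar>)\<^sup>2 / 4"
      using zero_le_power2[of "M * \<bar>s - t\<bar> / 2 - 1"] by (simp add: power2_diff power_divide mult.commute)
    also have "(M * \<bar>s - t\<bar>)\<^sup>2 / 4 \<le> (M\<^sup>2 / 2) * s\<^sup>2 + (M\<^sup>2 / 2) * t\<^sup>2"
    proof -
      have "(s - t)\<^sup>2 \<le> 2 * s\<^sup>2 + 2 * t\<^sup>2"
        using zero_le_power2[of "s + t"] by (simp add: power2_sum power2_diff)
      then have "M\<^sup>2 * (s - t)\<^sup>2 \<le> M\<^sup>2 * (2 * s\<^sup>2 + 2 * t\<^sup>2)" by (intro mult_left_mono) auto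
      then show ?thesis by (simp add: power_mult_distrib algebra_simps)
    qed
    finally have "psi i x * D x - phi n x * D x \<le> 1 + (M\<^sup>2 / 2) * s\<^sup>2 + (M\<^sup>2 / 2) * t\<^sup>2" by simp
    then show ?thesis using 1 unfolding R_def s_def t_def by simp
  qed
  define A where "A = (LINT x:B1|lebesgue. (norm (X x))\<^sup>2)"
  have "A \<le> (LINT x:B1|lebesgue. Y x \<bullet> X x)"
    unfolding A_def by (intro set_integral_mono Xi B XY)
  also have "\<dots> = (LINT x:B1|lebesgue. Z x \<bullet> X x + (psi i x * D x - phi n x * D x))"
  proof -
    have "(LINT x:B1|lebesgue. Z x \<bullet> X x + (psi i x * D x - phi n x * D x))
        = (LINT x:B1|lebesgue. Z x \<bullet> X x) + ((LINT x:B1|lebesgue. psi i x * D x) - (LINT x:B1|lebesgue. phi n x * D x))"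
      by (simp add: B BD)
    then show ?thesis using B BD gn(3) gi(3) by simp
  qed
  also have "\<dots> \<le> (LINT x:B1|lebesgue. R x)"
    by (intro set_integral_mono pt Ri set_integral_add(1) set_integral_diff(1) B BD)
  also have "\<dots> = (2 * (LINT x:B1|lebesgue. (norm (Z x - g x))\<^sup>2) + 2 * (LINT x:B1|lebesgue. (norm (g x))\<^sup>2) + 1 / 4 * A)
      + ((LINT x:B1|lebesgue. 1) + (M\<^sup>2 / 2) * (LINT x:B1|lebesgue. (norm (psi i x - radial U x))\<^sup>2)
        + (M\<^sup>2 / 2) * (LINT x:B1|lebesgue. (norm (phi n x - radial U x))\<^sup>2))"
  proof -
    note si = set_integral_add(1) set_integrable_mult_right I1 I2 I3 I4 I5 Xi
    have "(LINT x:B1|lebesgue. R x)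
        = (LINT x:B1|lebesgue. 2 * (norm (Z x - g x))\<^sup>2 + 2 * (norm (g x))\<^sup>2 + 1 / 4 * (norm (X x))\<^sup>2)
        + (LINT x:B1|lebesgue. 1 + (M\<^sup>2 / 2) * (norm (psi i x - radial U x))\<^sup>2 + (M\<^sup>2 / 2) * (norm (phi n x - radial U x))\<^sup>2)"
      unfolding R_def by (rule set_integral_add(2)) (intro si)+
    also have "(LINT x:B1|lebesgue. 2 * (norm (Z x - g x))\<^sup>2 + 2 * (norm (g x))\<^sup>2 + 1 / 4 * (norm (X x))\<^sup>2)
        = (LINT x:B1|lebesgue. 2 * (norm (Z x - g x))\<^sup>2 + 2 * (norm (g x))\<^sup>2) + (LINT x:B1|lebesgue. 1 / 4 * (norm (X x))\<^sup>2)"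
      by (rule set_integral_add(2)) (intro si)+
    also have "(LINT x:B1|lebesgue. 2 * (norm (Z x - g x))\<^sup>2 + 2 * (norm (g x))\<^sup>2)
        = (LINT x:B1|lebesgue. 2 * (norm (Z x - g x))\<^sup>2) + (LINT x:B1|lebesgue. 2 * (norm (g x))\<^sup>2)"
      by (rule set_integral_add(2)) (intro si)+
    also have "(LINT x:B1|lebesgue. 1 + (M\<^sup>2 / 2) * (norm (psi i x - radial U x))\<^sup>2 + (M\<^sup>2 / 2) * (norm (phi n x - radial U x))\<^sup>2)
        = (LINT x:B1|lebesgue. 1 + (M\<^sup>2 / 2) * (norm (psi i x - radial U x))\<^sup>2) + (LINT x:B1|lebesgue. (M\<^sup>2 / 2) * (norm (phi n x - radial U x))\<^sup>2)"
      by (rule set_integral_add(2)) (intro si)+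
    also have "(LINT x:B1|lebesgue. 1 + (M\<^sup>2 / 2) * (norm (psi i x - radial U x))\<^sup>2)
        = (LINT x:B1|lebesgue. 1) + (LINT x:B1|lebesgue. (M\<^sup>2 / 2) * (norm (psi i x - radial U x))\<^sup>2)"
      by (rule set_integral_add(2)) (intro si)+
    finally show ?thesis
      unfolding A_def by (simp only: set_integral_mult_right)
  qed
  finally have "A \<le> 2 * (LINT x:B1|lebesgue. (norm (Z x - g x))\<^sup>2) + 2 * (LINT x:B1|lebesgue. (norm (g x))\<^sup>2) + 1 / 4 * A
      + (LINT x:B1|lebesgue. 1) + (M\<^sup>2 / 2) * (LINT x:B1|lebesgue. (norm (psi i x - radial U x))\<^sup>2)
        + (M\<^sup>2 / 2) * (LINT x:B1|lebesgue. (norm (phi n x - radial U x))\<^sup>2)" by simp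
  moreover have "(M\<^sup>2 / 2) * (LINT x:B1|lebesgue. (norm (psi i x - radial U x))\<^sup>2) \<le> (M\<^sup>2 / 2) * eta"
    "(M\<^sup>2 / 2) * (LINT x:B1|lebesgue. (norm (phi n x - radial U x))\<^sup>2) \<le> (M\<^sup>2 / 2) * eta"
    using i n by (intro mult_left_mono; simp)+
  moreover have "(LINT x:B1|lebesgue. (norm (Z x - g x))\<^sup>2) < 1" using i by (simp add: Z_def)
  ultimately have "A \<le> 2 + 2 * (LINT x:B1|lebesgue. (norm (g x))\<^sup>2) + 1 / 4 * A + (LINT x:B1|lebesgue. 1) + M\<^sup>2 * eta"
    by simp
  then have "A \<le> 4 / 3 * (2 + 2 * (LINT x:B1|lebesgue. (norm (g x))\<^sup>2) + (LINT x:B1|lebesgue. 1) + 1)"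
    using eta(2) by simp
  then show ?thesis by (simp add: A_def X_def phi_def)
qed

text \<open>Fatou's lemma passes the uniform bound on the truncations to the Dirichlet integral of
  \<open>U\<close>. For \<open>2 e \<ge> - 1\<close> this integral dominates a multiple of the
  divergent integral of \<open>1 / (r (1 - ln r))\<close>.\<close>

theorem not_H10_radial:
  assumes e: "- 1 \<le> 2 * e"
  shows "\<not> H10_B1 (radial U)"
proof
  assume "H10_B1 (radial U)"
  then obtain g psi where H: "L2_B1 g" "\<And>n. test_function (psi n)"
    "(\<lambda>n. LINT x:B1|lebesgue. (norm (psi n x - radial U x))\<^sup>2) \<longlonglongrightarrow> 0"
    "(\<lambda>n. LINT x:B1|lebesgue. (norm (gradient (psi n) x - g x))\<^sup>2) \<longlonglongrightarrow> 0"
    unfolding H10_B1_def by blast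
  define K where "K = 4 / 3 * (2 + 2 * (LINT x:B1|lebesgue. (norm (g x))\<^sup>2) + (LINT x:B1|lebesgue. 1::real) + 1)"
  define G where "G = (\<lambda>n x. gradient (\<lambda>x. Phi (Suc n) (x \<bullet> x)) x)"
  have Gc: "continuous_on UNIV (G n)" for n
    unfolding G_def using Phi_test_function[of "Suc n"] unfolding test_function_def
    by (intro gradient_continuous) blast
  have Gi: "set_integrable lebesgue B1 (\<lambda>x. (norm (G n x))\<^sup>2)" for n
    using L2_continuous[OF Gc] by (simp add: L2_B1_def)
  have GK: "(LINT x:B1|lebesgue. (norm (G n x))\<^sup>2) \<le> K" for n
    unfolding G_def K_def by (rule energy_bound[OF _ H]) simp
  have GKn: "(\<integral>\<^sup>+x. ennreal (indicator B1 x *\<^sub>R (norm (G n x))\<^sup>2) \<partial>lebesgue) \<le> ennreal K" for n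
  proof -
    have "(\<integral>\<^sup>+x. ennreal (indicator B1 x *\<^sub>R (norm (G n x))\<^sup>2) \<partial>lebesgue)
        = ennreal (integral\<^sup>L lebesgue (\<lambda>x. indicator B1 x *\<^sub>R (norm (G n x))\<^sup>2))"
      using Gi[of n] unfolding set_integrable_def by (intro nn_integral_eq_integral) auto
    also have "\<dots> \<le> ennreal K" using GK[of n] by (intro ennreal_leI) (simp add: set_lebesgue_integral_def)
    finally show ?thesis .
  qed
  define f where "f = (\<lambda>r::real. (c * (1 - ln r) powr e / r)\<^sup>2)"
  have "(\<integral>\<^sup>+x. ennreal (f (norm x)) * indicator B1 x \<partial>(lborel :: (real^2) measure))
      = (\<integral>\<^sup>+x. ennreal (f (norm x)) * indicator B1 x \<partial>lebesgue)"
    by (simp add: nn_integral_completion)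
  also have "\<dots> = (\<integral>\<^sup>+x. liminf (\<lambda>n. ennreal (indicator B1 x *\<^sub>R (norm (G n x))\<^sup>2)) \<partial>lebesgue)"
  proof (rule nn_integral_cong_AE)
    show "AE x in lebesgue. ennreal (f (norm x)) * indicator B1 x
        = liminf (\<lambda>n. ennreal (indicator B1 x *\<^sub>R (norm (G n x))\<^sup>2))"
      using AE_lebesgue_neq_0
    proof eventually_elim
      case (elim x)
      show ?case
      proof (cases "x \<in> B1")
        case True
        have eq: "(norm (G n x))\<^sup>2 = (kap (Suc n) ((norm x)\<^sup>2) * norm (gradU x))\<^sup>2" for n
          unfolding G_def gradient_Phi_gradU[OF zero_less_Suc elim]
          by (simp add: power_mult_distrib power2_norm_eq_inner)
        have "(\<lambda>n. (kap (Suc n) ((norm x)\<^sup>2) * norm (gradU x))\<^sup>2) \<longlonglongrightarrow> (1 * norm (gradU x))\<^sup>2"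
          by (intro tendsto_intros kap_tendsto) (use elim True in \<open>auto simp: abs_square_less_1\<close>)
        then have "(\<lambda>n. ennreal ((norm (G n x))\<^sup>2)) \<longlonglongrightarrow> ennreal (f (norm x))"
          unfolding eq by (intro tendsto_ennrealI) (simp add: norm_gradU[OF elim] f_def)
        then have "liminf (\<lambda>n. ennreal ((norm (G n x))\<^sup>2)) = ennreal (f (norm x))"
          by (intro lim_imp_Liminf) auto
        then show ?thesis using True by simp
      qed (simp add: Liminf_const)
    qed
  qed
  also have "\<dots> \<le> liminf (\<lambda>n. \<integral>\<^sup>+x. ennreal (indicator B1 x *\<^sub>R (norm (G n x))\<^sup>2) \<partial>lebesgue)"
  proof (rule nn_integral_liminf)
    fix n
    have "(\<lambda>x. indicator B1 x *\<^sub>R (norm (G n x))\<^sup>2) \<in> borel_measurable lebesgue"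
      using Gi[of n] by (auto simp: set_integrable_def)
    then show "(\<lambda>x. ennreal (indicator B1 x *\<^sub>R (norm (G n x))\<^sup>2)) \<in> borel_measurable lebesgue" by simp
  qed
  also have "\<dots> \<le> liminf (\<lambda>n::nat. ennreal K)"
    by (intro Liminf_mono eventuallyI) (rule GKn)
  also have "\<dots> = ennreal K" by (simp add: Liminf_const)
  finally have fin: "(\<integral>\<^sup>+x. ennreal (f (norm x)) * indicator B1 x \<partial>(lborel :: (real^2) measure)) \<le> ennreal K" .
  have "(\<integral>\<^sup>+x. ennreal (f (norm x)) * indicator B1 x \<partial>(lborel :: (real^2) measure))
      = (\<integral>\<^sup>+r. ennreal (f r) * (ennreal (2 * pi * r) * indicator {0<..<1} r) \<partial>lborel)"
    by (rule nn_integral_radial) (auto simp: f_def)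
  with fin have fin: "(\<integral>\<^sup>+r. ennreal (f r) * (ennreal (2 * pi * r) * indicator {0<..<1} r) \<partial>lborel) \<le> ennreal K"
    by simp
  \<comment> \<open>Chosen so that the integral of \<open>2 pi c^2 / (r (1 - ln r))\<close> from
    \<open>a\<close> to \<open>1\<close> is \<open>|K| + 1\<close>.\<close>
  define a where "a = exp (1 - exp ((\<bar>K\<bar> + 1) / (2 * pi * c\<^sup>2)))"
  have a: "0 < a" "a < 1" using c by (auto simp: a_def)
  have pos: "1 \<le> 1 - ln r" if "0 < r" "r \<le> 1" for r :: real
  proof -
    have "ln r \<le> 0" using that by simp
    then show ?thesis by linarith
  qed
  have "(\<integral>\<^sup>+r. ennreal (2 * pi * c\<^sup>2 / (r * (1 - ln r))) * indicator {a..1} r \<partial>lborel)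
      = ennreal (- (2 * pi * c\<^sup>2) * ln (1 - ln 1) - - (2 * pi * c\<^sup>2) * ln (1 - ln a))"
  proof (rule nn_integral_FTC_Icc[where F = "\<lambda>r. - (2 * pi * c\<^sup>2) * ln (1 - ln r)"])
    fix r assume "r \<in> {a..1}"
    then have r: "a \<le> r" "r \<le> 1" by auto
    then have r0: "0 < r" using a by simp
    have t: "0 < 1 - ln r" using pos[OF r0 r(2)] by simp
    have "((\<lambda>r. 1 - ln r) has_real_derivative - inverse r) (at r)"
      by (rule DERIV_cong[OF DERIV_diff[OF DERIV_const DERIV_ln[OF r0]]]) simp
    from DERIV_chain2[where f = ln, OF DERIV_ln[OF t] this]
    have "((\<lambda>r. ln (1 - ln r)) has_real_derivative inverse (1 - ln r) * - inverse r) (at r)" .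
    then show "((\<lambda>r. - (2 * pi * c\<^sup>2) * ln (1 - ln r)) has_real_derivative 2 * pi * c\<^sup>2 / (r * (1 - ln r))) (at r)"
      by (rule DERIV_cong[OF DERIV_cmult]) (simp add: divide_inverse)
    show "0 \<le> 2 * pi * c\<^sup>2 / (r * (1 - ln r))" using r0 t by simp
  qed (use a in auto)
  moreover have "- (2 * pi * c\<^sup>2) * ln (1 - ln 1) - - (2 * pi * c\<^sup>2) * ln (1 - ln a) = \<bar>K\<bar> + 1"
    using c by (simp add: a_def)
  moreover have "(\<integral>\<^sup>+r. ennreal (2 * pi * c\<^sup>2 / (r * (1 - ln r))) * indicator {a..1} r \<partial>lborel)
      \<le> (\<integral>\<^sup>+r. ennreal (f r) * (ennreal (2 * pi * r) * indicator {0<..<1} r) \<partial>lborel)"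
  proof (rule nn_integral_mono_AE)
    have "AE r in lborel. r \<notin> {1::real}"
      by (rule AE_not_in) (auto intro: finite_imp_null_set_lborel)
    then show "AE r in lborel. ennreal (2 * pi * c\<^sup>2 / (r * (1 - ln r))) * indicator {a..1} r
        \<le> ennreal (f r) * (ennreal (2 * pi * r) * indicator {0<..<1} r)"
    proof eventually_elim
      case (elim r)
      show ?case
      proof (cases "r \<in> {a..1}")
        case True
        then have r: "0 < r" "r < 1" using a elim by auto
        have t: "1 \<le> 1 - ln r" using pos[of r] r by simp
        have "(1 - ln r) powr (- 1) \<le> (1 - ln r) powr (2 * e)" using t e by (intro powr_mono) auto
        moreover have "((1 - ln r) powr e)\<^sup>2 = (1 - ln r) powr (2 * e)"
          using t by (simp add: power2_eq_square flip: powr_add)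
        moreover have "(1 - ln r) powr (- 1) = 1 / (1 - ln r)" using t by (simp add: powr_minus_divide)
        ultimately have "1 / (1 - ln r) \<le> ((1 - ln r) powr e)\<^sup>2" by simp
        then have "(2 * pi * c\<^sup>2 / r) * (1 / (1 - ln r)) \<le> (2 * pi * c\<^sup>2 / r) * ((1 - ln r) powr e)\<^sup>2"
          by (rule mult_left_mono) (use r in simp)
        also have "\<dots> = f r * (2 * pi * r)" using r by (simp add: f_def power_mult_distrib power_divide power2_eq_square)
        finally have "ennreal (2 * pi * c\<^sup>2 / (r * (1 - ln r))) \<le> ennreal (f r * (2 * pi * r))"
          by (intro ennreal_leI) (simp add: divide_inverse mult_ac)
        also have "\<dots> = ennreal (f r) * ennreal (2 * pi * r)" using r by (intro ennreal_mult) (auto simp: f_def)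
        finally show ?thesis using r True by simp
      qed simp
    qed
  qed
  ultimately have "ennreal (\<bar>K\<bar> + 1) \<le> ennreal K" using fin by (metis order_trans)
  moreover have "ennreal K < ennreal (\<bar>K\<bar> + 1)" by (rule ennreal_lessI) auto
  ultimately show False by (meson leD)
qed

end

section \<open>The two nonlinearities\<close>

lemma nonlinearity_exp:
  assumes "0 < k"
  shows "nonlinearity k 0 1 exp (\<lambda>x. x) (\<lambda>u. u)"
  using assms by unfold_locales (auto simp: filterlim_ident)

text \<open>The substitution is \<open>\<xi> = (p - 1) ln (1 + u)\<close>. The choice
  \<open>b = m\<close> normalises \<open>g\<close>, and \<open>p > k + 1\<close> is
  \<open>m k < 1\<close>.\<close>

lemma nonlinearity_power:
  assumes k: "0 < k" and p: "k + 1 < p"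
  shows "nonlinearity k (1 / (p - 1)) (1 / (p - 1)) (power_nl p)
    (\<lambda>x. exp (1 / (p - 1) * x) - 1) (\<lambda>u. (p - 1) * ln (1 + u))"
proof
  have p1: "0 < p - 1" using k p by simp
  show "0 < k" by (rule k)
  show "0 \<le> 1 / (p - 1)" "0 < 1 / (p - 1)" using p1 by simp_all
  show "1 / (p - 1) * k < 1" using p p1 by (simp add: divide_less_eq)
  show "exp (1 / (p - 1) * 0) - 1 = 0" by simp
  show "((\<lambda>x. exp (1 / (p - 1) * x) - 1) has_real_derivative 1 / (p - 1) * exp (1 / (p - 1) * x)) (at x)" for x
    using p1 by (auto intro!: derivative_eq_intros)
  show "power_nl p (exp (1 / (p - 1) * x) - 1) = exp ((1 + 1 / (p - 1)) * x)" for x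
  proof -
    have "p * (1 / (p - 1)) = 1 + 1 / (p - 1)" using p1 by (simp add: field_simps)
    then have "p * (1 / (p - 1) * x) = (1 + 1 / (p - 1)) * x" by (simp only: mult.assoc[symmetric])
    then show ?thesis by (simp add: power_nl_def powr_def)
  qed
  show "(p - 1) * ln (1 + (exp (1 / (p - 1) * x) - 1)) = x" for x
    using p1 by simp
  fix u :: real assume u: "0 \<le> u"
  show "exp (1 / (p - 1) * ((p - 1) * ln (1 + u))) - 1 = u" using p1 u by simp
  have e: "exp (- (1 / (p - 1) * ((p - 1) * ln (1 + u)))) = inverse (1 + u)"
    using p1 u by (simp add: exp_minus)
  have "((\<lambda>u. 1 + u) has_real_derivative 1) (at u)" by (auto intro!: derivative_eq_intros)
  from DERIV_cmult[OF DERIV_chain2[where f = ln, OF DERIV_ln this], of "p - 1"] u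
  have "((\<lambda>u. (p - 1) * ln (1 + u)) has_real_derivative (p - 1) * (inverse (1 + u) * 1)) (at u)" by simp
  then show "((\<lambda>u. (p - 1) * ln (1 + u)) has_real_derivative
      exp (- (1 / (p - 1) * ((p - 1) * ln (1 + u)))) / (1 / (p - 1))) (at u)"
    unfolding e by (simp add: mult.commute)
next
  have p1: "0 < p - 1" using k p by simp
  have "filterlim (\<lambda>u::real. ln (1 + u)) at_top at_top"
    by (intro filterlim_compose[OF ln_at_top] filterlim_tendsto_add_at_top[OF tendsto_const filterlim_ident])
  then show "filterlim (\<lambda>u. (p - 1) * ln (1 + u)) at_top at_top"
    using p1 by (intro filterlim_tendsto_pos_mult_at_top[OF tendsto_const])
qed

section \<open>From orbits to the solution curves of the theorem\<close>

lemma uniform_limit_compose_filter: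
  assumes "uniform_limit K u l G" "filterlim h G F"
  shows "uniform_limit K (\<lambda>b. u (h b)) l F"
  using assms unfolding uniform_limit_iff filterlim_iff by blast

lemma uniform_limit_eventually_eq:
  assumes "uniform_limit K u l F" "\<forall>\<^sub>F b in F. v b = u b"
  shows "uniform_limit K v l F"
  unfolding uniform_limit_iff
proof (intro allI impI)
  fix e :: real assume "0 < e"
  then have "\<forall>\<^sub>F b in F. \<forall>x\<in>K. dist (u b x) (l x) < e" using assms(1) by (simp add: uniform_limit_iff)
  then show "\<forall>\<^sub>F b in F. \<forall>x\<in>K. dist (v b x) (l x) < e"
    using assms(2) by eventually_elim simp
qed

text \<open>The power curve has parameter \<open>\<beta>\<close>, the orbit family
  \<open>h \<beta>\<close>. The two are identified only for \<open>\<beta> > 0\<close>, hence the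
  agreement up to \<open>eventually\<close>.\<close>

lemma C2_loc_limit_reparam:
  assumes "C2_loc_limit u U G" "filterlim h G F" "\<forall>\<^sub>F b in F. v b = u (h b)"
  shows "C2_loc_limit v U F"
  unfolding C2_loc_limit_def
proof (intro allI impI)
  fix K :: "real set" assume "compact K \<and> K \<subseteq> {0<..1}"
  then have K: "uniform_limit K u U G" "uniform_limit K (\<lambda>b. rderiv (u b)) (rderiv U) G"
    "uniform_limit K (\<lambda>b. rderiv (rderiv (u b))) (rderiv (rderiv U)) G"
    using assms(1) unfolding C2_loc_limit_def by blast+
  have ev: "\<forall>\<^sub>F b in F. rderiv (v b) = rderiv (u (h b))"
    "\<forall>\<^sub>F b in F. rderiv (rderiv (v b)) = rderiv (rderiv (u (h b)))"
    using assms(3) by (auto elim: eventually_mono)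
  show "uniform_limit K v U F \<and> uniform_limit K (\<lambda>b. rderiv (v b)) (rderiv U) F \<and>
      uniform_limit K (\<lambda>b. rderiv (rderiv (v b))) (rderiv (rderiv U)) F"
    by (intro conjI uniform_limit_eventually_eq[OF uniform_limit_compose_filter[OF K(1) assms(2)] assms(3)]
        uniform_limit_eventually_eq[OF uniform_limit_compose_filter[OF K(2) assms(2)] ev(1)]
        uniform_limit_eventually_eq[OF uniform_limit_compose_filter[OF K(3) assms(2)] ev(2)])
qed

lemma (in nonlinearity) singular_solution_is_unique:
  assumes "2 * m * k < 1" and U: "\<And>r. 0 < r \<Longrightarrow> r \<le> 1 \<Longrightarrow> U r = g (k * log_depth r)"
  shows "unique_radial_singular_solution k f (b * (k * (1 - m * k))) U"
  unfolding unique_radial_singular_solution_def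
proof (intro conjI allI impI ballI)
  show "radial_singular_solution k f (b * (k * (1 - m * k))) U" by (rule singular_solution[OF U])
  fix lam' U' assume sol: "radial_singular_solution k f lam' U'"
  show "lam' = b * (k * (1 - m * k))" by (rule singular_solution_unique(1)[OF assms(1) sol])
  fix r :: real assume "r \<in> {0<..1}"
  then have r: "0 < r" "r \<le> 1" by auto
  show "U' r = U r" using singular_solution_unique(2)[OF assms(1) sol r] U[OF r] by simp
qed

lemma exp_U_star_eq:
  assumes "0 < r"
  shows "exp_U_star k r = k * log_depth r"
  using assms by (simp only: exp_U_star_def neg_ln_div_exp log_depth_def)

lemma power_U_star_eq:
  assumes "0 < r" "r \<le> 1"
  shows "power_U_star k p r = exp (1 / (p - 1) * (k * log_depth r)) - 1"
proof -
  have "ln r \<le> 0" using assms by simp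
  then have "(1 - ln r) powr (k / (p - 1)) = exp (k / (p - 1) * ln (1 - ln r))" by (simp add: powr_def)
  then show ?thesis unfolding power_U_star_def neg_ln_div_exp[OF assms(1)] log_depth_def by simp
qed

text \<open>With \<open>b = 1\<close> and \<open>L\<close> the identity, the parameter
  \<open>l\<close> of the orbit family is \<open>\<beta>\<close> itself. Existence and uniqueness
  for each \<open>l\<close> evaluate the \<open>THE\<close>.\<close>

lemma exp_curve_limit:
  assumes k: "0 < k"
  shows "((\<lambda>\<beta>. fst (exp_curve k \<beta>)) \<longlongrightarrow> k) at_top"
    and "C2_loc_limit (\<lambda>\<beta>. snd (exp_curve k \<beta>)) (exp_U_star k) at_top"
proof -
  obtain y Q where yQ: "\<And>a. orbit k 0 a y Q" "\<And>s. 0 < Q s"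
    "((\<lambda>s. y s + k * s) \<longlongrightarrow> 0) at_top" "(Q \<longlongrightarrow> 0) at_top"
    using regular_orbit_exists[of 0 k] k by auto
  interpret regular_curve k 0 1 exp "\<lambda>x. x" "\<lambda>u. u" y Q
    using yQ by (intro regular_curve.intro nonlinearity_exp k regular_curve_axioms.intro) auto
  have curve: "exp_curve k \<beta> = (curve_lam y \<beta>, curve_profile y \<beta>)" for \<beta>
    unfolding exp_curve_def
  proof (rule the_equality)
    show "radial_solution k exp (fst (curve_lam y \<beta>, curve_profile y \<beta>)) (snd (curve_lam y \<beta>, curve_profile y \<beta>)) \<and>
      snd (curve_lam y \<beta>, curve_profile y \<beta>) \<in> extensional {0..1} \<and>
      snd (curve_lam y \<beta>, curve_profile y \<beta>) 0 + ln (fst (curve_lam y \<beta>, curve_profile y \<beta>)) = \<beta>"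
      using curve_solution[of \<beta>] by simp
    fix s :: "real \<times> (real \<Rightarrow> real)"
    assume s: "radial_solution k exp (fst s) (snd s) \<and> snd s \<in> extensional {0..1} \<and> snd s 0 + ln (fst s) = \<beta>"
    then show "s = (curve_lam y \<beta>, curve_profile y \<beta>)"
      using curve_unique[of "fst s" "snd s" \<beta>] by (simp add: prod_eq_iff)
  qed
  show "((\<lambda>\<beta>. fst (exp_curve k \<beta>)) \<longlongrightarrow> k) at_top"
    using curve_limit(1) by (simp add: curve)
  show "C2_loc_limit (\<lambda>\<beta>. snd (exp_curve k \<beta>)) (exp_U_star k) at_top"
    using curve_limit(2)[of "exp_U_star k"] by (simp add: curve exp_U_star_eq)
qed

lemma power_curve_limit:
  assumes k: "0 < k" and p: "p_c k < p"
  shows "((\<lambda>\<beta>. fst (power_curve k p \<beta>)) \<longlongrightarrow> power_lam_star k p) at_top"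
    and "C2_loc_limit (\<lambda>\<beta>. snd (power_curve k p \<beta>)) (power_U_star k p) at_top"
proof -
  define m where "m = 1 / (p - 1)"
  have p1: "0 < p - 1" using k p by (simp add: p_c_def)
  have mpos: "0 < m" and "2 * m * k < 1"
    using k p p1 by (auto simp: m_def p_c_def field_simps)
  obtain y Q where yQ: "\<And>a. orbit k m a y Q" "\<And>s. 0 < Q s"
    "((\<lambda>s. y s + k * s) \<longlongrightarrow> 0) at_top" "(Q \<longlongrightarrow> 0) at_top"
    using regular_orbit_exists[of m k] k mpos \<open>2 * m * k < 1\<close> by auto
  interpret regular_curve k m m "power_nl p" "\<lambda>x. exp (m * x) - 1" "\<lambda>u. (p - 1) * ln (1 + u)" y Q
    unfolding m_def
    by (intro regular_curve.intro nonlinearity_power k regular_curve_axioms.intro)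
      (use yQ \<open>2 * m * k < 1\<close> p k in \<open>auto simp: m_def p_c_def\<close>)
  \<comment> \<open>The logarithm of the normalisation
    \<open>lam powr (1 / (p - 1)) * (v + 1) = \<beta>\<close>, multiplied by \<open>p - 1\<close>.
    The constant \<open>ln m\<close> stems from \<open>ln (lam / b)\<close> with
    \<open>b = m\<close>.\<close>
  define h where "h = (\<lambda>\<beta>::real. (p - 1) * ln \<beta> - ln m)"
  have par: "(lam powr (1 / (p - 1)) * (v + 1) = \<beta>) \<longleftrightarrow> ((p - 1) * ln (1 + v) + ln (lam / m) = h \<beta>)"
    if "0 < lam" "0 < v" "0 < \<beta>" for lam v \<beta>
  proof -
    have "(lam powr (1 / (p - 1)) * (v + 1) = \<beta>) \<longleftrightarrow> ln (lam powr (1 / (p - 1)) * (v + 1)) = ln \<beta>"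
      using that by (subst ln_inj_iff) auto
    also have "ln (lam powr (1 / (p - 1)) * (v + 1)) = ln lam / (p - 1) + ln (1 + v)"
      using that by (simp add: ln_mult ln_powr add.commute)
    also have "ln lam / (p - 1) + ln (1 + v) = ln \<beta> \<longleftrightarrow> (p - 1) * ln (1 + v) + ln (lam / m) = h \<beta>"
      using that mpos p1 by (auto simp: h_def ln_div field_simps)
    finally show ?thesis .
  qed
  have pos: "0 < lam" "0 < v 0" if "radial_solution k (power_nl p) lam v" for lam v
    using that unfolding radial_solution_def radial_pos_iff by auto
  have curve: "power_curve k p \<beta> = (curve_lam y (h \<beta>), curve_profile y (h \<beta>))" if b: "0 < \<beta>" for \<beta>
    unfolding power_curve_def
  proof (rule the_equality)
    let ?s = "(curve_lam y (h \<beta>), curve_profile y (h \<beta>))"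
    note sol = curve_solution[of "h \<beta>"]
    show "radial_solution k (power_nl p) (fst ?s) (snd ?s) \<and> snd ?s \<in> extensional {0..1} \<and>
      fst ?s powr (1 / (p - 1)) * (snd ?s 0 + 1) = \<beta>"
      using sol(1,2) par[OF pos[OF sol(1)] b] sol(3) by simp
    fix s :: "real \<times> (real \<Rightarrow> real)"
    assume s: "radial_solution k (power_nl p) (fst s) (snd s) \<and> snd s \<in> extensional {0..1} \<and>
      fst s powr (1 / (p - 1)) * (snd s 0 + 1) = \<beta>"
    then have "(p - 1) * ln (1 + snd s 0) + ln (fst s / m) = h \<beta>"
      using par[OF pos b] by blast
    then show "s = ?s"
      using curve_unique[of "fst s" "snd s" "h \<beta>"] s by (simp add: prod_eq_iff)
  qed
  have ev: "\<forall>\<^sub>F \<beta> in at_top. power_curve k p \<beta> = (curve_lam y (h \<beta>), curve_profile y (h \<beta>))"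
    using eventually_gt_at_top[of 0] by eventually_elim (rule curve)
  have "filterlim (\<lambda>\<beta>::real. (p - 1) * ln \<beta>) at_top at_top"
    using p1 ln_at_top by (intro filterlim_tendsto_pos_mult_at_top[OF tendsto_const])
  then have "filterlim (\<lambda>\<beta>::real. - ln m + (p - 1) * ln \<beta>) at_top at_top"
    by (rule filterlim_tendsto_add_at_top[OF tendsto_const])
  then have h: "filterlim h at_top at_top" by (simp add: h_def)
  have "((\<lambda>\<beta>. curve_lam y (h \<beta>)) \<longlongrightarrow> m * (k * (1 - m * k))) at_top"
    by (rule filterlim_compose[OF curve_limit(1) h])
  then have "((\<lambda>\<beta>. fst (power_curve k p \<beta>)) \<longlongrightarrow> m * (k * (1 - m * k))) at_top"
    by (rule Lim_transform_eventually) (use ev in \<open>auto elim: eventually_mono\<close>)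
  then show "((\<lambda>\<beta>. fst (power_curve k p \<beta>)) \<longlongrightarrow> power_lam_star k p) at_top"
    by (simp add: power_lam_star_def m_def)
  have "C2_loc_limit (curve_profile y) (power_U_star k p) at_top"
    by (rule curve_limit(2)) (simp add: power_U_star_eq m_def)
  then show "C2_loc_limit (\<lambda>\<beta>. snd (power_curve k p \<beta>)) (power_U_star k p) at_top"
    by (rule C2_loc_limit_reparam[OF _ h]) (use ev in \<open>auto elim: eventually_mono\<close>)
qed

lemma H10_exp_U_star:
  assumes k: "0 < k"
  shows "H10_B1 (radial (exp_U_star k))"
proof -
  interpret log_profile k "-1" k "exp_U_star k"
  proof
    fix r :: real assume r: "0 < r" "r \<le> 1"
    have "ln r \<le> 0" using r by simp
    then have t: "1 \<le> 1 - ln r" by simp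
    have "((\<lambda>r. k * log_depth r) has_real_derivative k * (- 1 / (r * exp (log_depth r)))) (at r)"
      by (intro DERIV_cmult log_depth_deriv r)
    then have "(exp_U_star k has_real_derivative k * (- 1 / (r * exp (log_depth r)))) (at r)"
      by (rule has_field_derivative_transform_within_open[of _ _ _ "{0<..}"]) (use r in \<open>auto simp: exp_U_star_eq\<close>)
    then show "(exp_U_star k has_real_derivative - (k * (1 - ln r) powr (- 1) / r)) (at r)"
    proof (rule DERIV_cong)
      have "x powr (- 1) = inverse x" if "1 \<le> x" for x :: real using that by (simp add: powr_minus)
      then show "k * (- 1 / (r * exp (log_depth r))) = - (k * (1 - ln r) powr (- 1) / r)"
        using t r by (simp only: exp_log_depth) (simp add: divide_inverse)
    qed
    have "ln (1 - ln r) \<le> 1 - ln r" using t ln_le_minus_one[of "1 - ln r"] by linarith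
    then show "exp_U_star k r \<le> k * (1 - ln r)"
      using k r by (simp add: exp_U_star_eq log_depth_def)
  qed (use k exp_U_star_eq[of 1 k] in auto)
  show ?thesis by (rule H10_radial) simp
qed

text \<open>With exponent \<open>e = \<theta> - 1\<close> the criterion \<open>2 e < - 1\<close>
  reads \<open>\<theta> < 1 / 2\<close>, that is, \<open>p > 2 k + 1\<close>.\<close>

lemma H10_power_U_star_iff:
  assumes k: "0 < k" and p: "p_s k < p"
  shows "H10_B1 (radial (power_U_star k p)) \<longleftrightarrow> p_c k < p"
proof -
  define \<theta> where "\<theta> = k / (p - 1)"
  have p1: "0 < p - 1" using k p by (simp add: p_s_def)
  have \<theta>: "0 < \<theta>" "\<theta> < 1" using k p p1 by (auto simp: \<theta>_def p_s_def)
  have pos: "1 \<le> 1 - ln r" if "0 < r" "r \<le> 1" for r :: real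
  proof -
    have "ln r \<le> 0" using that by simp
    then show ?thesis by simp
  qed
  have U: "power_U_star k p r = (1 - ln r) powr \<theta> - 1" if "0 < r" for r
    unfolding power_U_star_def neg_ln_div_exp[OF that] \<theta>_def ..
  interpret log_profile \<theta> "\<theta> - 1" 1 "power_U_star k p"
  proof
    fix r :: real assume r: "0 < r" "r \<le> 1"
    note t = pos[OF r]
    have "((\<lambda>r. 1 - ln r) has_real_derivative - inverse r) (at r)"
      by (rule DERIV_cong[OF DERIV_diff[OF DERIV_const DERIV_ln[OF r(1)]]]) simp
    from DERIV_chain2[where f = "\<lambda>z. z powr \<theta>", OF has_real_derivative_powr this] t
    have "((\<lambda>r. (1 - ln r) powr \<theta>) has_real_derivative \<theta> * (1 - ln r) powr (\<theta> - 1) * - inverse r) (at r)"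
      by simp
    then have "((\<lambda>r. (1 - ln r) powr \<theta> - 1) has_real_derivative - (\<theta> * (1 - ln r) powr (\<theta> - 1) / r)) (at r)"
      by (intro DERIV_cong[OF DERIV_diff[OF _ DERIV_const]]) (auto simp: divide_inverse)
    then show "(power_U_star k p has_real_derivative - (\<theta> * (1 - ln r) powr (\<theta> - 1) / r)) (at r)"
      by (rule has_field_derivative_transform_within_open[of _ _ _ "{0<..}"]) (use r U in auto)
    have "(1 - ln r) powr \<theta> \<le> (1 - ln r) powr 1" using t \<theta> by (intro powr_mono) auto
    then show "power_U_star k p r \<le> 1 * (1 - ln r)" using t U[OF r(1)] by simp
  qed (use \<theta> U[of 1] in auto)
  have "p_c k < p \<longleftrightarrow> 2 * (\<theta> - 1) < - 1" using p1 by (auto simp: \<theta>_def p_c_def field_simps)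
  moreover have "- 1 \<le> 2 * (\<theta> - 1)" if "\<not> 2 * (\<theta> - 1) < - 1" using that by simp
  ultimately show ?thesis using H10_radial not_H10_radial by blast
qed

theorem theorem1p3:
  fixes k :: real
  assumes "k > 0"
  shows
    "(unique_radial_singular_solution k exp k (exp_U_star k) \<and>
      H10_B1 (radial (exp_U_star k)) \<and>
      ((\<lambda>\<beta>. fst (exp_curve k \<beta>)) \<longlongrightarrow> k) at_top \<and>
      C2_loc_limit (\<lambda>\<beta>. snd (exp_curve k \<beta>)) (exp_U_star k) at_top) \<and>
     (\<forall>p::real. p > p_s k \<longrightarrow>
        radial_singular_solution k (power_nl p) (power_lam_star k p) (power_U_star k p) \<and>
        (H10_B1 (radial (power_U_star k p)) \<longleftrightarrow> p > p_c k) \<and>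
        (p > p_c k \<longrightarrow>
           unique_radial_singular_solution k (power_nl p) (power_lam_star k p) (power_U_star k p) \<and>
           ((\<lambda>\<beta>. fst (power_curve k p \<beta>)) \<longlongrightarrow> power_lam_star k p) at_top \<and>
           C2_loc_limit (\<lambda>\<beta>. snd (power_curve k p \<beta>)) (power_U_star k p) at_top))"
proof (intro conjI allI impI)
  interpret E: nonlinearity k 0 1 exp "\<lambda>x. x" "\<lambda>u. u" by (rule nonlinearity_exp[OF assms])
  show "unique_radial_singular_solution k exp k (exp_U_star k)"
    using E.singular_solution_is_unique[of "exp_U_star k"] by (simp add: exp_U_star_eq)
  show "H10_B1 (radial (exp_U_star k))" by (rule H10_exp_U_star[OF assms])
  show "((\<lambda>\<beta>. fst (exp_curve k \<beta>)) \<longlongrightarrow> k) at_top"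
    and "C2_loc_limit (\<lambda>\<beta>. snd (exp_curve k \<beta>)) (exp_U_star k) at_top"
    by (rule exp_curve_limit[OF assms])+
  fix p :: real assume p: "p > p_s k"
  interpret P: nonlinearity k "1 / (p - 1)" "1 / (p - 1)" "power_nl p" "\<lambda>x. exp (1 / (p - 1) * x) - 1"
      "\<lambda>u. (p - 1) * ln (1 + u)"
    by (rule nonlinearity_power[OF assms]) (use p in \<open>simp add: p_s_def\<close>)
  have lam: "1 / (p - 1) * (k * (1 - 1 / (p - 1) * k)) = power_lam_star k p"
    by (simp add: power_lam_star_def)
  show "radial_singular_solution k (power_nl p) (power_lam_star k p) (power_U_star k p)"
    unfolding lam[symmetric] by (rule P.singular_solution[OF power_U_star_eq])
  show "H10_B1 (radial (power_U_star k p)) \<longleftrightarrow> p > p_c k" by (rule H10_power_U_star_iff[OF assms p])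
  assume pc: "p > p_c k"
  have "2 * (1 / (p - 1)) * k < 1" using pc assms by (simp add: p_c_def field_simps)
  then show "unique_radial_singular_solution k (power_nl p) (power_lam_star k p) (power_U_star k p)"
    unfolding lam[symmetric] by (rule P.singular_solution_is_unique[OF _ power_U_star_eq])
  show "((\<lambda>\<beta>. fst (power_curve k p \<beta>)) \<longlongrightarrow> power_lam_star k p) at_top"
    and "C2_loc_limit (\<lambda>\<beta>. snd (power_curve k p \<beta>)) (power_U_star k p) at_top"
    by (rule power_curve_limit[OF assms pc])+
qed

end
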